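(* Let $\mathcal{H}$ be a reproducing kernel Hilbert space on a set $X$ whose reproducing kernel is a normalized complete Pick kernel, and let $\Lambda:\mathcal{H}\to\mathbb{C}$ be a linear functional (not assumed continuous) such that $\Lambda\not\equiv 0$. The following statements are equivalent: (i) $\Lambda(1)=1$ and $\Lambda(f)\neq 0$ for all cyclic elements $f\in\mathcal{H}$. (ii) $\Lambda(fg)=\Lambda(f)\Lambda(g)$ for all $f,g\in\mathcal{H}$ such that $fg\in\mathcal{H}$. Moreover, a functional $\Lambda$ satisfying (i) or (ii) is automatically continuous on $\mathcal{H}$.
   Context: A reproducing kernel Hilbert space (RKHS) on a set $X$ is a complex Hilbert space $\mathcal{H}$ of functions $X\to\mathbb{C}$ (with pointwise operations) such that, for each $x\in X$, the evaluation functional $f\mapsto f(x)$ is continuous on $\mathcal{H}$. For $x\in X$ let $k_x\in\mathcal{H}$ be the unique element with $f(x)=\langle f,k_x\rangle$ for all $f\in\mathcal{H}$. The reproducing kernel of $\mathcal{H}$ is $K:X\times X\to\mathbb{C}$, $K(x,y):=k_y(x)=\langle k_y,k_x\rangle$. It is always assumed that $K(x,x)>0$ for all $x\in X$. A function $F:X\times X\to\mathbb{C}$ is positive semi-definite if for every finite subset $\{x_1,\dots,x_n\}\subset X$ the matrix $(F(x_i,x_j))_{i,j}$ is positive semi-definite. The kernel $K$ is a complete Pick kernel if $K(x,y)\neq 0$ for all $x,y\in X$ and there exists $x_0\in X$ such that $$F(x,y):=1-\frac{K(x,x_0)K(x_0,y)}{K(x,y)K(x_0,x_0)}$$ is positive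 semi-definite on $X\times X$ (if this holds for one $x_0\in X$, it holds for all $x_0\in X$). The kernel $K$ is normalized if there exists $x_0\in X$ such that $K(x,x_0)=1$ for all $x\in X$. In that case $\mathcal{H}$ contains the constant functions; $1$ denotes the constant function with value $1$. A multiplier of $\mathcal{H}$ is a function $h:X\to\mathbb{C}$ such that $hf\in\mathcal{H}$ for all $f\in\mathcal{H}$; $\mathcal{M}$ denotes the set of multipliers. An element $f\in\mathcal{H}$ is cyclic if the closure in $\mathcal{H}$ of $\mathcal{M}f=\{hf:h\in\mathcal{M}\}$ is all of $\mathcal{H}$. Products $fg$ of functions are pointwise products on $X$. *)

theory Defs
  imports
    "HOL-Analysis.Analysis"
    "HOL-Library.Function_Algebras"
    "HOL-Library.Complex_Order"
begin

text \<open>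
  The set on which the functions live is the type \<open>'x\<close>.  A space of functions is given by
  its carrier \<open>H\<close> and its inner product \<open>ip\<close> (linear in the first argument); the values of
  \<open>ip\<close> at functions outside \<open>H\<close> are irrelevant.  Sums, products and the constants \<open>0\<close>, \<open>1\<close>
  on functions are the pointwise ones of \<^theory>\<open>HOL-Library.Function_Algebras\<close>, and the order on
  the complex numbers is that of \<^theory>\<open>HOL-Library.Complex_Order\<close>: \<open>0 \<le> z\<close> (or \<open>0 < z\<close>) says
  that \<open>z\<close> is real and nonnegative (or positive).
\<close>

locale function_pre_hilbert =
  fixes H :: "('x \<Rightarrow> complex) set"
    and ip :: "('x \<Rightarrow> complex) \<Rightarrow> ('x \<Rightarrow> complex) \<Rightarrow> complex"
  assumes zero_mem: "0 \<in> H"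
    and add_mem: "f \<in> H \<Longrightarrow> g \<in> H \<Longrightarrow> f + g \<in> H"
    and scale_mem: "f \<in> H \<Longrightarrow> (\<lambda>x. c * f x) \<in> H"
    and ip_add_left: "f \<in> H \<Longrightarrow> g \<in> H \<Longrightarrow> h \<in> H \<Longrightarrow> ip (f + g) h = ip f h + ip g h"
    and ip_scale_left: "f \<in> H \<Longrightarrow> g \<in> H \<Longrightarrow> ip (\<lambda>x. c * f x) g = c * ip f g"
    and ip_commute: "f \<in> H \<Longrightarrow> g \<in> H \<Longrightarrow> ip f g = cnj (ip g f)"
    and ip_nonneg: "f \<in> H \<Longrightarrow> 0 \<le> ip f f"
    and ip_definite: "f \<in> H \<Longrightarrow> ip f f = 0 \<Longrightarrow> f = 0"

text \<open>The case distinction makes \<open>ip_dist H ip\<close> symmetric and nonnegative off \<open>H\<close>, as the locale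
  \<^locale>\<open>Metric_space\<close> requires.\<close>

definition ip_dist :: "('x \<Rightarrow> complex) set \<Rightarrow> (('x \<Rightarrow> complex) \<Rightarrow> ('x \<Rightarrow> complex) \<Rightarrow> complex)
    \<Rightarrow> ('x \<Rightarrow> complex) \<Rightarrow> ('x \<Rightarrow> complex) \<Rightarrow> real" where
  "ip_dist H ip f g = (if f \<in> H \<and> g \<in> H then sqrt (Re (ip (f - g) (f - g))) else 0)"

definition ip_topology :: "('x \<Rightarrow> complex) set \<Rightarrow> (('x \<Rightarrow> complex) \<Rightarrow> ('x \<Rightarrow> complex) \<Rightarrow> complex)
    \<Rightarrow> ('x \<Rightarrow> complex) topology" where
  "ip_topology H ip = Metric_space.mtopology H (ip_dist H ip)"

context function_pre_hilbert
begin

lemma uminus_mem: "f \<in> H \<Longrightarrow> - f \<in> H"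
proof -
  assume "f \<in> H"
  moreover have "- f = (\<lambda>x. (-1) * f x)" by (auto simp: fun_eq_iff)
  ultimately show ?thesis using scale_mem[of f "-1"] by simp
qed

lemma diff_mem: "f \<in> H \<Longrightarrow> g \<in> H \<Longrightarrow> f - g \<in> H"
  using add_mem[of f "- g"] uminus_mem[of g] by simp

lemma ip_add_right: "f \<in> H \<Longrightarrow> g \<in> H \<Longrightarrow> h \<in> H \<Longrightarrow> ip h (f + g) = ip h f + ip h g"
  by (metis add_mem complex_cnj_add ip_add_left ip_commute)

lemma ip_scale_right: "f \<in> H \<Longrightarrow> g \<in> H \<Longrightarrow> ip f (\<lambda>x. c * g x) = cnj c * ip f g"
  by (metis complex_cnj_mult ip_commute ip_scale_left scale_mem)

lemma ip_uminus_uminus: "f \<in> H \<Longrightarrow> ip (- f) (- f) = ip f f"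
proof -
  assume f: "f \<in> H"
  have "- f = (\<lambda>x. (-1) * f x)" by (auto simp: fun_eq_iff)
  then show ?thesis
    using f ip_scale_left[of f "\<lambda>x. (-1) * f x" "-1"] ip_scale_right[of f f "-1"]
      scale_mem[of f "-1"] by simp
qed

lemma ip_zero: "ip 0 0 = 0"
  using ip_scale_left[OF zero_mem zero_mem, of 0] by (simp add: zero_fun_def)

lemma ip_zero_right: "f \<in> H \<Longrightarrow> ip f 0 = 0"
  using ip_scale_right[OF _ zero_mem, of f 0] by (simp add: zero_fun_def)

lemma Re_ip_nonneg: "f \<in> H \<Longrightarrow> 0 \<le> Re (ip f f)"
  using ip_nonneg[of f] by (simp add: less_eq_complex_def)

lemma ip_self: "f \<in> H \<Longrightarrow> ip f f = complex_of_real (Re (ip f f))"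
  using ip_nonneg[of f] by (simp add: less_eq_complex_def complex_eq_iff)

lemma ip_add_self:
  assumes "f \<in> H" "g \<in> H"
  shows "Re (ip (f + g) (f + g)) = Re (ip f f) + 2 * Re (ip f g) + Re (ip g g)"
  using assms ip_commute[of g f] by (simp add: ip_add_left ip_add_right add_mem)

lemma Re_ip_le:
  assumes f: "f \<in> H" and g: "g \<in> H"
  shows "Re (ip f g) \<le> sqrt (Re (ip f f)) * sqrt (Re (ip g g))"
proof (cases "ip g g = 0")
  case True
  then show ?thesis using ip_definite[OF g] ip_zero_right[OF f] by simp
next
  case False
  define a where "a = Re (ip f f)"
  define b where "b = Re (ip f g)"
  define d where "d = Re (ip g g)"
  have d: "d > 0" using Re_ip_nonneg[OF g] ip_self[OF g] False unfolding d_def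
    by (metis less_eq_real_def of_real_0)
  define t where "t = - b / d"
  let ?g = "\<lambda>x. complex_of_real t * g x"
  have gm: "?g \<in> H" using scale_mem[OF g] .
  have "ip f ?g = of_real t * ip f g" using ip_scale_right[OF f g] by simp
  moreover have "ip ?g ?g = of_real t * (of_real t * ip g g)"
    using ip_scale_left[OF g gm] ip_scale_right[OF g g] by simp
  ultimately have "0 \<le> a + 2 * (t * b) + t * (t * d)"
    using Re_ip_nonneg[OF add_mem[OF f gm]] ip_add_self[OF f gm]
    unfolding a_def b_def d_def by simp
  also have "\<dots> = a - b\<^sup>2 / d"
    using d unfolding t_def by (simp add: field_simps power2_eq_square)
  finally have "b\<^sup>2 \<le> a * d" using d by (simp add: field_simps)
  then have "\<bar>b\<bar> \<le> sqrt (a * d)" using real_le_rsqrt[of "\<bar>b\<bar>" "a * d"] by simp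
  then show ?thesis unfolding a_def b_def d_def by (simp add: real_sqrt_mult)
qed

lemma sqrt_ip_triangle:
  assumes f: "f \<in> H" and g: "g \<in> H"
  shows "sqrt (Re (ip (f + g) (f + g))) \<le> sqrt (Re (ip f f)) + sqrt (Re (ip g g))"
proof (rule real_le_lsqrt)
  show "Re (ip (f + g) (f + g)) \<le> (sqrt (Re (ip f f)) + sqrt (Re (ip g g)))\<^sup>2"
    using ip_add_self[OF f g] Re_ip_le[OF f g] Re_ip_nonneg[OF f] Re_ip_nonneg[OF g]
    by (simp add: power2_sum)
qed (use Re_ip_nonneg[OF f] Re_ip_nonneg[OF g] in simp)

lemma Metric_space_ip_dist: "Metric_space H (ip_dist H ip)"
proof
  show "0 \<le> ip_dist H ip f g" for f g
    by (simp add: ip_dist_def Re_ip_nonneg diff_mem)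
  show "ip_dist H ip f g = ip_dist H ip g f" for f g
    using ip_uminus_uminus[of "f - g"] diff_mem[of f g] by (auto simp: ip_dist_def)
  show "ip_dist H ip f g = 0 \<longleftrightarrow> f = g" if fg: "f \<in> H" "g \<in> H" for f g
  proof
    assume "ip_dist H ip f g = 0"
    then have "ip (f - g) (f - g) = 0"
      using fg ip_self[of "f - g"] diff_mem[OF fg] by (simp add: ip_dist_def)
    then show "f = g" using ip_definite[OF diff_mem[OF fg]] by simp
  qed (use fg ip_zero in \<open>simp add: ip_dist_def\<close>)
  show "ip_dist H ip f h \<le> ip_dist H ip f g + ip_dist H ip g h"
    if "f \<in> H" "g \<in> H" "h \<in> H" for f g h
    using sqrt_ip_triangle[OF diff_mem diff_mem, of f g g h] that by (simp add: ip_dist_def)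
qed

end

definition kernel_vec :: "('x \<Rightarrow> complex) set \<Rightarrow> (('x \<Rightarrow> complex) \<Rightarrow> ('x \<Rightarrow> complex) \<Rightarrow> complex)
    \<Rightarrow> 'x \<Rightarrow> ('x \<Rightarrow> complex)" where
  "kernel_vec H ip x = (THE k. k \<in> H \<and> (\<forall>f\<in>H. f x = ip f k))"

definition rep_kernel :: "('x \<Rightarrow> complex) set \<Rightarrow> (('x \<Rightarrow> complex) \<Rightarrow> ('x \<Rightarrow> complex) \<Rightarrow> complex)
    \<Rightarrow> 'x \<Rightarrow> 'x \<Rightarrow> complex" where
  "rep_kernel H ip x y = kernel_vec H ip y x"

text \<open>The positivity of the kernel on the diagonal is part of the notion of RKHS used here.\<close>

locale rkhs = function_pre_hilbert H ip
  for H :: "('x \<Rightarrow> complex) set"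
    and ip :: "('x \<Rightarrow> complex) \<Rightarrow> ('x \<Rightarrow> complex) \<Rightarrow> complex" +
  assumes complete: "Metric_space.mcomplete H (ip_dist H ip)"
    and eval_continuous: "continuous_map (ip_topology H ip) euclidean (\<lambda>f. f x)"
    and kernel_diag_pos: "0 < rep_kernel H ip x x"

definition pos_semidef_fun :: "('x \<Rightarrow> 'x \<Rightarrow> complex) \<Rightarrow> bool" where
  "pos_semidef_fun F \<longleftrightarrow>
    (\<forall>S c. finite S \<longrightarrow> 0 \<le> (\<Sum>x\<in>S. \<Sum>y\<in>S. cnj (c x) * F x y * c y))"

definition complete_pick_kernel :: "('x \<Rightarrow> 'x \<Rightarrow> complex) \<Rightarrow> bool" where
  "complete_pick_kernel K \<longleftrightarrow>
    (\<forall>x y. K x y \<noteq> 0) \<and>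
    (\<exists>x0. pos_semidef_fun (\<lambda>x y. 1 - (K x x0 * K x0 y) / (K x y * K x0 x0)))"

definition normalized_kernel :: "('x \<Rightarrow> 'x \<Rightarrow> complex) \<Rightarrow> bool" where
  "normalized_kernel K \<longleftrightarrow> (\<exists>x0. \<forall>x. K x x0 = 1)"

definition multipliers :: "('x \<Rightarrow> complex) set \<Rightarrow> ('x \<Rightarrow> complex) set" where
  "multipliers H = {h. \<forall>f\<in>H. h * f \<in> H}"

definition cyclic :: "('x \<Rightarrow> complex) set \<Rightarrow> (('x \<Rightarrow> complex) \<Rightarrow> ('x \<Rightarrow> complex) \<Rightarrow> complex)
    \<Rightarrow> ('x \<Rightarrow> complex) \<Rightarrow> bool" where
  "cyclic H ip f \<longleftrightarrow>
    f \<in> H \<and> ip_topology H ip closure_of {h * f | h. h \<in> multipliers H} = H"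

text \<open>A functional on \<open>H\<close> is a function on all of \<open>'x \<Rightarrow> complex\<close> of which only the values on
  \<open>H\<close> are used.\<close>

definition linear_functional_on ::
    "('x \<Rightarrow> complex) set \<Rightarrow> (('x \<Rightarrow> complex) \<Rightarrow> complex) \<Rightarrow> bool" where
  "linear_functional_on H L \<longleftrightarrow>
    (\<forall>f\<in>H. \<forall>g\<in>H. L (f + g) = L f + L g) \<and> (\<forall>f\<in>H. \<forall>c. L (\<lambda>x. c * f x) = c * L f)"

end

theory Submission
  imports Defs "HOL-Computational_Algebra.Fundamental_Theorem_Algebra"
begin

text \<open>
  Let \<open>K\<close> be the kernel and \<open>F = 1 - 1 / K\<close>, which is positive semidefinite. The Fock space over \<open>F\<close> is the
  space with reproducing kernel \<open>F(x\<^sub>1,y\<^sub>1) \<cdots> F(x\<^sub>n,y\<^sub>n)\<close> on words over \<open>X\<close>; summing over the words \<open>z \<cdots> z\<close>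
  maps it contractively and multiplicatively onto \<open>H\<close>. Right multiplication by words on the Fock space
  behaves like a system of shifts, so a Wold decomposition factors every square summable column
  \<open>(f\<^sub>n)\<close> in \<open>H\<close> as \<open>f\<^sub>n = h\<^sub>n G\<close> with contractive multipliers \<open>h\<^sub>n\<close> and a single cyclic \<open>G\<close>.

  Under (i), \<open>a \<mapsto> \<Lambda>(a G) / \<Lambda>(G)\<close> does not vanish on the invertible bounded multipliers, hence is a
  character by the Gleason-Kahane-Zelazko theorem. Factoring the pair \<open>(1, f) = (h\<^sub>1 G, h\<^sub>2 G)\<close> shows that
  this character does not depend on \<open>G\<close> and that \<open>f = h\<^sub>2 / h\<^sub>1\<close>, which gives (ii). Under (ii), \<open>\<Lambda>\<close> is bounded by
  \<open>1\<close> on contractive multipliers, so an unbounded \<open>\<Lambda>\<close> would contradict the factorization of a column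
  with \<open>\<parallel>f\<^sub>n\<parallel> = 2\<^sup>-\<^sup>n\<close> and \<open>|\<Lambda>(f\<^sub>n)| > n\<close>. By continuity a multiplicative \<open>\<Lambda>\<close> cannot vanish at a cyclic element.
\<close>

section \<open>Positive semidefinite kernels\<close>

text \<open>Letting the letters not commute repairs this, at the price of a map from words back to
  points. Left and right multiplication commute on words; hence a closed space generated by right
  multiples of a wandering vector is the range of an isometric left multiplication, and this
  descends to contractive multipliers of \<open>H\<close>. Words over the points of \<open>X\<close>
  take the place of an orthonormal basis: their Gram matrices determine everything, whatever the
  size of \<open>X\<close>, and no vectors representing \<open>F\<close> have to be chosen. One
  common factor for a whole column is essential. It makes \<open>1\<close> and \<open>f\<close>, or
  all members of a sequence, comparable through a single vector \<open>G\<close>, whose value under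
  \<open>\<Lambda>\<close> is one fixed number. The multipliers that occur carry explicit bounds.
  Density of their orbit already implies cyclicity, which refers to the larger orbit under all
  multipliers. The character theorem is applied in a form that asks only for inverses of the powers
  of \<open>1 - t a\<close> with small \<open>t\<close>, since under (i) \<open>\<Lambda>\<close>
  comes without any bound.\<close>

text \<open>A list of pairs \<open>(a, x)\<close> stands for the formal linear combination of the points \<open>x\<close> with
  coefficients \<open>a\<close>. Repetitions of points are allowed, so addition is list concatenation.\<close>

definition lin :: "(complex \<times> 's) list \<Rightarrow> ('s \<Rightarrow> complex) \<Rightarrow> complex" where
  "lin l f = (\<Sum>(a, x)\<leftarrow>l. a * f x)"

definition clin :: "(complex \<times> 's) list \<Rightarrow> ('s \<Rightarrow> complex) \<Rightarrow> complex" where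
  "clin l f = (\<Sum>(a, x)\<leftarrow>l. cnj a * f x)"

definition lscale :: "complex \<Rightarrow> (complex \<times> 's) list \<Rightarrow> (complex \<times> 's) list" where
  "lscale c l = map (\<lambda>(a, x). (c * a, x)) l"

definition lform :: "('s \<Rightarrow> 't \<Rightarrow> complex) \<Rightarrow> (complex \<times> 's) list \<Rightarrow> (complex \<times> 't) list \<Rightarrow> complex" where
  "lform K l l' = clin l (\<lambda>x. lin l' (K x))"

lemma lin_simps [simp]:
  "lin [] f = 0" "lin (p # l) f = fst p * f (snd p) + lin l f" "lin (l @ l') f = lin l f + lin l' f"
  by (simp_all add: lin_def case_prod_unfold)

lemma clin_simps [simp]:
  "clin [] f = 0" "clin (p # l) f = cnj (fst p) * f (snd p) + clin l f"
  "clin (l @ l') f = clin l f + clin l' f"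
  by (simp_all add: clin_def case_prod_unfold)

lemma lscale_simps [simp]:
  "lscale c [] = []" "lscale c (p # l) = (c * fst p, snd p) # lscale c l"
  by (simp_all add: lscale_def case_prod_unfold)

lemma snd_set_lscale [simp]: "snd ` set (lscale c l) = snd ` set l"
  by (induction l) auto

lemma lin_lscale [simp]: "lin (lscale c l) f = c * lin l f"
  by (induction l) (simp_all add: algebra_simps)

lemma clin_lscale [simp]: "clin (lscale c l) f = cnj c * clin l f"
  by (induction l) (simp_all add: algebra_simps)

lemma lin_add: "lin l (\<lambda>x. f x + g x) = lin l f + lin l g"
  by (induction l) (simp_all add: algebra_simps)

lemma lin_mult: "lin l (\<lambda>x. c * f x) = c * lin l f"
  by (induction l) (simp_all add: algebra_simps)

lemma lin_diff: "lin l (\<lambda>x. f x - g x) = lin l f - lin l g"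
  by (induction l) (simp_all add: algebra_simps)

lemma lin_sum: "lin l (\<lambda>x. \<Sum>i\<in>I. f i x) = (\<Sum>i\<in>I. lin l (f i))"
  by (induction l) (simp_all add: sum.distrib sum_distrib_left)

lemma clin_add: "clin l (\<lambda>x. f x + g x) = clin l f + clin l g"
  by (induction l) (simp_all add: algebra_simps)

lemma clin_mult: "clin l (\<lambda>x. c * f x) = c * clin l f"
  by (induction l) (simp_all add: algebra_simps)

lemma clin_diff: "clin l (\<lambda>x. f x - g x) = clin l f - clin l g"
  by (induction l) (simp_all add: algebra_simps)

lemma clin_sum: "clin l (\<lambda>x. \<Sum>i\<in>I. f i x) = (\<Sum>i\<in>I. clin l (f i))"
  by (induction l) (simp_all add: sum.distrib sum_distrib_left)

lemma cnj_lin: "cnj (lin l f) = clin l (\<lambda>x. cnj (f x))"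
  by (induction l) simp_all

lemma cnj_clin: "cnj (clin l f) = lin l (\<lambda>x. cnj (f x))"
  by (induction l) simp_all

lemma clin_zero [simp]: "clin l (\<lambda>x. 0) = 0" "lin l (\<lambda>x. 0) = 0"
  by (induction l) simp_all

lemma lin_cong: "(\<And>x. x \<in> snd ` set l \<Longrightarrow> f x = g x) \<Longrightarrow> lin l f = lin l g"
  by (induction l) auto

lemma clin_cong: "(\<And>x. x \<in> snd ` set l \<Longrightarrow> f x = g x) \<Longrightarrow> clin l f = clin l g"
  by (induction l) auto

lemma tendsto_lin [tendsto_intros]:
  "(\<And>x. ((\<lambda>n. f n x) \<longlongrightarrow> g x) A) \<Longrightarrow> ((\<lambda>n. lin l (f n)) \<longlongrightarrow> lin l g) A"
  by (induction l) (auto intro!: tendsto_intros)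

lemma tendsto_clin [tendsto_intros]:
  "(\<And>x. ((\<lambda>n. f n x) \<longlongrightarrow> g x) A) \<Longrightarrow> ((\<lambda>n. clin l (f n)) \<longlongrightarrow> clin l g) A"
  by (induction l) (auto intro!: tendsto_intros)

lemma lin_map: "lin (map (\<lambda>(a, x). (a * r x, g x)) l) f = lin l (\<lambda>x. r x * f (g x))"
  by (induction l) auto

lemma clin_map: "clin (map (\<lambda>(a, x). (a * r x, g x)) l) f = clin l (\<lambda>x. cnj (r x) * f (g x))"
  by (induction l) auto

lemma lform_simps:
  "lform K [] l' = 0" "lform K l [] = 0"
  "lform K (p # l) l' = cnj (fst p) * lin l' (K (snd p)) + lform K l l'"
  "lform K l (p # l') = fst p * clin l (\<lambda>x. K x (snd p)) + lform K l l'"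
  "lform K (k @ l) l' = lform K k l' + lform K l l'"
  "lform K l (k' @ l') = lform K l k' + lform K l l'"
  "lform K (lscale c l) l' = cnj c * lform K l l'"
  "lform K l (lscale c l') = c * lform K l l'"
  by (simp_all add: lform_def clin_add clin_mult)

lemma lform_sum: "lform (\<lambda>x y. \<Sum>i\<in>I. K i x y) l l' = (\<Sum>i\<in>I. lform (K i) l l')"
  by (simp add: lform_def lin_sum clin_sum)

lemma lform_map: "lform K (map (\<lambda>(a, x). (a * r x, g x)) l) (map (\<lambda>(a, x). (a * r x, g x)) l)
    = lform (\<lambda>x y. cnj (r x) * K (g x) (g y) * r y) l l"
  by (simp add: lform_def lin_map clin_map lin_mult[symmetric] mult_ac)

lemma lform_cong:
  assumes "\<And>x y. x \<in> snd ` set l \<Longrightarrow> y \<in> snd ` set l' \<Longrightarrow> K x y = M x y"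
  shows "lform K l l' = lform M l l'"
  unfolding lform_def by (intro clin_cong lin_cong assms)

text \<open>Hermitian symmetry is listed separately, so that positivity can be stated for real parts
  and passes to sums and limits as a real inequality.\<close>

definition psd :: "('s \<Rightarrow> 's \<Rightarrow> complex) \<Rightarrow> bool" where
  "psd K \<longleftrightarrow> (\<forall>x y. K y x = cnj (K x y)) \<and> (\<forall>l. 0 \<le> Re (lform K l l))"

lemma psd_herm: "psd K \<Longrightarrow> K y x = cnj (K x y)"
  and psd_nonneg: "psd K \<Longrightarrow> 0 \<le> Re (lform K l l)"
  unfolding psd_def by blast+

lemma psdI: "(\<And>x y. K y x = cnj (K x y)) \<Longrightarrow> (\<And>l. 0 \<le> Re (lform K l l)) \<Longrightarrow> psd K"
  unfolding psd_def by blast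

lemma psd_diag: assumes "psd K" shows "K x x = of_real (Re (K x x))" "0 \<le> Re (K x x)"
proof -
  show "K x x = of_real (Re (K x x))"
    using psd_herm[OF assms, of x x] by (simp add: complex_eq_iff)
  show "0 \<le> Re (K x x)" using psd_nonneg[OF assms, of "[(1, x)]"] by (simp add: lform_simps)
qed

text \<open>Adding up the coefficients of equal points turns a list with repetitions into a finite
  set with one coefficient per point, which is the form required by
  \<open>pos_semidef_fun\<close>.\<close>

lemma pos_semidef_fun_lform:
  assumes "pos_semidef_fun K"
  shows "0 \<le> lform K l l"
proof -
  define S where "S = snd ` set l"
  define c where "c x = (\<Sum>(a, y)\<leftarrow>l. if y = x then a else 0)" for x
  have gen: "(\<Sum>(a, y)\<leftarrow>k. a * f y) = (\<Sum>x\<in>T. (\<Sum>(a, y)\<leftarrow>k. if y = x then a else 0) * f x)"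
    if "finite T" "snd ` set k \<subseteq> T" for k :: "(complex \<times> 'a) list" and f T
    using that(2)
  proof (induction k)
    case (Cons p k)
    have "(\<Sum>x\<in>T. (if snd p = x then fst p else 0) * f x) = (\<Sum>x\<in>T. if snd p = x then fst p * f x else 0)"
      by (intro sum.cong) auto
    also have "\<dots> = fst p * f (snd p)" using Cons.prems that(1) by simp
    finally show ?case
      using Cons by (simp add: case_prod_unfold distrib_right sum.distrib)
  qed simp
  have fin: "finite S" by (simp add: S_def)
  have lin: "lin l f = (\<Sum>x\<in>S. c x * f x)" for f
    unfolding lin_def c_def by (rule gen) (auto simp: S_def)
  have clin: "clin l f = (\<Sum>x\<in>S. cnj (c x) * f x)" for f
  proof -
    have "clin l f = cnj (lin l (\<lambda>x. cnj (f x)))" by (simp add: cnj_lin)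
    then show ?thesis by (simp add: lin)
  qed
  have "lform K l l = (\<Sum>x\<in>S. \<Sum>y\<in>S. cnj (c x) * K x y * c y)"
  proof -
    have "cnj (c x) * (\<Sum>y\<in>S. c y * K x y) = (\<Sum>y\<in>S. cnj (c x) * K x y * c y)" for x
      unfolding sum_distrib_left by (intro sum.cong refl) algebra
    then show ?thesis by (simp only: lform_def clin lin)
  qed
  moreover have "0 \<le> (\<Sum>x\<in>S. \<Sum>y\<in>S. cnj (c x) * K x y * c y)"
    using assms fin unfolding pos_semidef_fun_def by blast
  ultimately show ?thesis by (simp only:)
qed

section \<open>Closure properties of positive semidefinite kernels\<close>

lemma psd_pullback:
  assumes "psd K" shows "psd (\<lambda>x y. cnj (r x) * K (g x) (g y) * r y)"
proof (rule psdI)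
  show "cnj (r y) * K (g y) (g x) * r x = cnj (cnj (r x) * K (g x) (g y) * r y)" for x y
    using psd_herm[OF assms, of "g y" "g x"] by simp
  show "0 \<le> Re (lform (\<lambda>x y. cnj (r x) * K (g x) (g y) * r y) l l)" for l
    unfolding lform_map[of K r g l, symmetric] by (rule psd_nonneg[OF assms])
qed

lemma psd_limit:
  assumes "\<And>n. psd (K n)" "\<And>x y. (\<lambda>n. K n x y) \<longlonglongrightarrow> M x y"
  shows "psd M"
proof (rule psdI)
  fix x y
  have "(\<lambda>n. cnj (K n x y)) \<longlonglongrightarrow> cnj (M x y)" by (intro tendsto_intros assms)
  moreover have "(\<lambda>n. cnj (K n x y)) = (\<lambda>n. K n y x)"
    using psd_herm[OF assms(1)] by (intro ext) metis
  ultimately show "M y x = cnj (M x y)" using assms(2)[of y x] LIMSEQ_unique by metis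
next
  fix l
  have "(\<lambda>n. Re (lform (K n) l l)) \<longlonglongrightarrow> Re (lform M l l)"
    unfolding lform_def by (intro tendsto_intros assms)
  then show "0 \<le> Re (lform M l l)" 
    by (rule LIMSEQ_le_const) (auto intro: psd_nonneg assms)
qed

lemma psd_sum:
  assumes "\<And>i. i \<in> I \<Longrightarrow> psd (K i)" shows "psd (\<lambda>x y. \<Sum>i\<in>I. K i x y)"
proof (rule psdI)
  show "(\<Sum>i\<in>I. K i y x) = cnj (\<Sum>i\<in>I. K i x y)" for x y
    unfolding cnj_sum by (intro sum.cong refl psd_herm assms)
  show "0 \<le> Re (lform (\<lambda>x y. \<Sum>i\<in>I. K i x y) l l)" for l
    by (auto simp: lform_sum intro!: sum_nonneg psd_nonneg assms)
qed

text \<open>The form at \<open>(t, s) # l\<close> is a quadratic polynomial in \<open>t\<close> that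
  never becomes negative; the best multiple \<open>t = - r v\<close> of the mixed term
  \<open>v\<close> gives the bound.\<close>

lemma psd_Cauchy_Schwarz:
  assumes K: "psd K"
  shows "(cmod (lin l (K s)))\<^sup>2 \<le> Re (K s s) * Re (lform K l l)"
proof -
  define v where "v = lin l (K s)"
  define \<alpha> where "\<alpha> = Re (K s s)"
  have exp: "0 \<le> (cmod t)\<^sup>2 * \<alpha> + 2 * Re (cnj t * v) + Re (lform K l l)" for t
  proof -
    have "clin l (\<lambda>x. K x s) = cnj v"
      unfolding v_def cnj_lin using psd_herm[OF K] by (intro clin_cong) metis
    then have "lform K ((t, s) # l) ((t, s) # l) = cnj t * t * K s s + cnj t * v + t * cnj v + lform K l l"
      unfolding v_def by (simp add: lform_simps algebra_simps)
    moreover have "Re (cnj t * t * K s s) = (cmod t)\<^sup>2 * \<alpha>"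
    proof -
      have "cnj t * t * K s s = of_real ((cmod t)\<^sup>2 * \<alpha>)"
        unfolding of_real_mult complex_norm_square \<alpha>_def psd_diag(1)[OF K, symmetric] by (simp add: mult.commute)
      then show ?thesis by simp
    qed
    moreover have "Re (t * cnj v) = Re (cnj t * v)" by simp
    ultimately show ?thesis using psd_nonneg[OF K, of "(t, s) # l"] by simp
  qed
  have vv: "Re (cnj (- of_real r * v) * v) = - r * (cmod v)\<^sup>2" for r
  proof -
    have "cnj (- of_real r * v) * v = of_real (- r * (cmod v)\<^sup>2)"
      unfolding of_real_mult complex_norm_square by (simp add: mult.commute)
    then show ?thesis by (simp only: Re_complex_of_real)
  qed
  have nn: "0 \<le> Re (lform K l l)" using psd_nonneg[OF K] .
  have *: "0 \<le> r\<^sup>2 * (cmod v)\<^sup>2 * \<alpha> - 2 * r * (cmod v)\<^sup>2 + Re (lform K l l)" for r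
    using exp[of "- of_real r * v"] vv[of r] by (simp add: norm_mult power_mult_distrib)
  show ?thesis
  proof (cases "\<alpha> = 0")
    case True
    then have "2 * r * (cmod v)\<^sup>2 \<le> Re (lform K l l)" for r using *[of r] by simp
    \<comment> \<open>Without a quadratic term the estimate is linear in \<open>r\<close>, and this
      \<open>r\<close> violates it unless \<open>v = 0\<close>.\<close>
    from this[of "(Re (lform K l l) + 1) / (2 * (cmod v)\<^sup>2)"]
    have "v = 0" using nn by (cases "v = 0") (auto simp: field_simps)
    then show ?thesis using True by (simp add: v_def \<alpha>_def)
  next
    case False
    then have "\<alpha> > 0" using psd_diag(2)[OF K, of s] by (simp add: \<alpha>_def)
    then show ?thesis using *[of "1 / \<alpha>"]
      by (simp add: v_def[symmetric] \<alpha>_def[symmetric] field_simps power2_eq_square)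
  qed
qed

lemma lform_rank_one: "lform (\<lambda>x y. K x s * K s y) l l = clin l (\<lambda>x. K x s) * lin l (K s)"
  by (simp add: lform_def lin_mult clin_mult[symmetric] mult_ac)

lemma lform_scale: "lform (\<lambda>x y. c * K x y) l l' = c * lform K l l'"
  by (simp add: lform_def lin_mult clin_mult)

lemma lform_diff: "lform (\<lambda>x y. K x y - M x y) l l' = lform K l l' - lform M l l'"
  by (simp add: lform_def lin_diff clin_diff)

lemma lform_add: "lform (\<lambda>x y. K x y + M x y) l l' = lform K l l' + lform M l l'"
  by (simp add: lform_def lin_add clin_add)

text \<open>If \<open>K s s = 0\<close>, then \<open>K s y = 0\<close> for all \<open>y\<close>, so that the division by zero is harmless.\<close>

lemma psd_Schur_complement:
  assumes K: "psd K"
  shows "psd (\<lambda>x y. K x y - K x s * K s y / K s s)"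
proof (rule psdI)
  show "K y x - K y s * K s x / K s s = cnj (K x y - K x s * K s y / K s s)" for x y
    using psd_herm[OF K, of y x] psd_herm[OF K, of y s] psd_herm[OF K, of s x] psd_herm[OF K, of s s]
    by (simp add: mult.commute)
  fix l
  have "lform (\<lambda>x y. K x y - K x s * K s y / K s s) l l
      = lform K l l - clin l (\<lambda>x. K x s) * lin l (K s) / K s s"
    using lform_diff[of K "\<lambda>x y. inverse (K s s) * (K x s * K s y)" l l]
    unfolding lform_scale lform_rank_one by (simp add: divide_inverse mult.commute)
  also have "clin l (\<lambda>x. K x s) = cnj (lin l (K s))"
    unfolding cnj_lin using psd_herm[OF K] by (intro clin_cong) metis
  also have "cnj (lin l (K s)) * lin l (K s) / K s s
      = of_real ((cmod (lin l (K s)))\<^sup>2 / Re (K s s))"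
    unfolding of_real_divide psd_diag(1)[OF K, symmetric] complex_norm_square by (simp add: mult.commute)
  finally have "Re (lform (\<lambda>x y. K x y - K x s * K s y / K s s) l l)
      = Re (lform K l l) - (cmod (lin l (K s)))\<^sup>2 / Re (K s s)" by simp
  moreover have "(cmod (lin l (K s)))\<^sup>2 / Re (K s s) \<le> Re (lform K l l)"
    using psd_Cauchy_Schwarz[OF K, of l s] psd_nonneg[OF K, of l] psd_diag(2)[OF K, of s]
    by (cases "Re (K s s) = 0") (auto simp: field_simps)
  ultimately show "0 \<le> Re (lform (\<lambda>x y. K x y - K x s * K s y / K s s) l l)" by simp
qed

lemma psd_zero_row: assumes K: "psd K" "K s s = 0" shows "K s y = 0" "K y s = 0"
proof -
  show "K s y = 0" using psd_Cauchy_Schwarz[OF K(1), of "[(1, y)]" s] K(2) by simp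
  then show "K y s = 0" using psd_herm[OF K(1), of y s] by simp
qed

lemma lin_filter: "(\<And>x. \<not> P x \<Longrightarrow> f x = 0) \<Longrightarrow> lin (filter (\<lambda>p. P (snd p)) l) f = lin l f"
  by (induction l) auto

lemma clin_filter: "(\<And>x. \<not> P x \<Longrightarrow> f x = 0) \<Longrightarrow> clin (filter (\<lambda>p. P (snd p)) l) f = clin l f"
  by (induction l) auto

lemma lform_filter:
  assumes "\<And>x y. \<not> P x \<Longrightarrow> K x y = 0" "\<And>x y. \<not> P y \<Longrightarrow> K x y = 0"
  shows "lform K (filter (\<lambda>p. P (snd p)) l) (filter (\<lambda>p. P (snd p)) l') = lform K l l'"
proof -
  have "lin l' (K x) = 0" if "\<not> P x" for x
    using lin_cong[of l' "K x" "\<lambda>_. 0"] assms(1)[OF that] by simp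
  then show ?thesis
    unfolding lform_def by (subst clin_filter) (simp_all add: assms lin_filter)
qed

lemma Re_of_real_mult: "Re (of_real r * z) = r * Re z"
  by simp

text \<open>Schur product theorem: Schur complements eliminate the points of the first kernel one at a time.\<close>

lemma psd_mult:
  assumes K: "psd K" and M: "psd M"
  shows "psd (\<lambda>x y. K x y * M x y)"
proof (rule psdI)
  show "K y x * M y x = cnj (K x y * M x y)" for x y
    using psd_herm[OF K, of y x] psd_herm[OF M, of y x] by simp
  fix l
  have "0 \<le> Re (lform (\<lambda>x y. K x y * M x y) l l)"
    if "finite S" "snd ` set l \<subseteq> S" "psd K" for S l K
    using that
  proof (induction S arbitrary: l K rule: finite_induct)
    case empty
    then show ?case by (simp add: lform_simps)
  next
    case (insert s S)
    define K' where "K' x y = K x y - K x s * K s y / K s s" for x y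
    have K': "psd K'" unfolding K'_def using psd_Schur_complement[OF insert.prems(2)] .
    have K's: "K' s y = 0" "K' y s = 0" for y
      using psd_zero_row[OF insert.prems(2), of s y] by (cases "K s s = 0"; simp add: K'_def)+
    have *: "K x s * K s y / K s s * M x y = inverse (K s s) * (cnj (K s x) * M x y * K s y)" for x y
      using psd_herm[OF insert.prems(2), of x s] by (simp add: divide_inverse mult_ac)
    let ?l = "filter (\<lambda>p. snd p \<noteq> s) l"
    have "lform (\<lambda>x y. K x y * M x y) l l
       = lform (\<lambda>x y. K' x y * M x y + inverse (K s s) * (cnj (K s x) * M x y * K s y)) l l"
      unfolding *[symmetric] K'_def by (intro lform_cong) (simp add: algebra_simps)
    also have "\<dots> = lform (\<lambda>x y. K' x y * M x y) l l
        + inverse (K s s) * lform (\<lambda>x y. cnj (K s x) * M x y * K s y) l l"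
      by (simp add: lform_add lform_scale)
    also have "lform (\<lambda>x y. K' x y * M x y) l l = lform (\<lambda>x y. K' x y * M x y) ?l ?l"
      by (rule lform_filter[symmetric]) (simp_all add: K's)
    finally have eq: "lform (\<lambda>x y. K x y * M x y) l l = lform (\<lambda>x y. K' x y * M x y) ?l ?l
        + inverse (K s s) * lform (\<lambda>x y. cnj (K s x) * M x y * K s y) l l" .
    have "0 \<le> Re (lform (\<lambda>x y. K' x y * M x y) ?l ?l)"
      using insert.prems(1) by (intro insert.IH K') auto
    moreover have "0 \<le> Re (inverse (K s s) * lform (\<lambda>x y. cnj (K s x) * M x y * K s y) l l)"
    proof -
      have "inverse (K s s) = of_real (inverse (Re (K s s)))"
        by (subst psd_diag(1)[OF insert.prems(2)]) simp
      moreover have "0 \<le> Re (lform (\<lambda>x y. cnj (K s x) * M x y * K s y) l l)"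
        using psd_nonneg[OF psd_pullback[OF M, of "K s" "\<lambda>x. x"]] by simp
      ultimately show ?thesis
        using psd_diag(2)[OF insert.prems(2), of s] by (simp only: Re_of_real_mult) simp
    qed
    ultimately show ?case by (simp add: eq)
  qed
  from this[of "snd ` set l" l K] show "0 \<le> Re (lform (\<lambda>x y. K x y * M x y) l l)" using K by simp
qed

lemma psd_of_bool_eq: "psd (\<lambda>x y. of_bool (x = y))"
proof (rule psdI)
  fix l :: "(complex \<times> 'a) list"
  have "pos_semidef_fun (\<lambda>x y::'a. of_bool (x = y))"
    unfolding pos_semidef_fun_def
  proof (intro allI impI)
    fix S :: "'a set" and c :: "'a \<Rightarrow> complex" assume S: "finite S"
    have "(\<Sum>x\<in>S. \<Sum>y\<in>S. cnj (c x) * of_bool (x = y) * c y) = (\<Sum>x\<in>S. cnj (c x) * c x)"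
    proof (intro sum.cong refl)
      fix x assume "x \<in> S"
      have "(\<Sum>y\<in>S. cnj (c x) * of_bool (x = y) * c y) = (\<Sum>y\<in>S. if x = y then cnj (c x) * c y else 0)"
        by (intro sum.cong) auto
      then show "(\<Sum>y\<in>S. cnj (c x) * of_bool (x = y) * c y) = cnj (c x) * c x"
        using S \<open>x \<in> S\<close> by simp
    qed
    also have "\<dots> \<ge> 0"
      by (intro sum_nonneg) (simp add: less_eq_complex_def)
    finally show "0 \<le> (\<Sum>x\<in>S. \<Sum>y\<in>S. cnj (c x) * of_bool (x = y) * c y)" .
  qed
  from pos_semidef_fun_lform[OF this, of l] show "0 \<le> Re (lform (\<lambda>x y. of_bool (x = y)) l l)"
    by (simp add: less_eq_complex_def)
qed auto

section \<open>Gram kernels of words and of columns of words\<close>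

fun word_kernel :: "('x \<Rightarrow> 'x \<Rightarrow> complex) \<Rightarrow> 'x list \<Rightarrow> 'x list \<Rightarrow> complex" where
  "word_kernel F [] [] = 1"
| "word_kernel F (x # u) (y # v) = F x y * word_kernel F u v"
| "word_kernel F [] (y # v) = 0"
| "word_kernel F (x # u) [] = 0"

text \<open>The first component numbers the entries of a column: the space with this kernel is an
  orthogonal sum of copies of the Fock space, one for each index.\<close>

definition column_kernel :: "('x \<Rightarrow> 'x \<Rightarrow> complex) \<Rightarrow> 'i \<times> 'x list \<Rightarrow> 'i \<times> 'x list \<Rightarrow> complex" where
  "column_kernel F p q = of_bool (fst p = fst q) * word_kernel F (snd p) (snd q)"

lemma word_kernel_length: "length u \<noteq> length v \<Longrightarrow> word_kernel F u v = 0"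
  by (induction F u v rule: word_kernel.induct) auto

lemma word_kernel_append:
  "length u = length v \<Longrightarrow> word_kernel F (u @ u') (v @ v') = word_kernel F u v * word_kernel F u' v'"
  by (induction F u v rule: word_kernel.induct) auto

lemma word_kernel_replicate: "word_kernel F (replicate m x) (replicate n y) = (if m = n then F x y ^ m else 0)"
  by (induction m arbitrary: n; case_tac n) auto

text \<open>On words of length \<open>n + 1\<close> the kernel is the Schur product of
  \<open>F\<close> at the heads with the kernel of length \<open>n\<close> at the tails; the weights
  are indicators that exclude the empty word. The sum over all lengths is a pointwise limit that is
  eventually constant.\<close>

lemma psd_word_kernel:
  assumes F: "psd F" shows "psd (word_kernel F)"
proof (rule psd_limit)
  define W where "W n u v = (if length u = n \<and> length v = n then word_kernel F u v else 0)" for n u v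
  have W: "psd (W n)" for n
  proof (induction n)
    case 0
    have "psd (\<lambda>u v :: 'a list. cnj (of_bool (u = [])) * of_bool (() = ()) * of_bool (v = []))"
      using psd_pullback[OF psd_of_bool_eq, of "\<lambda>u. of_bool (u = [])" "\<lambda>_. ()"] by simp
    moreover have "W 0 = (\<lambda>u v. cnj (of_bool (u = [])) * of_bool (() = ()) * of_bool (v = []))"
      by (auto simp: W_def fun_eq_iff)
    ultimately show ?case by simp
  next
    case (Suc n)
    have "psd (\<lambda>u v. (cnj (of_bool (u \<noteq> [])) * F (hd u) (hd v) * of_bool (v \<noteq> []))
        * (cnj 1 * W n (tl u) (tl v) * 1))"
      by (intro psd_mult psd_pullback F Suc)
    moreover have "W (Suc n) = (\<lambda>u v. (cnj (of_bool (u \<noteq> [])) * F (hd u) (hd v) * of_bool (v \<noteq> []))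
        * (cnj 1 * W n (tl u) (tl v) * 1))"
    proof (intro ext)
      fix u v show "W (Suc n) u v = (cnj (of_bool (u \<noteq> [])) * F (hd u) (hd v) * of_bool (v \<noteq> []))
        * (cnj 1 * W n (tl u) (tl v) * 1)"
        by (cases u; cases v) (auto simp: W_def)
    qed
    ultimately show ?case by simp
  qed
  show "psd (\<lambda>u v. \<Sum>n<N. W n u v)" for N by (intro psd_sum W)
  fix u v
  have "(\<Sum>n<N. W n u v) = word_kernel F u v" if "N > length u" for N
  proof -
    have "(\<Sum>n<N. W n u v) = (\<Sum>n<N. if n = length u then word_kernel F u v else 0)"
      by (intro sum.cong) (auto simp: W_def word_kernel_length)
    then show ?thesis using that by simp
  qed
  then show "(\<lambda>N. \<Sum>n<N. W n u v) \<longlonglongrightarrow> word_kernel F u v"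
    by (intro tendsto_eventually) (auto simp: eventually_sequentially intro!: exI[of _ "Suc (length u)"])
qed

lemma psd_column_kernel:
  assumes F: "psd F" shows "psd (column_kernel F)"
proof -
  have "psd (\<lambda>p q. (cnj 1 * of_bool (fst p = fst q) * 1) * (cnj 1 * word_kernel F (snd p) (snd q) * 1))"
    by (intro psd_mult psd_pullback psd_word_kernel F psd_pullback[OF psd_of_bool_eq, of _ fst])
  then show ?thesis by (simp add: column_kernel_def[abs_def])
qed

section \<open>Hilbert spaces of functions\<close>

definition fscale :: "complex \<Rightarrow> ('x \<Rightarrow> complex) \<Rightarrow> 'x \<Rightarrow> complex" where
  "fscale c f = (\<lambda>x. c * f x)"

definition lc :: "('s \<Rightarrow> 'x \<Rightarrow> complex) \<Rightarrow> (complex \<times> 's) list \<Rightarrow> 'x \<Rightarrow> complex" where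
  "lc g l = (\<lambda>x. lin l (\<lambda>s. g s x))"

definition nrm :: "('a \<Rightarrow> 'a \<Rightarrow> complex) \<Rightarrow> 'a \<Rightarrow> real" where
  "nrm ip f = sqrt (Re (ip f f))"

lemma fscale_apply [simp]: "fscale c f x = c * f x"
  by (simp add: fscale_def)

lemma fscale_fscale [simp]: "fscale c (fscale d f) = fscale (c * d) f"
  by (simp add: fscale_def mult.assoc)

lemma fscale_simps: "fscale 1 f = f" "fscale 0 f = 0" "fscale c 0 = 0" "fscale (- 1) f = - f"
  "fscale c (f + g) = fscale c f + fscale c g" "fscale c (f - g) = fscale c f - fscale c g"
  by (auto simp: fscale_def fun_eq_iff algebra_simps)

lemma lc_simps: "lc g [] = 0" "lc g (p # l) = fscale (fst p) (g (snd p)) + lc g l"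
  "lc g (l @ l') = lc g l + lc g l'" "lc g (lscale c l) = fscale c (lc g l)"
  by (auto simp: lc_def fun_eq_iff)

definition is_subspace :: "('x \<Rightarrow> complex) set \<Rightarrow> bool" where
  "is_subspace V \<longleftrightarrow> 0 \<in> V \<and> (\<forall>f\<in>V. \<forall>g\<in>V. f + g \<in> V) \<and> (\<forall>f\<in>V. \<forall>c. fscale c f \<in> V)"

lemma is_subspaceD:
  assumes "is_subspace V"
  shows "0 \<in> V" "f \<in> V \<Longrightarrow> g \<in> V \<Longrightarrow> f + g \<in> V" "f \<in> V \<Longrightarrow> fscale c f \<in> V"
    "f \<in> V \<Longrightarrow> g \<in> V \<Longrightarrow> f - g \<in> V"
proof -
  show *: "0 \<in> V" "f \<in> V \<Longrightarrow> g \<in> V \<Longrightarrow> f + g \<in> V" "f \<in> V \<Longrightarrow> fscale c f \<in> V" for f g c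
    using assms by (auto simp: is_subspace_def)
  show "f \<in> V \<Longrightarrow> g \<in> V \<Longrightarrow> f - g \<in> V"
    using *(2)[of f "- g"] *(3)[of g "-1"] by (simp add: fscale_simps)
qed

lemma is_subspace_lc: "is_subspace V \<Longrightarrow> (\<And>s. s \<in> snd ` set l \<Longrightarrow> g s \<in> V) \<Longrightarrow> lc g l \<in> V"
  by (induction l) (auto simp: lc_simps is_subspaceD)

lemma is_subspace_span: "is_subspace {lc g l | l. snd ` set l \<subseteq> S}"
  unfolding is_subspace_def
proof (intro conjI ballI allI)
  show "0 \<in> {lc g l | l. snd ` set l \<subseteq> S}" by (auto intro!: exI[of _ "[]"] simp: lc_simps)
next
  fix f h assume "f \<in> {lc g l | l. snd ` set l \<subseteq> S}" "h \<in> {lc g l | l. snd ` set l \<subseteq> S}"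
  then obtain l l' where "f = lc g l" "h = lc g l'" "snd ` set l \<subseteq> S" "snd ` set l' \<subseteq> S" by blast
  then show "f + h \<in> {lc g l | l. snd ` set l \<subseteq> S}"
    by (intro CollectI exI[of _ "l @ l'"]) (auto simp: lc_simps)
next
  fix f c assume "f \<in> {lc g l | l. snd ` set l \<subseteq> S}"
  then obtain l where "f = lc g l" "snd ` set l \<subseteq> S" by blast
  then show "fscale c f \<in> {lc g l | l. snd ` set l \<subseteq> S}"
    by (intro CollectI exI[of _ "lscale c l"]) (auto simp: lc_simps)
qed

section \<open>Norm, convergence and closure in an inner product space\<close>

context function_pre_hilbert
begin

lemma fscale_mem: "f \<in> H \<Longrightarrow> fscale c f \<in> H"
  unfolding fscale_def by (rule scale_mem)

lemma is_subspace_H: "is_subspace H"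
  by (auto simp: is_subspace_def zero_mem add_mem fscale_mem)

lemma lc_mem: "(\<And>s. s \<in> snd ` set l \<Longrightarrow> g s \<in> H) \<Longrightarrow> lc g l \<in> H"
  using is_subspace_lc[OF is_subspace_H] .

lemma ip_fscale: "f \<in> H \<Longrightarrow> g \<in> H \<Longrightarrow> ip (fscale c f) g = c * ip f g"
  "f \<in> H \<Longrightarrow> g \<in> H \<Longrightarrow> ip f (fscale c g) = cnj c * ip f g"
  unfolding fscale_def by (rule ip_scale_left ip_scale_right; assumption)+

lemma ip_diff: "f \<in> H \<Longrightarrow> g \<in> H \<Longrightarrow> h \<in> H \<Longrightarrow> ip (f - g) h = ip f h - ip g h"
  "f \<in> H \<Longrightarrow> g \<in> H \<Longrightarrow> h \<in> H \<Longrightarrow> ip h (f - g) = ip h f - ip h g"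
  using ip_add_left[of "f - g" g h] ip_add_right[of "f - g" g h] diff_mem[of f g] by simp_all

lemma ip_zero_left: "f \<in> H \<Longrightarrow> ip 0 f = 0"
  using ip_commute[OF zero_mem, of f] ip_zero_right[of f] by simp

lemma ip_lc_left:
  "(\<And>s. s \<in> snd ` set l \<Longrightarrow> g s \<in> H) \<Longrightarrow> h \<in> H \<Longrightarrow> ip (lc g l) h = lin l (\<lambda>s. ip (g s) h)"
  by (induction l) (simp_all add: lc_simps ip_zero_left ip_add_left ip_fscale fscale_mem lc_mem)

lemma ip_lc_right:
  "(\<And>s. s \<in> snd ` set l \<Longrightarrow> g s \<in> H) \<Longrightarrow> h \<in> H \<Longrightarrow> ip h (lc g l) = clin l (\<lambda>s. ip h (g s))"
  by (induction l) (simp_all add: lc_simps ip_zero_right ip_add_right ip_fscale fscale_mem lc_mem)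

lemma ip_lc_lc:
  assumes "\<And>s. s \<in> snd ` set l \<Longrightarrow> g s \<in> H" "\<And>s. s \<in> snd ` set l' \<Longrightarrow> g s \<in> H"
  shows "ip (lc g l) (lc g l') = lform (\<lambda>s t. ip (g t) (g s)) l' l"
proof -
  have "ip (lc g l) (lc g l') = clin l' (\<lambda>s. ip (lc g l) (g s))"
    by (intro ip_lc_right lc_mem assms)
  also have "\<dots> = clin l' (\<lambda>s. lin l (\<lambda>t. ip (g t) (g s)))"
    by (intro clin_cong ip_lc_left assms)
  finally show ?thesis by (simp add: lform_def)
qed

abbreviation "norm_H \<equiv> nrm ip"

lemma nrm_nonneg: "f \<in> H \<Longrightarrow> 0 \<le> norm_H f"
  by (simp add: nrm_def Re_ip_nonneg)

lemma nrm_power2: "f \<in> H \<Longrightarrow> (norm_H f)\<^sup>2 = Re (ip f f)"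
  by (simp add: nrm_def Re_ip_nonneg)

lemma ip_self_nrm: "f \<in> H \<Longrightarrow> ip f f = of_real ((norm_H f)\<^sup>2)"
  by (simp only: nrm_power2 ip_self[symmetric])

lemma nrm_zero: "norm_H 0 = 0"
  by (simp add: nrm_def ip_zero)

lemma nrm_eq_0: "f \<in> H \<Longrightarrow> norm_H f = 0 \<longleftrightarrow> f = 0"
  using ip_self_nrm[of f] ip_definite[of f] nrm_zero by auto

lemma nrm_uminus: "f \<in> H \<Longrightarrow> norm_H (- f) = norm_H f"
  by (simp add: nrm_def ip_uminus_uminus)

lemma nrm_minus_commute: "f \<in> H \<Longrightarrow> g \<in> H \<Longrightarrow> norm_H (f - g) = norm_H (g - f)"
  using nrm_uminus[of "f - g"] diff_mem[of f g] by simp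

lemma nrm_add_power2: "f \<in> H \<Longrightarrow> g \<in> H \<Longrightarrow> (norm_H (f + g))\<^sup>2 = (norm_H f)\<^sup>2 + 2 * Re (ip f g) + (norm_H g)\<^sup>2"
  by (simp add: nrm_power2 add_mem ip_add_self)

lemma nrm_fscale: "f \<in> H \<Longrightarrow> norm_H (fscale c f) = cmod c * norm_H f"
proof -
  assume f: "f \<in> H"
  have "ip (fscale c f) (fscale c f) = (c * cnj c) * of_real ((norm_H f)\<^sup>2)"
    using f by (simp add: ip_fscale fscale_mem ip_self_nrm[OF f])
  also have "\<dots> = of_real ((cmod c * norm_H f)\<^sup>2)"
    by (simp only: of_real_mult complex_norm_square power_mult_distrib)
  finally show ?thesis using f by (simp add: nrm_def nrm_nonneg Re_ip_nonneg)
qed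

lemma nrm_triangle: "f \<in> H \<Longrightarrow> g \<in> H \<Longrightarrow> norm_H (f + g) \<le> norm_H f + norm_H g"
  unfolding nrm_def by (rule sqrt_ip_triangle)

lemma nrm_triangle_diff:
  assumes "f \<in> H" "g \<in> H" "h \<in> H" shows "norm_H (f - h) \<le> norm_H (f - g) + norm_H (g - h)"
  using nrm_triangle[of "f - g" "g - h"] assms by (simp add: diff_mem)

lemma nrm_diff_le:
  assumes "f \<in> H" "g \<in> H" shows "\<bar>norm_H f - norm_H g\<bar> \<le> norm_H (f - g)"
  using nrm_triangle[of "f - g" g] nrm_triangle[of "g - f" f] assms nrm_minus_commute[of f g]
  by (simp add: diff_mem)

lemma parallelogram:
  assumes "f \<in> H" "g \<in> H"
  shows "(norm_H (f + g))\<^sup>2 + (norm_H (f - g))\<^sup>2 = 2 * (norm_H f)\<^sup>2 + 2 * (norm_H g)\<^sup>2"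
  using nrm_add_power2[of f g] nrm_add_power2[of f "- g"] assms ip_fscale(2)[of f g "-1"]
  by (simp add: nrm_uminus uminus_mem fscale_simps)

lemma Cauchy_Schwarz:
  assumes f: "f \<in> H" and g: "g \<in> H" shows "cmod (ip f g) \<le> norm_H f * norm_H g"
proof (cases "ip f g = 0")
  case False
  define u where "u = cnj (sgn (ip f g))"
  have u: "cmod u = 1" using False by (simp add: u_def norm_sgn)
  have "u * ip f g = of_real (cmod (ip f g))"
    using False complex_norm_square[of "ip f g"]
    by (simp add: u_def sgn_eq divide_simps power2_eq_square mult.commute)
  then have "cmod (ip f g) = Re (ip (fscale u f) g)"
    using f g by (simp add: ip_fscale)
  also have "\<dots> \<le> norm_H (fscale u f) * norm_H g"
    using Re_ip_le[OF fscale_mem[OF f] g] by (simp add: nrm_def)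
  also have "\<dots> = norm_H f * norm_H g" using u f by (simp add: nrm_fscale)
  finally show ?thesis .
qed (use f g nrm_nonneg in auto)

definition conv :: "(nat \<Rightarrow> 'x \<Rightarrow> complex) \<Rightarrow> ('x \<Rightarrow> complex) \<Rightarrow> bool" where
  "conv \<sigma> f \<longleftrightarrow> (\<lambda>n. norm_H (\<sigma> n - f)) \<longlonglongrightarrow> 0"

definition cauchy :: "(nat \<Rightarrow> 'x \<Rightarrow> complex) \<Rightarrow> bool" where
  "cauchy \<sigma> \<longleftrightarrow> (\<forall>e>0. \<exists>N. \<forall>m\<ge>N. \<forall>n\<ge>N. norm_H (\<sigma> m - \<sigma> n) < e)"

definition clo :: "('x \<Rightarrow> complex) set \<Rightarrow> ('x \<Rightarrow> complex) set" where
  "clo V = {f \<in> H. \<forall>e>0. \<exists>v\<in>V. norm_H (f - v) < e}"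

lemma conv_cauchy:
  assumes "\<And>n. \<sigma> n \<in> H" "f \<in> H" "conv \<sigma> f" shows "cauchy \<sigma>"
  unfolding cauchy_def
proof (intro allI impI)
  fix e :: real assume "e > 0"
  then have "\<forall>\<^sub>F n in sequentially. norm_H (\<sigma> n - f) < e / 2"
    using assms(3) unfolding conv_def by (intro order_tendstoD) auto
  then obtain N where N: "\<And>n. n \<ge> N \<Longrightarrow> norm_H (\<sigma> n - f) < e / 2"
    by (auto simp: eventually_sequentially)
  have "norm_H (\<sigma> m - \<sigma> n) < e" if "m \<ge> N" "n \<ge> N" for m n
    using nrm_triangle_diff[of "\<sigma> m" f "\<sigma> n"] N[OF that(1)] N[OF that(2)]
      nrm_minus_commute[of f "\<sigma> n"] assms(1,2) by simp
  then show "\<exists>N. \<forall>m\<ge>N. \<forall>n\<ge>N. norm_H (\<sigma> m - \<sigma> n) < e" by blast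
qed

lemma conv_ip:
  assumes "\<And>n. \<sigma> n \<in> H" "f \<in> H" "conv \<sigma> f" "g \<in> H"
  shows "(\<lambda>n. ip (\<sigma> n) g) \<longlonglongrightarrow> ip f g"
proof (rule LIM_zero_cancel, rule Lim_null_comparison)
  show "\<forall>\<^sub>F n in sequentially. norm (ip (\<sigma> n) g - ip f g) \<le> norm_H (\<sigma> n - f) * norm_H g"
    using Cauchy_Schwarz[of "\<sigma> _ - f" g] assms by (simp add: ip_diff[symmetric] diff_mem)
  show "(\<lambda>n. norm_H (\<sigma> n - f) * norm_H g) \<longlonglongrightarrow> 0"
    using assms(3) unfolding conv_def by (intro tendsto_mult_left_zero)
qed

lemma conv_nrm:
  assumes "\<And>n. \<sigma> n \<in> H" "f \<in> H" "conv \<sigma> f"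
  shows "(\<lambda>n. norm_H (\<sigma> n)) \<longlonglongrightarrow> norm_H f"
proof (rule LIM_zero_cancel, rule Lim_null_comparison)
  show "\<forall>\<^sub>F n in sequentially. norm (norm_H (\<sigma> n) - norm_H f) \<le> norm_H (\<sigma> n - f)"
    using nrm_diff_le[of "\<sigma> _" f] assms by simp
  show "(\<lambda>n. norm_H (\<sigma> n - f)) \<longlonglongrightarrow> 0"
    using assms(3) unfolding conv_def .
qed

lemma clo_mem: "f \<in> clo V \<Longrightarrow> f \<in> H"
  by (simp add: clo_def)

lemma clo_D: "f \<in> clo V \<Longrightarrow> e > 0 \<Longrightarrow> \<exists>v\<in>V. norm_H (f - v) < e"
  by (simp add: clo_def)

lemma clo_mono: "V \<subseteq> W \<Longrightarrow> clo V \<subseteq> clo W"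
  unfolding clo_def by blast

lemma clo_superset: "f \<in> V \<Longrightarrow> f \<in> H \<Longrightarrow> f \<in> clo V"
  by (auto simp: clo_def nrm_zero intro!: bexI[of _ f])

lemma clo_clo:
  assumes "V \<subseteq> H" "f \<in> H" "\<And>e. e > 0 \<Longrightarrow> \<exists>g\<in>clo V. norm_H (f - g) < e"
  shows "f \<in> clo V"
  unfolding clo_def
proof (intro CollectI conjI allI impI)
  fix e :: real assume e: "e > 0"
  obtain g where g: "g \<in> clo V" "norm_H (f - g) < e / 2" using assms(3)[of "e / 2"] e by auto
  obtain v where v: "v \<in> V" "norm_H (g - v) < e / 2" using clo_D[OF g(1), of "e / 2"] e by auto
  have "norm_H (f - v) < e"
    using nrm_triangle_diff[OF assms(2) clo_mem[OF g(1)], of v] g(2) v assms(1) by auto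
  then show "\<exists>v\<in>V. norm_H (f - v) < e" using v by blast
qed fact

lemma is_subspace_clo:
  assumes V: "is_subspace V" "V \<subseteq> H" shows "is_subspace (clo V)"
  unfolding is_subspace_def
proof (intro conjI ballI allI)
  show "0 \<in> clo V" using is_subspaceD(1)[OF V(1)] by (intro clo_superset zero_mem)
next
  fix f g assume fg: "f \<in> clo V" "g \<in> clo V"
  note fgH = clo_mem[OF fg(1)] clo_mem[OF fg(2)]
  show "f + g \<in> clo V"
    unfolding clo_def
  proof (intro CollectI conjI allI impI)
    fix e :: real assume e: "e > 0"
    obtain v where v: "v \<in> V" "norm_H (f - v) < e / 2" using clo_D[OF fg(1), of "e / 2"] e by auto
    obtain w where w: "w \<in> V" "norm_H (g - w) < e / 2" using clo_D[OF fg(2), of "e / 2"] e by auto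
    have "norm_H (f + g - (v + w)) \<le> norm_H (f - v) + norm_H (g - w)"
      using nrm_triangle[of "f - v" "g - w"] v w V(2) fgH
      by (simp add: diff_mem subset_iff add_diff_add)
    then show "\<exists>v\<in>V. norm_H (f + g - v) < e"
      using v w is_subspaceD(2)[OF V(1) v(1) w(1)] by (intro bexI[of _ "v + w"]) auto
  qed (use fgH add_mem in blast)
next
  fix f c assume f: "f \<in> clo V"
  show "fscale c f \<in> clo V"
    unfolding clo_def
  proof (intro CollectI conjI allI impI)
    fix e :: real assume e: "e > 0"
    obtain v where v: "v \<in> V" "norm_H (f - v) < e / (cmod c + 1)"
      using clo_D[OF f, of "e / (cmod c + 1)"] e norm_ge_zero[of c] by (auto simp: add_nonneg_pos)
    have vH: "f - v \<in> H" using v V(2) clo_mem[OF f] by (auto intro: diff_mem)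
    have "norm_H (fscale c f - fscale c v) = cmod c * norm_H (f - v)"
      using nrm_fscale[OF vH, of c] by (simp add: fscale_simps)
    also have "\<dots> \<le> cmod c * (e / (cmod c + 1))"
      using v by (intro mult_left_mono) auto
    also have "\<dots> < e"
    proof -
      have "cmod c + 1 > 0" using norm_ge_zero[of c] by linarith
      then show ?thesis using e by (simp add: field_simps)
    qed
    finally show "\<exists>v\<in>V. norm_H (fscale c f - v) < e" using v is_subspaceD(3)[OF V(1)] by blast
  qed (use f clo_mem fscale_mem in blast)
qed

lemma clo_orthogonal:
  assumes "f \<in> H" "V \<subseteq> H" "\<And>v. v \<in> V \<Longrightarrow> ip f v = 0" "g \<in> clo V"
  shows "ip f g = 0"
proof (rule ccontr)
  assume nz: "ip f g \<noteq> 0"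
  have fp: "norm_H f + 1 > 0" using nrm_nonneg[OF assms(1)] by simp
  then obtain v where v: "v \<in> V" "norm_H (g - v) < cmod (ip f g) / (norm_H f + 1)"
    using clo_D[OF assms(4), of "cmod (ip f g) / (norm_H f + 1)"] nz by auto
  have mem: "v \<in> H" "g \<in> H" using v assms clo_mem by auto
  have "ip f g = ip f (g - v)" using v(1) assms mem by (simp add: ip_diff)
  then have "cmod (ip f g) \<le> norm_H f * norm_H (g - v)"
    using Cauchy_Schwarz[OF assms(1) diff_mem[OF mem(2,1)]] by simp
  also have "\<dots> \<le> norm_H f * (cmod (ip f g) / (norm_H f + 1))"
    using v nrm_nonneg[OF assms(1)] by (intro mult_left_mono) auto
  also have "\<dots> < cmod (ip f g)"
    using nz fp nrm_nonneg[OF assms(1)] by (simp add: field_simps)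
  finally show False by simp
qed

lemma clo_sequence:
  assumes "f \<in> clo V" "V \<subseteq> H"
  obtains \<sigma> where "\<And>n. \<sigma> n \<in> V" "conv \<sigma> f"
proof -
  have "\<forall>n. \<exists>v\<in>V. norm_H (f - v) < inverse (real (Suc n))"
    using clo_D[OF assms(1)] by (metis inverse_positive_iff_positive of_nat_0_less_iff zero_less_Suc)
  then obtain \<sigma> where \<sigma>: "\<And>n. \<sigma> n \<in> V" "\<And>n. norm_H (f - \<sigma> n) < inverse (real (Suc n))"
    by metis
  have "conv \<sigma> f"
    unfolding conv_def
  proof (rule Lim_null_comparison)
    have "norm_H (\<sigma> n - f) = norm_H (f - \<sigma> n)" for n
      using \<sigma>(1)[of n] assms(2) clo_mem[OF assms(1)] by (intro nrm_minus_commute) auto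
    moreover have "0 \<le> norm_H (f - \<sigma> n)" for n
      using \<sigma>(1)[of n] assms(2) clo_mem[OF assms(1)] by (intro nrm_nonneg diff_mem) auto
    ultimately show "\<forall>\<^sub>F n in sequentially. norm (norm_H (\<sigma> n - f)) \<le> inverse (real (Suc n))"
      using \<sigma>(2) by (simp add: less_imp_le)
    show "(\<lambda>n. inverse (real (Suc n))) \<longlonglongrightarrow> 0" by (rule LIMSEQ_inverse_real_of_nat)
  qed
  then show thesis using \<sigma> that by blast
qed

end

section \<open>Orthogonal projection and the Riesz representation\<close>

locale function_hilbert = function_pre_hilbert H ip
  for H :: "('x \<Rightarrow> complex) set" and ip +
  assumes cauchy_conv: "(\<And>n. \<sigma> n \<in> H) \<Longrightarrow> cauchy \<sigma> \<Longrightarrow> \<exists>f\<in>H. conv \<sigma> f"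
begin

text \<open>Closedness of \<open>V\<close> is not assumed, because the spans of words are not
  closed; the projection lies in \<open>clo V\<close>. A minimizing sequence is Cauchy by the
  parallelogram law, and a nonzero inner product of \<open>f - p\<close> with some \<open>v\<close>
  would allow a step along \<open>v\<close> that decreases the distance.\<close>

lemma projection_exists:
  assumes V: "is_subspace V" "V \<subseteq> H" and f: "f \<in> H"
  obtains p where "p \<in> clo V" "\<And>v. v \<in> V \<Longrightarrow> ip (f - p) v = 0"
proof -
  define d where "d = (INF v\<in>V. (norm_H (f - v))\<^sup>2)"
  have bdd: "bdd_below ((\<lambda>v. (norm_H (f - v))\<^sup>2) ` V)" by (intro bdd_belowI2[of _ 0]) simp
  have ne: "V \<noteq> {}" using is_subspaceD(1)[OF V(1)] by auto
  have d_le: "d \<le> (norm_H (f - v))\<^sup>2" if "v \<in> V" for v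
    unfolding d_def using bdd that by (rule cINF_lower)
  have "\<exists>v\<in>V. (norm_H (f - v))\<^sup>2 < d + inverse (real (Suc n))" for n
    using cINF_less_iff[OF ne bdd, of "d + inverse (real (Suc n))"] by (simp add: d_def[symmetric])
  then obtain \<sigma> where \<sigma>: "\<And>n. \<sigma> n \<in> V"
    and \<sigma>d: "\<And>n. (norm_H (f - \<sigma> n))\<^sup>2 < d + inverse (real (Suc n))"
    by metis
  have \<sigma>H: "\<sigma> n \<in> H" for n using \<sigma> V(2) by auto
  have est: "(norm_H (\<sigma> m - \<sigma> n))\<^sup>2 \<le> 2 * inverse (real (Suc m)) + 2 * inverse (real (Suc n))" for m n
  proof -
    \<comment> \<open>The midpoint of two nearly optimal elements is in \<open>V\<close>, so its
      distance to \<open>f\<close> cannot beat \<open>d\<close>; the parallelogram law then bounds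
      the distance of the two elements.\<close>
    have "fscale (1/2) (\<sigma> n + \<sigma> m) \<in> V" using \<sigma> is_subspaceD[OF V(1)] by blast
    then have "d \<le> (norm_H (f - fscale (1/2) (\<sigma> n + \<sigma> m)))\<^sup>2" by (rule d_le)
    moreover have "(f - \<sigma> n) + (f - \<sigma> m) = fscale 2 (f - fscale (1/2) (\<sigma> n + \<sigma> m))"
      by (auto simp: fun_eq_iff algebra_simps)
    moreover have "f - fscale (1/2) (\<sigma> n + \<sigma> m) \<in> H"
      using f \<sigma>H by (intro diff_mem fscale_mem add_mem)
    ultimately have "4 * d \<le> (norm_H ((f - \<sigma> n) + (f - \<sigma> m)))\<^sup>2"
      by (simp add: nrm_fscale power_mult_distrib)
    then show ?thesis
      using parallelogram[of "f - \<sigma> n" "f - \<sigma> m"] \<sigma>d[of m] \<sigma>d[of n] f \<sigma>H by (simp add: diff_mem)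
  qed
  have "cauchy \<sigma>"
    unfolding cauchy_def
  proof (intro allI impI)
    fix e :: real assume e: "e > 0"
    then obtain N where N: "inverse (real (Suc N)) < e\<^sup>2 / 4"
      using reals_Archimedean[of "e\<^sup>2 / 4"] by auto
    have "norm_H (\<sigma> m - \<sigma> n) < e" if "m \<ge> N" "n \<ge> N" for m n
    proof (rule power2_less_imp_less)
      have "inverse (real (Suc m)) \<le> inverse (real (Suc N))" "inverse (real (Suc n)) \<le> inverse (real (Suc N))"
        using that by auto
      then show "(norm_H (\<sigma> m - \<sigma> n))\<^sup>2 < e\<^sup>2" using est[of m n] N by linarith
    qed (use e in simp)
    then show "\<exists>N. \<forall>m\<ge>N. \<forall>n\<ge>N. norm_H (\<sigma> m - \<sigma> n) < e" by blast
  qed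
  then obtain p where p: "p \<in> H" "conv \<sigma> p" using cauchy_conv[of \<sigma>] \<sigma>H by blast
  have lim: "(\<lambda>n. (norm_H (f - (\<sigma> n + w)))\<^sup>2) \<longlonglongrightarrow> (norm_H (f - (p + w)))\<^sup>2" if w: "w \<in> H" for w
  proof (intro tendsto_power conv_nrm)
    have "norm_H (f - (\<sigma> n + w) - (f - (p + w))) = norm_H (\<sigma> n - p)" for n
      using nrm_minus_commute[OF \<sigma>H p(1), of n] by (simp add: algebra_simps)
    then show "conv (\<lambda>n. f - (\<sigma> n + w)) (f - (p + w))" using p(2) by (simp add: conv_def)
  qed (use f \<sigma>H p w in \<open>auto intro!: diff_mem add_mem\<close>)
  have "(norm_H (f - (p + 0)))\<^sup>2 \<le> d + 0"
  proof (rule LIMSEQ_le[OF lim[OF zero_mem] tendsto_add[OF tendsto_const LIMSEQ_inverse_real_of_nat]])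
    show "\<exists>N. \<forall>n\<ge>N. (norm_H (f - (\<sigma> n + 0)))\<^sup>2 \<le> d + inverse (real (Suc n))"
      using \<sigma>d less_imp_le by simp blast
  qed
  then have fp: "(norm_H (f - p))\<^sup>2 \<le> d" by simp
  have orth: "ip (f - p) v = 0" if v: "v \<in> V" for v
  proof (rule ccontr)
    have vH: "v \<in> H" using v V(2) by auto
    define c where "c = ip (f - p) v"
    assume "ip (f - p) v \<noteq> 0"
    then have c: "cmod c > 0" by (simp add: c_def)
    have ge: "d \<le> (norm_H (f - (p + fscale t v)))\<^sup>2" for t
    proof (rule LIMSEQ_le_const[OF lim])
      show "\<exists>N. \<forall>n\<ge>N. d \<le> (norm_H (f - (\<sigma> n + fscale t v)))\<^sup>2"
        using d_le \<sigma> v is_subspaceD[OF V(1)] by blast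
    qed (use vH fscale_mem in blast)
    have key: "2 * s * (cmod c)\<^sup>2 \<le> s\<^sup>2 * (cmod c)\<^sup>2 * (norm_H v)\<^sup>2" for s
    proof -
      have fpH: "f - p \<in> H" using f p diff_mem by blast
      have eq: "f - (p + fscale (of_real s * c) v) = (f - p) + fscale (- of_real s * c) v"
        by (auto simp: fun_eq_iff)
      have "ip (f - p) (fscale (- of_real s * c) v) = - of_real s * (c * cnj c)"
        using ip_fscale(2)[OF fpH vH] by (simp add: c_def mult_ac)
      also have "\<dots> = of_real (- s * (cmod c)\<^sup>2)"
        by (simp only: complex_norm_square of_real_mult of_real_minus)
      finally have ipv: "Re (ip (f - p) (fscale (- of_real s * c) v)) = - s * (cmod c)\<^sup>2"
        by (simp only: Re_complex_of_real)
      have "d \<le> (norm_H (f - p))\<^sup>2 - 2 * s * (cmod c)\<^sup>2 + s\<^sup>2 * (cmod c)\<^sup>2 * (norm_H v)\<^sup>2"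
        using ge[of "of_real s * c"] nrm_add_power2[OF fpH fscale_mem[OF vH], of "- of_real s * c"] ipv
        unfolding eq by (simp add: nrm_fscale vH norm_mult power_mult_distrib)
      then show ?thesis using fp by simp
    qed
    \<comment> \<open>Any \<open>s > 0\<close> whose product with the squared norm of
      \<open>v\<close> is below 1 contradicts \<open>key\<close>; the summand 1 keeps the
      denominator positive.\<close>
    define s where "s = 1 / ((norm_H v)\<^sup>2 + 1)"
    have pos: "(norm_H v)\<^sup>2 + 1 > 0" by (simp add: add_nonneg_pos)
    have s: "s > 0" "s * (norm_H v)\<^sup>2 < 1" using pos by (auto simp: s_def divide_simps)
    have "2 * s * (cmod c)\<^sup>2 \<le> s * (cmod c)\<^sup>2 * (s * (norm_H v)\<^sup>2)"
      using key[of s] by (simp add: power2_eq_square mult_ac)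
    also have "\<dots> \<le> s * (cmod c)\<^sup>2 * 1"
      using s by (intro mult_left_mono) auto
    finally show False using s c by simp
  qed
  have "p \<in> clo V"
    unfolding clo_def
  proof (intro CollectI conjI allI impI)
    fix e :: real assume "e > 0"
    then have "\<forall>\<^sub>F n in sequentially. norm_H (\<sigma> n - p) < e"
      using p(2) unfolding conv_def by (intro order_tendstoD) auto
    then obtain n where "norm_H (\<sigma> n - p) < e" by (auto simp: eventually_sequentially)
    then show "\<exists>v\<in>V. norm_H (p - v) < e" using \<sigma>(1)[of n] nrm_minus_commute[OF p(1) \<sigma>H[of n]] by (intro bexI[of _ "\<sigma> n"]) auto
  qed fact
  then show thesis using that orth by blast
qed

lemma Riesz:
  assumes add: "\<And>f g. f \<in> H \<Longrightarrow> g \<in> H \<Longrightarrow> \<phi> (f + g) = \<phi> f + \<phi> g"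
    and scale: "\<And>f c. f \<in> H \<Longrightarrow> \<phi> (fscale c f) = c * \<phi> f"
    and bounded: "\<And>f. f \<in> H \<Longrightarrow> cmod (\<phi> f) \<le> C * norm_H f"
  obtains k where "k \<in> H" "\<And>f. f \<in> H \<Longrightarrow> \<phi> f = ip f k"
proof (cases "\<forall>f\<in>H. \<phi> f = 0")
  case True
  then show thesis using that[OF zero_mem] ip_zero_right by simp
next
  case False
  then obtain f0 where f0: "f0 \<in> H" "\<phi> f0 \<noteq> 0" by blast
  define V where "V = {f \<in> H. \<phi> f = 0}"
  have \<phi>0: "\<phi> 0 = 0" using scale[OF zero_mem, of 0] by (simp add: fscale_simps)
  have V: "is_subspace V" "V \<subseteq> H"
    by (auto simp: is_subspace_def V_def add scale add_mem fscale_mem zero_mem \<phi>0)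
  have diff: "\<phi> (f - g) = \<phi> f - \<phi> g" if "f \<in> H" "g \<in> H" for f g
    using add[OF diff_mem[OF that] that(2)] by simp
  obtain p where p: "p \<in> clo V" "\<And>v. v \<in> V \<Longrightarrow> ip (f0 - p) v = 0"
    using projection_exists[OF V f0(1)] by blast
  have pH: "p \<in> H" using p clo_mem by blast
  have "\<phi> p = 0"
  proof (rule ccontr)
    assume "\<phi> p \<noteq> 0"
    then have pos: "cmod (\<phi> p) > 0" by simp
    then have "cmod (\<phi> p) / (\<bar>C\<bar> + 1) > 0" by (simp add: add_nonneg_pos)
    then obtain v where v: "v \<in> V" "norm_H (p - v) < cmod (\<phi> p) / (\<bar>C\<bar> + 1)"
      using clo_D[OF p(1)] by blast
    have vH: "v \<in> H" using v V by auto
    have "cmod (\<phi> p) = cmod (\<phi> (p - v))" using v vH pH by (simp add: diff V_def)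
    also have "\<dots> \<le> C * norm_H (p - v)" by (intro bounded diff_mem vH pH)
    also have "\<dots> \<le> (\<bar>C\<bar> + 1) * norm_H (p - v)"
      using nrm_nonneg[OF diff_mem[OF pH vH]] by (intro mult_right_mono) auto
    also have "\<dots> < cmod (\<phi> p)" using v(2) by (simp add: field_simps add_nonneg_pos)
    finally show False by simp
  qed
  define g where "g = f0 - p"
  have g: "g \<in> H" "\<phi> g \<noteq> 0" using f0 pH \<open>\<phi> p = 0\<close> by (auto simp: g_def diff_mem diff)
  have gg: "ip g g \<noteq> 0" using ip_definite[OF g(1)] g(2) \<phi>0 by auto
  have "\<phi> f = ip f (fscale (cnj (\<phi> g / ip g g)) g)" if f: "f \<in> H" for f
  proof -
    let ?h = "f - fscale (\<phi> f / \<phi> g) g"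
    have "?h \<in> V" using f g by (simp add: V_def diff_mem fscale_mem diff scale)
    then have "ip g ?h = 0" using p(2) by (simp add: g_def)
    then have "ip ?h g = 0" using ip_commute[of ?h g] f g by (simp add: diff_mem fscale_mem)
    then have "ip f g = \<phi> f / \<phi> g * ip g g" using f g by (simp add: ip_diff ip_fscale fscale_mem)
    then show ?thesis using f g gg by (simp add: ip_fscale)
  qed
  then show thesis using that g fscale_mem by blast
qed

end

section \<open>Spaces with a reproducing kernel\<close>

locale reproducing = function_hilbert H ip
  for H :: "('x \<Rightarrow> complex) set" and ip +
  fixes kv :: "'x \<Rightarrow> 'x \<Rightarrow> complex"
  assumes kv_mem: "kv x \<in> H"
    and reproduce: "f \<in> H \<Longrightarrow> ip f (kv x) = f x"
begin

lemma eval_bound: "f \<in> H \<Longrightarrow> cmod (f x) \<le> norm_H f * norm_H (kv x)"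
  using Cauchy_Schwarz[of f "kv x"] kv_mem by (simp add: reproduce)

lemma conv_pointwise:
  "(\<And>n. \<sigma> n \<in> H) \<Longrightarrow> f \<in> H \<Longrightarrow> conv \<sigma> f \<Longrightarrow> (\<lambda>n. \<sigma> n x) \<longlonglongrightarrow> f x"
  using conv_ip[of \<sigma> f "kv x"] kv_mem by (simp add: reproduce)

lemma lc_kv_mem: "lc kv l \<in> H"
  by (intro lc_mem kv_mem)

lemma lc_kv_subset: "range (lc kv) \<subseteq> H"
  using lc_kv_mem by auto

lemma ip_lc_kv: "ip (lc kv l) (lc kv l') = lform (\<lambda>x y. kv y x) l' l"
  by (simp add: ip_lc_lc kv_mem reproduce)

lemma nrm_lc_kv: "(norm_H (lc kv l))\<^sup>2 = Re (lform (\<lambda>x y. kv y x) l l)"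
  by (simp add: nrm_power2 lc_kv_mem ip_lc_kv)

lemma ip_lc_kv_right: "f \<in> H \<Longrightarrow> ip f (lc kv l) = clin l f"
  by (simp add: ip_lc_right kv_mem reproduce)

lemma kv_herm: "kv x y = cnj (kv y x)"
  using ip_commute[of "kv x" "kv y"] kv_mem by (simp add: reproduce)

text \<open>The part of \<open>f\<close> orthogonal to all kernel vectors takes the value 0 at every
  point.\<close>

lemma lc_kv_dense:
  assumes f: "f \<in> H" shows "f \<in> clo (range (lc kv))"
proof -
  have V: "is_subspace (range (lc kv))" "range (lc kv) \<subseteq> H"
    using is_subspace_span[of kv UNIV] by (auto simp: full_SetCompr_eq lc_kv_mem)
  obtain p where p: "p \<in> clo (range (lc kv))" "\<And>v. v \<in> range (lc kv) \<Longrightarrow> ip (f - p) v = 0"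
    using projection_exists[OF V f] by blast
  have pH: "p \<in> H" using p clo_mem by blast
  have "(f - p) x = 0" for x
    using p(2)[of "lc kv [(1, x)]"] ip_lc_kv_right[OF diff_mem[OF f pH], of "[(1, x)]"] by simp
  then have "f = p" by (auto simp: fun_eq_iff)
  then show ?thesis using p by simp
qed

end

text \<open>On combinations of kernel vectors both norms are computed from the kernel alone. A
  sequence of such combinations converging in one space is Cauchy in the other, and the two limits
  agree pointwise. This identifies a given space with the one constructed from its kernel.\<close>

lemma reproducing_unique:
  assumes "reproducing H1 ip1 kv" "reproducing H2 ip2 kv" "f \<in> H1"
  shows "f \<in> H2 \<and> nrm ip2 f = nrm ip1 f"
proof -
  interpret A: reproducing H1 ip1 kv by fact
  interpret B: reproducing H2 ip2 kv by fact
  obtain \<sigma> where \<sigma>: "\<And>n. \<sigma> n \<in> range (lc kv)" "A.conv \<sigma> f"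
    using A.clo_sequence[OF A.lc_kv_dense[OF assms(3)] A.lc_kv_subset] by blast
  have eq: "nrm ip1 g = nrm ip2 g" if "g \<in> range (lc kv)" for g
    using that A.nrm_nonneg[of g] B.nrm_nonneg[of g] A.nrm_lc_kv B.nrm_lc_kv
    by (auto simp: A.lc_kv_mem B.lc_kv_mem intro: power2_eq_imp_eq)
  have diff: "g - h \<in> range (lc kv)" if "g \<in> range (lc kv)" "h \<in> range (lc kv)" for g h
    using is_subspaceD(4)[OF is_subspace_span[of kv UNIV]] that by (auto simp: full_SetCompr_eq)
  have mem: "\<sigma> n \<in> H1" "\<sigma> n \<in> H2" for n using \<sigma>(1)[of n] A.lc_kv_mem B.lc_kv_mem by auto
  have "B.cauchy \<sigma>"
    using A.conv_cauchy[OF mem(1) assms(3) \<sigma>(2)] eq[OF diff[OF \<sigma>(1) \<sigma>(1)]]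
    by (simp add: A.cauchy_def B.cauchy_def)
  then obtain g where g: "g \<in> H2" "B.conv \<sigma> g" using B.cauchy_conv mem(2) by blast
  have "f x = g x" for x
    using A.conv_pointwise[OF mem(1) assms(3) \<sigma>(2)] B.conv_pointwise[OF mem(2) g] LIMSEQ_unique by blast
  then have fg: "f = g" by auto
  have "nrm ip1 f = nrm ip2 f"
  proof (rule LIMSEQ_unique)
    show "(\<lambda>n. nrm ip1 (\<sigma> n)) \<longlonglongrightarrow> nrm ip1 f" by (rule A.conv_nrm[OF mem(1) assms(3) \<sigma>(2)])
    show "(\<lambda>n. nrm ip1 (\<sigma> n)) \<longlonglongrightarrow> nrm ip2 f"
      using B.conv_nrm[OF mem(2) g] eq[OF \<sigma>(1)] fg by simp
  qed
  then show ?thesis using fg g by simp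
qed

text \<open>Since \<open>T\<close> is defined on all functions and respects pointwise limits, the
  norm limit of the images of an approximating sequence can only be \<open>T f\<close>; a bound on
  combinations of kernel vectors therefore carries over to the whole space.\<close>

lemma reproducing_extend:
  assumes "reproducing H1 ip1 kv1" "reproducing H2 ip2 kv2"
    and diff: "\<And>f g. T (f - g) = T f - T g"
    and pointwise: "\<And>\<sigma> f y. (\<And>x. (\<lambda>n. \<sigma> n x) \<longlonglongrightarrow> f x) \<Longrightarrow> (\<lambda>n. T (\<sigma> n) y) \<longlonglongrightarrow> T f y"
    and mem: "\<And>l. T (lc kv1 l) \<in> H2"
    and bound: "\<And>l. nrm ip2 (T (lc kv1 l)) \<le> C * nrm ip1 (lc kv1 l)"
    and f: "f \<in> H1"
  shows "T f \<in> H2 \<and> nrm ip2 (T f) \<le> C * nrm ip1 f"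
proof -
  interpret A: reproducing H1 ip1 kv1 by fact
  interpret B: reproducing H2 ip2 kv2 by fact
  obtain \<sigma> where \<sigma>: "\<And>n. \<sigma> n \<in> range (lc kv1)" "A.conv \<sigma> f"
    using A.clo_sequence[OF A.lc_kv_dense[OF f] A.lc_kv_subset] by blast
  have m1: "\<sigma> n \<in> H1" and m2: "T (\<sigma> n) \<in> H2" for n using \<sigma>(1)[of n] A.lc_kv_mem mem by auto
  have "B.cauchy (\<lambda>n. T (\<sigma> n))"
    unfolding B.cauchy_def
  proof (intro allI impI)
    fix e :: real assume e: "e > 0"
    then have "e / (\<bar>C\<bar> + 1) > 0" by (simp add: add_nonneg_pos)
    then obtain N where N: "\<And>m n. m \<ge> N \<Longrightarrow> n \<ge> N \<Longrightarrow> nrm ip1 (\<sigma> m - \<sigma> n) < e / (\<bar>C\<bar> + 1)"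
      using A.conv_cauchy[OF m1 f \<sigma>(2)] unfolding A.cauchy_def by metis
    have "nrm ip2 (T (\<sigma> m) - T (\<sigma> n)) < e" if "m \<ge> N" "n \<ge> N" for m n
    proof -
      have "\<sigma> m - \<sigma> n \<in> range (lc kv1)"
        using is_subspaceD(4)[OF is_subspace_span[of kv1 UNIV]] \<sigma>(1) by (auto simp: full_SetCompr_eq)
      then have "nrm ip2 (T (\<sigma> m - \<sigma> n)) \<le> C * nrm ip1 (\<sigma> m - \<sigma> n)" using bound by auto
      also have "\<dots> \<le> (\<bar>C\<bar> + 1) * nrm ip1 (\<sigma> m - \<sigma> n)"
        using A.nrm_nonneg[OF A.diff_mem[OF m1 m1]] by (intro mult_right_mono) auto
      also have "\<dots> < e" using N[OF that] by (simp add: field_simps add_nonneg_pos)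
      finally show ?thesis by (simp add: diff)
    qed
    then show "\<exists>N. \<forall>m\<ge>N. \<forall>n\<ge>N. nrm ip2 (T (\<sigma> m) - T (\<sigma> n)) < e" by blast
  qed
  then obtain g where g: "g \<in> H2" "B.conv (\<lambda>n. T (\<sigma> n)) g" using B.cauchy_conv[of "\<lambda>n. T (\<sigma> n)", OF m2] by blast
  have "T f y = g y" for y
  proof (rule LIMSEQ_unique)
    show "(\<lambda>n. T (\<sigma> n) y) \<longlonglongrightarrow> T f y"
      by (rule pointwise) (rule A.conv_pointwise[OF m1 f \<sigma>(2)])
    show "(\<lambda>n. T (\<sigma> n) y) \<longlonglongrightarrow> g y" by (rule B.conv_pointwise[OF m2 g])
  qed
  then have Tf: "T f = g" by auto
  have "nrm ip2 g \<le> C * nrm ip1 f"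
  proof (rule LIMSEQ_le[OF B.conv_nrm[OF m2 g] tendsto_mult_left[OF A.conv_nrm[OF m1 f \<sigma>(2)]]])
    have "nrm ip2 (T (\<sigma> n)) \<le> C * nrm ip1 (\<sigma> n)" for n using bound \<sigma>(1)[of n] by auto
    then show "\<exists>N. \<forall>n\<ge>N. nrm ip2 (T (\<sigma> n)) \<le> C * nrm ip1 (\<sigma> n)" by blast
  qed
  then show ?thesis using Tf g by simp
qed

section \<open>The space with a given reproducing kernel\<close>

definition rk_defect :: "('s \<Rightarrow> 's \<Rightarrow> complex) \<Rightarrow> ('s \<Rightarrow> complex) \<Rightarrow> (complex \<times> 's) list \<Rightarrow> real" where
  "rk_defect K f l = 2 * Re (clin l f) - Re (lform K l l)"

definition rk_set :: "('s \<Rightarrow> 's \<Rightarrow> complex) \<Rightarrow> ('s \<Rightarrow> complex) set" where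
  "rk_set K = {f. bdd_above (range (rk_defect K f))}"

text \<open>Completing the square shows that \<open>rk_sq K f\<close> is the squared norm of \<open>f\<close>: the functional
  \<open>2 * Re \<langle>f, v\<rangle> - \<langle>v, v\<rangle>\<close> has supremum \<open>\<langle>f, f\<rangle>\<close> over a dense set of \<open>v\<close>.\<close>

definition rk_sq :: "('s \<Rightarrow> 's \<Rightarrow> complex) \<Rightarrow> ('s \<Rightarrow> complex) \<Rightarrow> real" where
  "rk_sq K f = (SUP l. rk_defect K f l)"

definition rk_Re :: "('s \<Rightarrow> 's \<Rightarrow> complex) \<Rightarrow> ('s \<Rightarrow> complex) \<Rightarrow> ('s \<Rightarrow> complex) \<Rightarrow> real" where
  "rk_Re K f g = (rk_sq K (f + g) - rk_sq K (f - g)) / 4"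

text \<open>For a form that is conjugate linear in the second argument, the imaginary part at
  \<open>f, g\<close> is the real part at \<open>f, \<i> g\<close>.\<close>

definition rk_ip :: "('s \<Rightarrow> 's \<Rightarrow> complex) \<Rightarrow> ('s \<Rightarrow> complex) \<Rightarrow> ('s \<Rightarrow> complex) \<Rightarrow> complex" where
  "rk_ip K f g = Complex (rk_Re K f g) (rk_Re K f (fscale \<i> g))"

lemma rk_sq_least:
  "(\<And>l. rk_defect K f l \<le> C) \<Longrightarrow> f \<in> rk_set K \<and> rk_sq K f \<le> C"
  unfolding rk_set_def rk_sq_def by (auto intro!: bdd_aboveI[of _ C] cSUP_least)

lemma rk_sq_upper: "f \<in> rk_set K \<Longrightarrow> rk_defect K f l \<le> rk_sq K f"
  unfolding rk_set_def rk_sq_def by (intro cSUP_upper) auto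

lemma rk_sq_nonneg: "f \<in> rk_set K \<Longrightarrow> 0 \<le> rk_sq K f"
  using rk_sq_upper[of f K "[]"] by (simp add: rk_defect_def lform_simps)

lemma rk_defect_fscale: "rk_defect K (fscale c f) (lscale c l) = (cmod c)\<^sup>2 * rk_defect K f l"
proof -
  have *: "cnj c * (c * z) = of_real ((cmod c)\<^sup>2) * z" for z
    unfolding complex_norm_square by (simp add: mult_ac)
  have "clin (lscale c l) (fscale c f) = cnj c * (c * clin l f)"
    by (simp add: fscale_def clin_mult)
  moreover have "lform K (lscale c l) (lscale c l) = cnj c * (c * lform K l l)"
    by (simp add: lform_simps)
  ultimately show ?thesis
    unfolding rk_defect_def * Re_of_real_mult by (simp add: algebra_simps)
qed

text \<open>An additive function that vanishes at 1 has period 1, so a bound on the unit interval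
  holds everywhere, and the multiples \<open>n t\<close> then leave only the value 0. Applied to the
  defect of homogeneity of \<open>rk_Re\<close>, it yields real homogeneity.\<close>

lemma additive_bounded_zero:
  fixes \<psi> :: "real \<Rightarrow> real"
  assumes add: "\<And>s t. \<psi> (s + t) = \<psi> s + \<psi> t" and one: "\<psi> 1 = 0"
    and bdd: "\<And>t. 0 \<le> t \<Longrightarrow> t \<le> 1 \<Longrightarrow> \<bar>\<psi> t\<bar> \<le> C"
  shows "\<psi> t = 0"
proof -
  have zero: "\<psi> 0 = 0" using add[of 0 0] by simp
  have neg: "\<psi> (- t) = - \<psi> t" for t using add[of t "- t"] zero by simp
  have mult: "\<psi> (of_nat n * t) = of_nat n * \<psi> t" for n t
    by (induction n) (simp_all add: zero add distrib_right)
  have nat: "\<psi> (of_nat n) = 0" for n using mult[of n 1] one by simp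
  have int: "\<psi> (of_int k) = 0" for k
    by (cases k rule: int_cases2) (simp_all add: nat neg)
  have all: "\<bar>\<psi> t\<bar> \<le> C" for t
  proof -
    have "\<psi> t = \<psi> (frac t + of_int \<lfloor>t\<rfloor>)" by (simp add: frac_def)
    also have "\<dots> = \<psi> (frac t)" by (simp add: add int)
    finally show ?thesis using bdd[of "frac t"] frac_lt_1[of t] by (simp add: less_imp_le)
  qed
  show ?thesis
  proof (rule ccontr)
    assume "\<psi> t \<noteq> 0"
    then obtain n where "real n * \<bar>\<psi> t\<bar> > C" using reals_Archimedean3[of "\<bar>\<psi> t\<bar>"] by auto
    then show False using all[of "of_nat n * t"] by (simp add: mult abs_mult)
  qed
qed

context
  fixes K :: "'s \<Rightarrow> 's \<Rightarrow> complex"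
  assumes K: "psd K"
begin

lemma rk_zero: "0 \<in> rk_set K" "rk_sq K 0 = 0"
proof -
  have "rk_defect K 0 l \<le> 0" for l
    using psd_nonneg[OF K, of l] by (simp add: rk_defect_def zero_fun_def)
  then show "0 \<in> rk_set K" "rk_sq K 0 = 0"
    using rk_sq_least[of K 0 0] rk_sq_nonneg[of 0 K] by auto
qed

lemma rk_fscale:
  assumes f: "f \<in> rk_set K"
  shows "fscale c f \<in> rk_set K" "rk_sq K (fscale c f) = (cmod c)\<^sup>2 * rk_sq K f"
proof -
  have *: "fscale c f \<in> rk_set K \<and> rk_sq K (fscale c f) \<le> (cmod c)\<^sup>2 * rk_sq K f"
    if "c \<noteq> 0" "f \<in> rk_set K" for c f
  proof (rule rk_sq_least)
    fix l
    have "fscale (1/c) (fscale c f) = f" using that by (simp add: fscale_simps)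
    then have "rk_defect K (fscale c f) l = (cmod c)\<^sup>2 * rk_defect K f (lscale (1/c) l)"
      using rk_defect_fscale[of K "1/c" "fscale c f" l] that(1)
      by (simp add: norm_divide power_divide)
    also have "\<dots> \<le> (cmod c)\<^sup>2 * rk_sq K f"
      using rk_sq_upper[OF that(2)] by (intro mult_left_mono) auto
    finally show "rk_defect K (fscale c f) l \<le> (cmod c)\<^sup>2 * rk_sq K f" .
  qed
  show "fscale c f \<in> rk_set K" "rk_sq K (fscale c f) = (cmod c)\<^sup>2 * rk_sq K f"
  proof -
    show "fscale c f \<in> rk_set K"
      using * f rk_zero by (cases "c = 0") (auto simp: fscale_simps)
    show "rk_sq K (fscale c f) = (cmod c)\<^sup>2 * rk_sq K f"
    proof (cases "c = 0")
      case True
      then show ?thesis by (simp add: fscale_simps rk_zero)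
    next
      case False
      then have "rk_sq K f \<le> (cmod (1/c))\<^sup>2 * rk_sq K (fscale c f)"
        using *[of "1/c" "fscale c f"] *[OF False f] by (simp add: fscale_simps)
      then have "(cmod c)\<^sup>2 * rk_sq K f \<le> rk_sq K (fscale c f)"
        using False by (simp add: norm_divide power_divide field_simps)
      then show ?thesis using *[OF False f] by simp
    qed
  qed
qed

text \<open>For a fixed list the defect is affine in the function, and \<open>f + g\<close> is the
  mean of \<open>2 f\<close> and \<open>2 g\<close>.\<close>

lemma rk_add: assumes f: "f \<in> rk_set K" and g: "g \<in> rk_set K" shows "f + g \<in> rk_set K"
proof -
  have "rk_defect K (f + g) l \<le> (rk_sq K (fscale 2 f) + rk_sq K (fscale 2 g)) / 2" for l
  proof -
    have "2 * rk_defect K (f + g) l = rk_defect K (fscale 2 f) l + rk_defect K (fscale 2 g) l"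
      unfolding rk_defect_def fscale_def plus_fun_def clin_add clin_mult by simp
    then show ?thesis
      using rk_sq_upper[OF rk_fscale(1)[OF f], of 2 l] rk_sq_upper[OF rk_fscale(1)[OF g], of 2 l] by simp
  qed
  then show ?thesis using rk_sq_least by blast
qed

lemma rk_diff: "f \<in> rk_set K \<Longrightarrow> g \<in> rk_set K \<Longrightarrow> f - g \<in> rk_set K"
  using rk_add[of f "- g"] rk_fscale(1)[of g "-1"] by (simp add: fscale_simps)

text \<open>Testing \<open>f + g\<close> with \<open>l @ l'\<close> and \<open>f - g\<close> with
  \<open>l @ lscale (-1) l'\<close> cancels the mixed terms, so the suprema over \<open>l\<close>
  and \<open>l'\<close> can be taken independently.\<close>

lemma rk_parallelogram_le:
  assumes f: "f \<in> rk_set K" and g: "g \<in> rk_set K"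
  shows "2 * rk_sq K f + 2 * rk_sq K g \<le> rk_sq K (f + g) + rk_sq K (f - g)"
proof -
  let ?X = "rk_sq K (f + g) + rk_sq K (f - g)"
  have *: "2 * rk_defect K f l + 2 * rk_defect K g l' \<le> ?X" for l l'
  proof -
    have "rk_defect K (f + g) (l @ l') + rk_defect K (f - g) (l @ lscale (-1) l')
        = 2 * rk_defect K f l + 2 * rk_defect K g l'"
      by (simp add: rk_defect_def lform_simps plus_fun_def fun_diff_def clin_add clin_diff)
    then show ?thesis
      using rk_sq_upper[OF rk_add[OF f g]] rk_sq_upper[OF rk_diff[OF f g]] by (metis add_mono)
  qed
  have "rk_sq K f \<le> ?X / 2 - rk_defect K g l'" for l'
    using rk_sq_least[of K f "?X / 2 - rk_defect K g l'"] *[of _ l'] by (simp add: field_simps)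
  then have "rk_sq K g \<le> ?X / 2 - rk_sq K f"
    using rk_sq_least[of K g "?X / 2 - rk_sq K f"] by (simp add: field_simps)
  then show ?thesis by (simp add: field_simps)
qed

text \<open>The converse inequality is the previous one at \<open>f + g\<close> and
  \<open>f - g\<close>, whose sum and difference are \<open>2 f\<close> and
  \<open>2 g\<close>.\<close>

lemma rk_parallelogram:
  assumes f: "f \<in> rk_set K" and g: "g \<in> rk_set K"
  shows "rk_sq K (f + g) + rk_sq K (f - g) = 2 * rk_sq K f + 2 * rk_sq K g"
proof -
  have "(f + g) + (f - g) = fscale 2 f" "(f + g) - (f - g) = fscale 2 g"
    by (auto simp: fun_eq_iff)
  then have "2 * rk_sq K (f + g) + 2 * rk_sq K (f - g) \<le> 4 * rk_sq K f + 4 * rk_sq K g"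
    using rk_parallelogram_le[OF rk_add[OF f g] rk_diff[OF f g]] by (simp add: rk_fscale f g)
  then show ?thesis using rk_parallelogram_le[OF f g] by simp
qed

text \<open>Jordan and von Neumann: the parallelogram law makes the polarization additive.\<close>

lemma rk_Re_add_half:
  assumes f: "f \<in> rk_set K" and g: "g \<in> rk_set K" and h: "h \<in> rk_set K"
  shows "rk_Re K f h + rk_Re K g h = rk_Re K (f + g) (fscale 2 h) / 2"
proof -
  have eqs: "(f + h) + (g + h) = f + g + fscale 2 h" "(f + h) - (g + h) = f - g"
    "(f - h) + (g - h) = f + g - fscale 2 h" "(f - h) - (g - h) = f - g"
    by (auto simp: fun_eq_iff)
  show ?thesis
    using rk_parallelogram[OF rk_add[OF f h] rk_add[OF g h]]
      rk_parallelogram[OF rk_diff[OF f h] rk_diff[OF g h]]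
    unfolding eqs rk_Re_def by (simp add: field_simps)
qed

lemma rk_Re_zero: "h \<in> rk_set K \<Longrightarrow> rk_Re K 0 h = 0"
  using rk_fscale(2)[of h "-1"] by (simp add: rk_Re_def fscale_simps)

text \<open>The factor 2 in \<open>rk_Re_add_half\<close> disappears by comparing its instances at
  \<open>f, g\<close> and at \<open>f + g, 0\<close>, which have the same right side.\<close>

lemma rk_Re_add:
  assumes f: "f \<in> rk_set K" and g: "g \<in> rk_set K" and h: "h \<in> rk_set K"
  shows "rk_Re K (f + g) h = rk_Re K f h + rk_Re K g h"
  using rk_Re_add_half[OF f g h] rk_Re_add_half[OF rk_add[OF f g] rk_zero(1) h]
  by (simp add: rk_Re_zero h)

lemma rk_Re_commute: "f \<in> rk_set K \<Longrightarrow> g \<in> rk_set K \<Longrightarrow> rk_Re K f g = rk_Re K g f"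
  using rk_fscale(2)[OF rk_diff[of f g], of "-1"] by (simp add: rk_Re_def fscale_simps add.commute)

lemma rk_Re_self: "f \<in> rk_set K \<Longrightarrow> rk_Re K f f = rk_sq K f"
proof -
  assume f: "f \<in> rk_set K"
  have "f + f = fscale 2 f" by auto
  then show ?thesis using f by (simp add: rk_Re_def rk_fscale rk_zero)
qed

lemma rk_Re_bound:
  assumes f: "f \<in> rk_set K" and g: "g \<in> rk_set K"
  shows "\<bar>rk_Re K f g\<bar> \<le> (rk_sq K f + rk_sq K g) / 2"
  using rk_parallelogram[OF f g] rk_sq_nonneg[OF rk_add[OF f g]] rk_sq_nonneg[OF rk_diff[OF f g]]
  unfolding rk_Re_def by (auto simp: abs_if field_simps)

lemma rk_Re_scale:
  assumes f: "f \<in> rk_set K" and g: "g \<in> rk_set K"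
  shows "rk_Re K (fscale (of_real t) f) g = t * rk_Re K f g"
proof -
  define \<psi> where "\<psi> t = rk_Re K (fscale (of_real t) f) g - t * rk_Re K f g" for t
  have "\<psi> t = 0"
  proof (rule additive_bounded_zero[of \<psi> "(rk_sq K f + rk_sq K g) / 2 + \<bar>rk_Re K f g\<bar>"])
    show "\<psi> (s + t) = \<psi> s + \<psi> t" for s t
    proof -
      have "fscale (of_real (s + t)) f = fscale (of_real s) f + fscale (of_real t) f"
        by (auto simp: algebra_simps)
      then show ?thesis
        using rk_Re_add[of "fscale (of_real s) f" "fscale (of_real t) f" g] f g
        by (simp add: \<psi>_def rk_fscale algebra_simps)
    qed
    show "\<psi> 1 = 0" by (simp add: \<psi>_def fscale_simps)
    fix t :: real assume t: "0 \<le> t" "t \<le> 1"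
    have "\<bar>rk_Re K (fscale (of_real t) f) g\<bar> \<le> (t\<^sup>2 * rk_sq K f + rk_sq K g) / 2"
      using rk_Re_bound[OF rk_fscale(1)[OF f] g, of "of_real t"] f by (simp add: rk_fscale)
    moreover have "t\<^sup>2 * rk_sq K f \<le> rk_sq K f"
      using t rk_sq_nonneg[OF f] mult_right_mono[of "t\<^sup>2" 1 "rk_sq K f"] by (simp add: power_le_one)
    moreover have "\<bar>t * rk_Re K f g\<bar> \<le> \<bar>rk_Re K f g\<bar>"
      using t mult_right_mono[of "\<bar>t\<bar>" 1 "\<bar>rk_Re K f g\<bar>"] by (simp add: abs_mult)
    ultimately show "\<bar>\<psi> t\<bar> \<le> (rk_sq K f + rk_sq K g) / 2 + \<bar>rk_Re K f g\<bar>"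
      unfolding \<psi>_def
      using abs_triangle_ineq4[of "rk_Re K (fscale (of_real t) f) g" "t * rk_Re K f g"] by argo
  qed
  then show ?thesis by (simp add: \<psi>_def)
qed

lemma rk_Re_fscale_ii:
  assumes f: "f \<in> rk_set K" and g: "g \<in> rk_set K"
  shows "rk_Re K (fscale \<i> f) (fscale \<i> g) = rk_Re K f g"
  using rk_fscale(2)[OF rk_add[OF f g], of \<i>] rk_fscale(2)[OF rk_diff[OF f g], of \<i>]
  by (simp add: rk_Re_def fscale_simps)

lemma rk_Re_minus:
  assumes f: "f \<in> rk_set K" and g: "g \<in> rk_set K"
  shows "rk_Re K (- f) g = - rk_Re K f g" "rk_Re K f (- g) = - rk_Re K f g"
  using rk_Re_scale[OF f g, of "-1"] rk_Re_scale[OF g f, of "-1"] rk_Re_commute f g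
    rk_fscale(1)[OF f, of "-1"] rk_fscale(1)[OF g, of "-1"]
  by (simp_all add: fscale_simps)

lemma rk_Re_fscale_ii_left:
  assumes f: "f \<in> rk_set K" and g: "g \<in> rk_set K"
  shows "rk_Re K (fscale \<i> f) g = - rk_Re K f (fscale \<i> g)"
  using rk_Re_fscale_ii[OF f rk_fscale(1)[OF g], of \<i>] rk_Re_minus(2)[OF rk_fscale(1)[OF f] g, of \<i>]
  by (simp add: fscale_simps)

lemma function_pre_hilbert_rk: "function_pre_hilbert (rk_set K) (rk_ip K)"
proof
  show "0 \<in> rk_set K" by (rule rk_zero)
  show "f + g \<in> rk_set K" if "f \<in> rk_set K" "g \<in> rk_set K" for f g by (rule rk_add[OF that])
  show "(\<lambda>x. c * f x) \<in> rk_set K" if "f \<in> rk_set K" for f c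
    using rk_fscale(1)[OF that] by (simp add: fscale_def)
  show add: "rk_ip K (f + g) h = rk_ip K f h + rk_ip K g h"
    if "f \<in> rk_set K" "g \<in> rk_set K" "h \<in> rk_set K" for f g h
    using that by (simp add: rk_ip_def complex_eq_iff rk_Re_add rk_fscale)
  show "rk_ip K (\<lambda>x. c * f x) g = c * rk_ip K f g" if "f \<in> rk_set K" "g \<in> rk_set K" for f g c
  proof -
    have "fscale c f = fscale (of_real (Re c)) f + fscale (of_real (Im c)) (fscale \<i> f)"
      by (auto simp: complex_eq_iff)
    then have "rk_ip K (fscale c f) g
        = rk_ip K (fscale (of_real (Re c)) f) g + rk_ip K (fscale (of_real (Im c)) (fscale \<i> f)) g"
      using that by (metis add rk_fscale(1))
    also have "\<dots> = c * rk_ip K f g"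
      using that
      by (simp add: rk_ip_def complex_eq_iff rk_Re_scale rk_Re_fscale_ii_left rk_Re_fscale_ii rk_fscale del: fscale_fscale)
        (simp add: fscale_simps rk_Re_minus algebra_simps)
    finally show ?thesis by (simp add: fscale_def)
  qed
  show "rk_ip K f g = cnj (rk_ip K g f)" if "f \<in> rk_set K" "g \<in> rk_set K" for f g
    using that rk_Re_commute[of f g] rk_Re_fscale_ii_left[of g f] rk_Re_commute[of "fscale \<i> g" f]
    by (simp add: rk_ip_def complex_eq_iff rk_fscale)
  have self: "rk_ip K f f = of_real (rk_sq K f)" if "f \<in> rk_set K" for f
    using that rk_Re_fscale_ii_left[of f f] rk_Re_commute[of "fscale \<i> f" f]
    by (simp add: rk_ip_def complex_eq_iff rk_Re_self rk_fscale)
  show "0 \<le> rk_ip K f f" if "f \<in> rk_set K" for f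
    using self[OF that] rk_sq_nonneg[OF that] by (simp add: less_eq_complex_def)
  show "f = 0" if f: "f \<in> rk_set K" and 0: "rk_ip K f f = 0" for f
  proof
    fix x
    have N: "rk_sq K f = 0" using 0 self[OF f] by simp
    show "f x = 0 x"
    proof (rule ccontr)
      assume "f x \<noteq> 0 x"
      then have pos: "(cmod (f x))\<^sup>2 > 0" by simp
      define d where "d = Re (K x x)"
      have d: "d \<ge> 0" unfolding d_def by (rule psd_diag[OF K])
      \<comment> \<open>The list with the single point \<open>x\<close> and coefficient
        \<open>s f x\<close> has this defect, which is positive for \<open>s = 1 / (d + 1)\<close>
        although the supremum is 0.\<close>
      have "s * (2 - s * d) * (cmod (f x))\<^sup>2 \<le> 0" for s
      proof -
        have "cnj (of_real s * f x) * f x = of_real (s * (cmod (f x))\<^sup>2)"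
          unfolding of_real_mult complex_norm_square by (simp add: mult_ac)
        moreover have "of_real s * f x * (cnj (of_real s * f x) * K x x)
            = of_real (s\<^sup>2 * (cmod (f x))\<^sup>2 * d)"
          unfolding of_real_mult complex_norm_square d_def psd_diag(1)[OF K, symmetric]
          by (simp add: mult_ac power2_eq_square)
        ultimately have "rk_defect K f [(of_real s * f x, x)]
            = 2 * (s * (cmod (f x))\<^sup>2) - s\<^sup>2 * (cmod (f x))\<^sup>2 * d"
          unfolding rk_defect_def by (simp only: lform_simps clin_simps lin_simps fst_conv snd_conv
              add_0_right Re_complex_of_real)
        then show ?thesis
          using rk_sq_upper[OF f, of "[(of_real s * f x, x)]"] N
          by (simp add: algebra_simps power2_eq_square)
      qed
      moreover have "1 / (d + 1) * (2 - 1 / (d + 1) * d) * (cmod (f x))\<^sup>2 > 0"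
        using d pos by (intro mult_pos_pos) (auto simp: field_simps)
      ultimately show False by (simp only: not_less[symmetric])
    qed
  qed
qed

interpretation R: function_pre_hilbert "rk_set K" "rk_ip K"
  by (rule function_pre_hilbert_rk)

lemma Re_rk_ip_self: "f \<in> rk_set K \<Longrightarrow> Re (rk_ip K f f) = rk_sq K f"
  by (simp add: rk_ip_def rk_Re_self)

lemma nrm_rk: "f \<in> rk_set K \<Longrightarrow> (nrm (rk_ip K) f)\<^sup>2 = rk_sq K f"
  by (simp add: R.nrm_power2 Re_rk_ip_self)

text \<open>The defect of \<open>f\<close> plus \<open>t\<close> times the kernel vector at
  \<open>x\<close>, tested with \<open>l\<close>, differs by a constant from the defect of
  \<open>f\<close> tested with \<open>(- t, x) # l\<close>. Undoing the change with
  \<open>- t\<close> gives equality, and polarization then gives the reproducing property.\<close>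

lemma rk_sq_add_kernel:
  assumes f: "f \<in> rk_set K"
  shows "f + fscale t (\<lambda>y. K y x) \<in> rk_set K"
    "rk_sq K (f + fscale t (\<lambda>y. K y x)) \<le> rk_sq K f + 2 * Re (cnj t * f x) + (cmod t)\<^sup>2 * Re (K x x)"
proof -
  let ?g = "f + fscale t (\<lambda>y. K y x)"
  let ?r = "2 * Re (cnj t * f x) + (cmod t)\<^sup>2 * Re (K x x)"
  have "rk_defect K ?g l \<le> rk_sq K f + 2 * Re (cnj t * f x) + (cmod t)\<^sup>2 * Re (K x x)" for l
  proof -
    define c where "c = clin l (\<lambda>y. K y x)"
    have c: "lin l (K x) = cnj c"
      unfolding c_def cnj_clin using psd_herm[OF K] by (intro lin_cong) metis
    have g: "clin l ?g = clin l f + t * c"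
      by (simp add: plus_fun_def fscale_def clin_add clin_mult c_def)
    have q: "lform K ((- t, x) # l) ((- t, x) # l)
        = cnj t * t * K x x - cnj t * cnj c - t * c + lform K l l"
      by (simp add: lform_simps c c_def[symmetric] algebra_simps)
    have tt: "Re (cnj t * t * K x x) = (cmod t)\<^sup>2 * Re (K x x)"
      unfolding mult.commute[of "cnj t" t] complex_norm_square[symmetric] Re_of_real_mult ..
    have "Re (cnj t * cnj c) = Re (t * c)" by simp
    then have "rk_defect K f ((- t, x) # l) = rk_defect K ?g l - ?r"
      unfolding rk_defect_def g q using tt by simp
    then show ?thesis using rk_sq_upper[OF f, of "(- t, x) # l"] by simp
  qed
  from rk_sq_least[OF this] show "?g \<in> rk_set K"
    "rk_sq K ?g \<le> rk_sq K f + 2 * Re (cnj t * f x) + (cmod t)\<^sup>2 * Re (K x x)" by simp_all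
qed

lemma kernel_in_rk: "(\<lambda>y. K y x) \<in> rk_set K"
  using rk_sq_add_kernel(1)[OF rk_zero(1), of 1 x] by (simp add: fscale_simps)

lemma rk_sq_add_kernel_eq:
  assumes f: "f \<in> rk_set K"
  shows "rk_sq K (f + fscale t (\<lambda>y. K y x)) = rk_sq K f + 2 * Re (cnj t * f x) + (cmod t)\<^sup>2 * Re (K x x)"
proof -
  let ?g = "f + fscale t (\<lambda>y. K y x)"
  have "?g + fscale (- t) (\<lambda>y. K y x) = f" by (auto simp: fun_eq_iff)
  then have "rk_sq K f \<le> rk_sq K ?g + 2 * Re (cnj (- t) * ?g x) + (cmod t)\<^sup>2 * Re (K x x)"
    using rk_sq_add_kernel(2)[OF rk_sq_add_kernel(1)[OF f, of t x], of "- t" x]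
    by (simp only: norm_minus_cancel)
  moreover have "Re (cnj t * (t * K x x)) = (cmod t)\<^sup>2 * Re (K x x)"
    unfolding mult.assoc[symmetric] mult.commute[of "cnj t" t] complex_norm_square[symmetric] Re_of_real_mult ..
  ultimately have "rk_sq K f + 2 * Re (cnj t * f x) + (cmod t)\<^sup>2 * Re (K x x) \<le> rk_sq K ?g"
    by (simp add: distrib_left) 
  then show ?thesis using rk_sq_add_kernel(2)[OF f, of t x] by simp
qed

lemma rk_reproduce:
  assumes f: "f \<in> rk_set K" shows "rk_ip K f (\<lambda>y. K y x) = f x"
proof -
  have "rk_Re K f (fscale t (\<lambda>y. K y x)) = Re (cnj t * f x)" for t
  proof -
    have "f - fscale t (\<lambda>y. K y x) = f + fscale (- t) (\<lambda>y. K y x)" by (auto simp: fun_eq_iff)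
    then show ?thesis unfolding rk_Re_def by (simp only: rk_sq_add_kernel_eq f) simp
  qed
  from this[of 1] this[of \<i>] show ?thesis by (simp add: rk_ip_def complex_eq_iff fscale_simps)
qed

text \<open>For completeness: a Cauchy sequence converges at every point, and the defect at a fixed
  list depends continuously on finitely many values. The bound on the defects of
  \<open>\<sigma> m - \<sigma> n\<close> thus survives the limit in \<open>m\<close>, uniformly in
  the list.\<close>

theorem reproducing_rk: "reproducing (rk_set K) (rk_ip K) (\<lambda>x y. K y x)"
proof
  show "(\<lambda>y. K y x) \<in> rk_set K" for x by (rule kernel_in_rk)
  show "rk_ip K f (\<lambda>y. K y x) = f x" if "f \<in> rk_set K" for f x by (rule rk_reproduce[OF that])
  fix \<sigma> :: "nat \<Rightarrow> 's \<Rightarrow> complex"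
  assume \<sigma>: "\<And>n. \<sigma> n \<in> rk_set K" and C: "R.cauchy \<sigma>"
  have pt: "cmod (f x) \<le> nrm (rk_ip K) f * nrm (rk_ip K) (\<lambda>y. K y x)" if "f \<in> rk_set K" for f x
    using R.Cauchy_Schwarz[OF that kernel_in_rk, of x] rk_reproduce[OF that, of x] by simp
  have "Cauchy (\<lambda>n. \<sigma> n x)" for x
  proof (rule CauchyI)
    fix e :: real assume e: "e > 0"
    let ?k = "nrm (rk_ip K) (\<lambda>y. K y x)"
    have k: "?k + 1 > 0" using R.nrm_nonneg[OF kernel_in_rk, of x] by simp
    then obtain N where N: "\<And>m n. m \<ge> N \<Longrightarrow> n \<ge> N \<Longrightarrow> nrm (rk_ip K) (\<sigma> m - \<sigma> n) < e / (?k + 1)"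
      using C e unfolding R.cauchy_def by (metis divide_pos_pos)
    have "norm (\<sigma> m x - \<sigma> n x) < e" if "m \<ge> N" "n \<ge> N" for m n
    proof -
      have "norm (\<sigma> m x - \<sigma> n x) \<le> nrm (rk_ip K) (\<sigma> m - \<sigma> n) * ?k"
        using pt[OF rk_diff[OF \<sigma> \<sigma>], of m n x] by simp
      also have "\<dots> \<le> nrm (rk_ip K) (\<sigma> m - \<sigma> n) * (?k + 1)"
        using R.nrm_nonneg[OF rk_diff[OF \<sigma> \<sigma>]] by (intro mult_left_mono) auto
      also have "\<dots> < e" using N[OF that] k by (simp add: field_simps)
      finally show ?thesis .
    qed
    then show "\<exists>M. \<forall>m\<ge>M. \<forall>n\<ge>M. norm (\<sigma> m x - \<sigma> n x) < e" by blast
  qed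
  then have "\<exists>z. (\<lambda>n. \<sigma> n x) \<longlonglongrightarrow> z" for x using Cauchy_convergent convergent_def by blast
  then obtain f where f: "\<And>x. (\<lambda>n. \<sigma> n x) \<longlonglongrightarrow> f x" by metis
  have main: "\<exists>N. \<forall>n\<ge>N. f - \<sigma> n \<in> rk_set K \<and> nrm (rk_ip K) (\<sigma> n - f) < e" if e: "e > 0" for e
  proof -
    obtain N where N: "\<And>m n. m \<ge> N \<Longrightarrow> n \<ge> N \<Longrightarrow> nrm (rk_ip K) (\<sigma> m - \<sigma> n) < e / 2"
      using C e unfolding R.cauchy_def by (metis half_gt_zero)
    have "f - \<sigma> n \<in> rk_set K \<and> nrm (rk_ip K) (\<sigma> n - f) < e" if n: "n \<ge> N" for n
    proof -
      have "rk_defect K (f - \<sigma> n) l \<le> (e / 2)\<^sup>2" for l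
      proof (rule LIMSEQ_le_const2)
        show "(\<lambda>m. rk_defect K (\<sigma> m - \<sigma> n) l) \<longlonglongrightarrow> rk_defect K (f - \<sigma> n) l"
          unfolding rk_defect_def by (auto intro!: tendsto_intros f)
        have "rk_defect K (\<sigma> m - \<sigma> n) l \<le> (e / 2)\<^sup>2" if "m \<ge> N" for m
        proof -
          have "rk_defect K (\<sigma> m - \<sigma> n) l \<le> (nrm (rk_ip K) (\<sigma> m - \<sigma> n))\<^sup>2"
            using rk_sq_upper[OF rk_diff[OF \<sigma> \<sigma>]] by (simp add: nrm_rk rk_diff \<sigma>)
          also have "\<dots> \<le> (e / 2)\<^sup>2"
            using N[OF that n] R.nrm_nonneg[OF rk_diff[OF \<sigma> \<sigma>]] by (intro power_mono) auto
          finally show ?thesis .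
        qed
        then show "\<exists>N. \<forall>m\<ge>N. rk_defect K (\<sigma> m - \<sigma> n) l \<le> (e / 2)\<^sup>2" by blast
      qed
      from rk_sq_least[OF this] have *: "f - \<sigma> n \<in> rk_set K" "rk_sq K (f - \<sigma> n) \<le> (e / 2)\<^sup>2" by simp_all
      have "nrm (rk_ip K) (f - \<sigma> n) \<le> e / 2"
      proof (rule power2_le_imp_le)
        show "(nrm (rk_ip K) (f - \<sigma> n))\<^sup>2 \<le> (e / 2)\<^sup>2" using *(2) by (simp only: nrm_rk[OF *(1)])
      qed (use e in simp)
      moreover have "nrm (rk_ip K) (\<sigma> n - f) = nrm (rk_ip K) (f - \<sigma> n)"
        using R.nrm_uminus[OF *(1)] by simp
      ultimately show ?thesis using * e by simp
    qed
    then show ?thesis by blast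
  qed
  obtain n where "f - \<sigma> n \<in> rk_set K" using main[of 1] by auto
  then have fm: "f \<in> rk_set K" using rk_add[OF _ \<sigma>[of n], of "f - \<sigma> n"] by simp
  moreover have "R.conv \<sigma> f"
    unfolding R.conv_def
  proof (rule LIMSEQ_I)
    fix e :: real assume "e > 0"
    then obtain N where "\<forall>n\<ge>N. nrm (rk_ip K) (\<sigma> n - f) < e" using main by blast
    then show "\<exists>N. \<forall>n\<ge>N. norm (nrm (rk_ip K) (\<sigma> n - f) - 0) < e"
      using R.nrm_nonneg[OF rk_diff[OF \<sigma> fm]] by auto
  qed
  ultimately show "\<exists>f\<in>rk_set K. R.conv \<sigma> f" by blast
qed

end

section \<open>The Fock space of a kernel\<close>

definition word_vec :: "('x \<Rightarrow> 'x \<Rightarrow> complex) \<Rightarrow> 'i \<times> 'x list \<Rightarrow> 'i \<times> 'x list \<Rightarrow> complex" where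
  "word_vec F p q = column_kernel F q p"

text \<open>The function \<open>f\<close> on words stands for the vector whose inner product with the word \<open>w\<close>, seen as
  a simple tensor, is \<open>f w\<close>. In these terms the tensor product of vectors is deconcatenation.\<close>

definition conc :: "('i \<times> 'x list \<Rightarrow> complex) \<Rightarrow> (unit \<times> 'x list \<Rightarrow> complex) \<Rightarrow> 'i \<times> 'x list \<Rightarrow> complex" where
  "conc f g p = (\<Sum>j\<le>length (snd p). f (fst p, take j (snd p)) * g ((), drop j (snd p)))"

lemma conc_linear:
  "conc (f + f') g = conc f g + conc f' g" "conc (f - f') g = conc f g - conc f' g"
  "conc (fscale c f) g = fscale c (conc f g)" "conc 0 g = 0"
  "conc f (g + g') = conc f g + conc f g'" "conc f (g - g') = conc f g - conc f g'"
  "conc f (fscale c g) = fscale c (conc f g)" "conc f 0 = 0"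
  by (auto simp: fun_eq_iff conc_def algebra_simps sum.distrib sum_subtractf sum_distrib_left)

lemma conc_lc_left: "conc (lc G l) g = lc (\<lambda>s. conc (G s) g) l"
  by (induction l) (simp_all only: lc_simps conc_linear)

lemma conc_lc_right: "conc f (lc G l) = lc (\<lambda>s. conc f (G s)) l"
  by (induction l) (simp_all only: lc_simps conc_linear)

lemma tendsto_conc_left:
  "(\<And>p. (\<lambda>n. \<sigma> n p) \<longlonglongrightarrow> f p) \<Longrightarrow> (\<lambda>n. conc (\<sigma> n) g q) \<longlonglongrightarrow> conc f g q"
  unfolding conc_def by (intro tendsto_intros)

lemma tendsto_conc_right:
  "(\<And>p. (\<lambda>n. \<sigma> n p) \<longlonglongrightarrow> g p) \<Longrightarrow> (\<lambda>n. conc f (\<sigma> n) q) \<longlonglongrightarrow> conc f g q"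
  unfolding conc_def by (intro tendsto_intros)

text \<open>Words of different lengths are orthogonal, so only the cut that leaves a suffix as long
  as \<open>v\<close> contributes.\<close>

lemma conc_word:
  "conc f (word_vec F ((), v)) (i, w) = (if length v \<le> length w
    then f (i, take (length w - length v) w) * word_kernel F (drop (length w - length v) w) v else 0)"
proof -
  have "conc f (word_vec F ((), v)) (i, w)
      = (\<Sum>j\<le>length w. if length w - j = length v then f (i, take j w) * word_kernel F (drop j w) v else 0)"
    unfolding conc_def word_vec_def column_kernel_def
    by (intro sum.cong) (auto simp: word_kernel_length)
  also have "\<dots> = (\<Sum>j\<le>length w. if j = length w - length v then
      (if length v \<le> length w then f (i, take j w) * word_kernel F (drop j w) v else 0) else 0)"
    by (intro sum.cong) auto
  finally show ?thesis by simp
qed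

lemma conc_word_append:
  "length u = length v \<Longrightarrow> conc f (word_vec F ((), v)) (i, w @ u) = f (i, w) * word_kernel F u v"
  by (simp add: conc_word)

lemma conc_word_vec: "conc (word_vec F (i, u)) (word_vec F ((), v)) = word_vec F (i, u @ v)"
proof
  fix p :: "'a \<times> 'b list"
  obtain j w where p: "p = (j, w)" by force
  show "conc (word_vec F (i, u)) (word_vec F ((), v)) p = word_vec F (i, u @ v) p"
  proof (cases "length w = length u + length v")
    case True
    then have "word_kernel F w (u @ v)
        = word_kernel F (take (length u) w) u * word_kernel F (drop (length u) w) v"
      using word_kernel_append[of "take (length u) w" u F "drop (length u) w" v] by simp
    then show ?thesis using True by (simp add: p conc_word word_vec_def column_kernel_def)
  next
    case False
    have "length v \<le> length w \<Longrightarrow> word_kernel F (take (length w - length v) w) u = 0"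
      using False by (intro word_kernel_length) auto
    moreover have "word_kernel F w (u @ v) = 0" using False by (intro word_kernel_length) auto
    ultimately show ?thesis by (simp add: p conc_word word_vec_def column_kernel_def)
  qed
qed

text \<open>Removing a suffix of the length of \<open>v\<close> commutes with cutting the remaining
  prefix in two.\<close>

lemma conc_assoc_word: "conc (conc f g) (word_vec F ((), v)) = conc f (conc g (word_vec F ((), v)))"
proof
  fix p :: "'a \<times> 'b list"
  obtain i w where p: "p = (i, w)" by force
  show "conc (conc f g) (word_vec F ((), v)) p = conc f (conc g (word_vec F ((), v))) p"
  proof (cases "length v \<le> length w")
    case le: True
    let ?n = "length w - length v"
    have "conc f (conc g (word_vec F ((), v))) (i, w)
        = (\<Sum>j\<le>length w. f (i, take j w) * conc g (word_vec F ((), v)) ((), drop j w))"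
      by (simp add: conc_def[of f])
    also have "\<dots> = (\<Sum>j\<le>?n. f (i, take j w) * conc g (word_vec F ((), v)) ((), drop j w))"
      by (rule sum.mono_neutral_right) (auto simp: conc_word)
    also have "\<dots> = (\<Sum>j\<le>?n. f (i, take j (take ?n w)) * g ((), drop j (take ?n w))
        * word_kernel F (drop ?n w) v)"
    proof (intro sum.cong refl)
      fix j assume j: "j \<in> {..?n}"
      then have "take (length w - j - length v) (drop j w) = drop j (take ?n w)"
        "drop (length w - j - length v) (drop j w) = drop ?n w" "take j (take ?n w) = take j w"
        "length v \<le> length w - j"
        using le by (auto simp: drop_take min_def diff_diff_add add.commute[of "length v" j])
      then show "f (i, take j w) * conc g (word_vec F ((), v)) ((), drop j w)
          = f (i, take j (take ?n w)) * g ((), drop j (take ?n w)) * word_kernel F (drop ?n w) v"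
        by (simp add: conc_word mult.assoc)
    qed
    also have "\<dots> = conc (conc f g) (word_vec F ((), v)) (i, w)"
      using le by (simp add: conc_word conc_def[of f] sum_distrib_right)
    finally show ?thesis by (simp add: p)
  next
    case False
    then show ?thesis by (auto simp: p conc_word conc_def[of f] intro!: sum.neutral)
  qed
qed

lemma conc_assoc_lc: "conc (conc f g) (lc (word_vec F) l) = conc f (conc g (lc (word_vec F) l))"
proof -
  have "conc (conc f g) (word_vec F s) = conc f (conc g (word_vec F s))" for s
    using conc_assoc_word[of f g F "snd s"] by (cases s) simp
  then show ?thesis by (simp add: conc_lc_right)
qed

lemma conc_Nil: "conc f (word_vec F ((), [])) = f"
  by (auto simp: fun_eq_iff conc_word)

lemma word_vec_apply: "word_vec F (i, u) (i, v) = word_kernel F v u"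
  by (simp add: word_vec_def column_kernel_def)

definition pick_kernel :: "('x \<Rightarrow> 'x \<Rightarrow> complex) \<Rightarrow> 'x \<Rightarrow> 'x \<Rightarrow> complex" where
  "pick_kernel F x y = 1 / (1 - F x y)"

text \<open>This is the inner product of \<open>f\<close> with the sum of the words
  \<open>z ... z\<close> in entry \<open>i\<close>. The Gram kernel of these sums is the geometric
  series of \<open>F\<close>, that is, the Pick kernel.\<close>

definition hat :: "('i \<times> 'x list \<Rightarrow> complex) \<Rightarrow> 'i \<Rightarrow> 'x \<Rightarrow> complex" where
  "hat f i z = (\<Sum>m. f (i, replicate m z))"

section \<open>Right multiplication by words and inner columns\<close>

locale pick =
  fixes F :: "'x \<Rightarrow> 'x \<Rightarrow> complex"
  assumes psd_F: "psd F" and F_less: "Re (F x x) < 1"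
begin

abbreviation fock :: "('i \<times> 'x list \<Rightarrow> complex) set" where
  "fock \<equiv> rk_set (column_kernel F)"

abbreviation fip :: "('i \<times> 'x list \<Rightarrow> complex) \<Rightarrow> ('i \<times> 'x list \<Rightarrow> complex) \<Rightarrow> complex" where
  "fip \<equiv> rk_ip (column_kernel F)"

abbreviation fnrm :: "('i \<times> 'x list \<Rightarrow> complex) \<Rightarrow> real" where
  "fnrm \<equiv> nrm fip"

lemma reproducing_fock: "reproducing fock fip (word_vec F)"
  using reproducing_rk[OF psd_column_kernel[OF psd_F]] by (simp add: word_vec_def[abs_def])

text \<open>Appending \<open>v\<close> to all words multiplies their Gram matrix by the number
  \<open>word_kernel F v v\<close>; right multiplication by \<open>v\<close> is therefore a multiple
  of an isometry on the span of the words, and it extends by density.\<close>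

lemma word_vec_conc_mem_nrm:
  fixes f :: "'i \<times> 'x list \<Rightarrow> complex"
  assumes f: "f \<in> fock"
  shows "conc f (word_vec F ((), v)) \<in> fock
    \<and> fnrm (conc f (word_vec F ((), v))) \<le> sqrt (Re (word_kernel F v v)) * fnrm f"
proof -
  interpret A: reproducing "fock :: ('i \<times> 'x list \<Rightarrow> complex) set" fip "word_vec F" by (rule reproducing_fock)
  have eq: "conc (lc (word_vec F) l) (word_vec F ((), v)) = lc (\<lambda>p. word_vec F (fst p, snd p @ v)) l"
    for l :: "(complex \<times> 'i \<times> 'x list) list"
  proof -
    have "conc (word_vec F p) (word_vec F ((), v)) = word_vec F (fst p, snd p @ v)" for p :: "'i \<times> 'x list"
      using conc_word_vec[of F "fst p" "snd p" v] by simp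
    then show ?thesis by (simp add: conc_lc_left)
  qed
  note vv = psd_diag[OF psd_word_kernel[OF psd_F], of v]
  show ?thesis
  proof (rule reproducing_extend[where T = "\<lambda>f. conc f (word_vec F ((), v))", OF reproducing_fock reproducing_fock _ _ _ _ f])
    show "conc (f - g) (word_vec F ((), v)) = conc f (word_vec F ((), v)) - conc g (word_vec F ((), v))"
      for f g :: "'i \<times> 'x list \<Rightarrow> complex" by (rule conc_linear)
    show "(\<lambda>n. conc (\<sigma> n) (word_vec F ((), v)) y) \<longlonglongrightarrow> conc f (word_vec F ((), v)) y"
      if "\<And>x. (\<lambda>n. \<sigma> n x) \<longlonglongrightarrow> f x" for \<sigma> f and y :: "'i \<times> 'x list"
      using that by (rule tendsto_conc_left)
    fix l :: "(complex \<times> 'i \<times> 'x list) list"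
    show mem: "conc (lc (word_vec F) l) (word_vec F ((), v)) \<in> fock"
      unfolding eq by (intro A.lc_mem A.kv_mem)
    have "fip (conc (lc (word_vec F) l) (word_vec F ((), v))) (conc (lc (word_vec F) l) (word_vec F ((), v)))
        = lform (\<lambda>p q. column_kernel F (fst p, snd p @ v) (fst q, snd q @ v)) l l"
      unfolding eq by (subst A.ip_lc_lc) (simp_all add: A.kv_mem A.reproduce word_vec_def)
    also have "\<dots> = lform (\<lambda>p q. word_kernel F v v * column_kernel F p q) l l"
    proof (intro lform_cong)
      fix p q :: "'i \<times> 'x list"
      have "word_kernel F (snd p @ v) (snd q @ v) = word_kernel F (snd p) (snd q) * word_kernel F v v"
      proof (cases "length (snd p) = length (snd q)")
        case False
        then show ?thesis by (simp add: word_kernel_length)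
      qed (rule word_kernel_append)
      then show "column_kernel F (fst p, snd p @ v) (fst q, snd q @ v)
          = word_kernel F v v * column_kernel F p q" by (simp add: column_kernel_def)
    qed
    also have "\<dots> = of_real (Re (word_kernel F v v)) * fip (lc (word_vec F) l) (lc (word_vec F) l)"
      by (simp add: lform_scale A.ip_lc_kv word_vec_def vv(1)[symmetric])
    finally have "Re (fip (conc (lc (word_vec F) l) (word_vec F ((), v))) (conc (lc (word_vec F) l) (word_vec F ((), v))))
        = Re (word_kernel F v v) * Re (fip (lc (word_vec F) l) (lc (word_vec F) l))"
      by (simp only: Re_of_real_mult)
    then show "fnrm (conc (lc (word_vec F) l) (word_vec F ((), v)))
        \<le> sqrt (Re (word_kernel F v v)) * fnrm (lc (word_vec F) l)"
      by (simp add: nrm_def real_sqrt_mult)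
  qed
qed

lemmas conc_word_mem = word_vec_conc_mem_nrm[THEN conjunct1]

lemma conc_word_conv:
  fixes f :: "'i \<times> 'x list \<Rightarrow> complex"
  assumes \<sigma>: "\<And>n. \<sigma> n \<in> fock" and f: "f \<in> fock" and c: "function_pre_hilbert.conv fip \<sigma> f"
  shows "function_pre_hilbert.conv fip (\<lambda>n. conc (\<sigma> n) (word_vec F ((), v))) (conc f (word_vec F ((), v)))"
proof -
  interpret A: reproducing "fock :: ('i \<times> 'x list \<Rightarrow> complex) set" fip "word_vec F" by (rule reproducing_fock)
  let ?C = "sqrt (Re (word_kernel F v v))"
  show ?thesis
    unfolding A.conv_def
  proof (rule Lim_null_comparison)
    have "norm (fnrm (conc (\<sigma> n) (word_vec F ((), v)) - conc f (word_vec F ((), v)))) \<le> ?C * fnrm (\<sigma> n - f)" for n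
      using word_vec_conc_mem_nrm[OF A.diff_mem[OF \<sigma> f], of n v]
        A.nrm_nonneg[OF conc_word_mem[OF A.diff_mem[OF \<sigma> f], of n v]]
      by (simp add: conc_linear)
    then show "\<forall>\<^sub>F n in sequentially.
        norm (fnrm (conc (\<sigma> n) (word_vec F ((), v)) - conc f (word_vec F ((), v)))) \<le> ?C * fnrm (\<sigma> n - f)"
      by simp
    show "(\<lambda>n. ?C * fnrm (\<sigma> n - f)) \<longlonglongrightarrow> 0"
      using c unfolding A.conv_def by (rule tendsto_mult_right_zero)
  qed
qed

text \<open>With \<open>R v\<close> for right multiplication by \<open>v\<close>, this says that the
  adjoint of \<open>R u\<close> composed with \<open>R v\<close> is the scalar
  \<open>word_kernel F u v\<close>; it replaces the relations of isometries with orthogonal ranges.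
  For a word \<open>g\<close> both sides are values of \<open>f\<close>, and the rest is continuity
  in \<open>g\<close>.\<close>

lemma ip_conc_word:
  fixes f g :: "'i \<times> 'x list \<Rightarrow> complex"
  assumes f: "f \<in> fock" and g: "g \<in> fock" and len: "length u = length v"
  shows "fip (conc g (word_vec F ((), v))) (conc f (word_vec F ((), u))) = word_kernel F u v * fip g f"
proof -
  interpret A: reproducing "fock :: ('i \<times> 'x list \<Rightarrow> complex) set" fip "word_vec F" by (rule reproducing_fock)
  let ?R = "\<lambda>f. conc f (word_vec F ((), v))" and ?f = "conc f (word_vec F ((), u))"
  have base: "fip (?R (word_vec F p)) ?f = word_kernel F u v * fip (word_vec F p) f" for p
  proof -
    have "fip (?R (word_vec F p)) ?f = cnj (?f (fst p, snd p @ v))"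
      using conc_word_vec[of F "fst p" "snd p" v] A.ip_commute[OF A.kv_mem conc_word_mem[OF f]]
        A.reproduce[OF conc_word_mem[OF f]] by simp
    also have "\<dots> = cnj (f p) * cnj (word_kernel F v u)"
      using len by (simp add: conc_word_append)
    also have "cnj (word_kernel F v u) = word_kernel F u v"
      using psd_herm[OF psd_word_kernel[OF psd_F], of u v] by simp
    also have "cnj (f p) = fip (word_vec F p) f"
      using A.ip_commute[OF A.kv_mem f] A.reproduce[OF f] by simp
    finally show ?thesis by simp
  qed
  have lcs: "fip (?R (lc (word_vec F) l)) ?f = word_kernel F u v * fip (lc (word_vec F) l) f" for l
    by (simp add: conc_lc_left A.ip_lc_left conc_word_mem A.kv_mem f base lin_mult)
  obtain \<sigma> where \<sigma>: "\<And>n. \<sigma> n \<in> range (lc (word_vec F))" "A.conv \<sigma> g"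
    using A.clo_sequence[OF A.lc_kv_dense[OF g] A.lc_kv_subset] by blast
  have \<sigma>m: "\<sigma> n \<in> fock" for n using \<sigma>(1)[of n] A.lc_kv_mem by auto
  show ?thesis
  proof (rule LIMSEQ_unique)
    show "(\<lambda>n. fip (?R (\<sigma> n)) ?f) \<longlonglongrightarrow> fip (?R g) ?f"
      by (rule A.conv_ip[OF conc_word_mem[OF \<sigma>m] conc_word_mem[OF g] conc_word_conv[OF \<sigma>m g \<sigma>(2)] conc_word_mem[OF f]])
    have "fip (?R (\<sigma> n)) ?f = word_kernel F u v * fip (\<sigma> n) f" for n
      using \<sigma>(1)[of n] lcs by auto
    then show "(\<lambda>n. fip (?R (\<sigma> n)) ?f) \<longlonglongrightarrow> word_kernel F u v * fip g f"
      using tendsto_mult_left[OF A.conv_ip[OF \<sigma>m g \<sigma>(2) f]] by simp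
  qed
qed

text \<open>The right multiples of \<open>\<Theta>\<close> by words have the Gram matrix of the
  words themselves. By density this makes left multiplication by \<open>\<Theta>\<close> an isometry
  on the Fock space.\<close>

definition inner :: "('i \<times> 'x list \<Rightarrow> complex) \<Rightarrow> bool" where
  "inner \<Theta> \<longleftrightarrow> \<Theta> \<in> fock \<and> (\<forall>u v. fip (conc \<Theta> (word_vec F ((), v))) (conc \<Theta> (word_vec F ((), u))) = word_kernel F u v)"

lemma inner_poly:
  fixes \<Theta> :: "'i \<times> 'x list \<Rightarrow> complex"
  assumes "inner \<Theta>"
  shows "conc \<Theta> (lc (word_vec F) l) \<in> fock" "fnrm (conc \<Theta> (lc (word_vec F) l)) = fnrm (lc (word_vec F) l)"
proof -
  interpret A: reproducing "fock :: ('i \<times> 'x list \<Rightarrow> complex) set" fip "word_vec F" by (rule reproducing_fock)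
  interpret U: reproducing "fock :: (unit \<times> 'x list \<Rightarrow> complex) set" fip "word_vec F" by (rule reproducing_fock)
  have m: "conc \<Theta> (word_vec F s) \<in> fock" for s
    using assms conc_word_mem[of \<Theta> "snd s"] by (cases s) (simp add: inner_def)
  show "conc \<Theta> (lc (word_vec F) l) \<in> fock"
    unfolding conc_lc_right by (intro A.lc_mem m)
  have "fip (conc \<Theta> (word_vec F s)) (conc \<Theta> (word_vec F t)) = word_vec F s t" for s t :: "unit \<times> 'x list"
    using assms by (cases s; cases t) (simp add: inner_def word_vec_def column_kernel_def)
  then have "fip (conc \<Theta> (lc (word_vec F) l)) (conc \<Theta> (lc (word_vec F) l)) = fip (lc (word_vec F) l) (lc (word_vec F) l)"
    unfolding conc_lc_right by (simp add: A.ip_lc_lc m U.ip_lc_kv)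
  then show "fnrm (conc \<Theta> (lc (word_vec F) l)) = fnrm (lc (word_vec F) l)" by (simp add: nrm_def)
qed

lemma inner_conc_le:
  fixes \<Theta> :: "'i \<times> 'x list \<Rightarrow> complex"
  assumes "inner \<Theta>" "g \<in> fock"
  shows "conc \<Theta> g \<in> fock \<and> fnrm (conc \<Theta> g) \<le> 1 * fnrm g"
proof (rule reproducing_extend[where T = "conc \<Theta>", OF reproducing_fock reproducing_fock _ _ _ _ assms(2)])
  show "conc \<Theta> (f - g) = conc \<Theta> f - conc \<Theta> g" for f g by (rule conc_linear)
  show "(\<lambda>n. conc \<Theta> (\<sigma> n) y) \<longlonglongrightarrow> conc \<Theta> f y" if "\<And>x. (\<lambda>n. \<sigma> n x) \<longlonglongrightarrow> f x" for \<sigma> f y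
    using that by (rule tendsto_conc_right)
qed (simp_all add: inner_poly[OF assms(1)])

lemma inner_conc_mem: "inner \<Theta> \<Longrightarrow> g \<in> fock \<Longrightarrow> conc \<Theta> g \<in> fock"
  using inner_conc_le by blast

lemma inner_conc_nrm:
  fixes \<Theta> :: "'i \<times> 'x list \<Rightarrow> complex"
  assumes \<Theta>: "inner \<Theta>" and g: "g \<in> fock"
  shows "fnrm (conc \<Theta> g) = fnrm g"
proof -
  interpret A: reproducing "fock :: ('i \<times> 'x list \<Rightarrow> complex) set" fip "word_vec F" by (rule reproducing_fock)
  interpret U: reproducing "fock :: (unit \<times> 'x list \<Rightarrow> complex) set" fip "word_vec F" by (rule reproducing_fock)
  obtain \<sigma> where \<sigma>: "\<And>n. \<sigma> n \<in> range (lc (word_vec F))" "U.conv \<sigma> g"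
    using U.clo_sequence[OF U.lc_kv_dense[OF g] U.lc_kv_subset] by blast
  have \<sigma>m: "\<sigma> n \<in> fock" for n using \<sigma>(1)[of n] U.lc_kv_mem by auto
  have "A.conv (\<lambda>n. conc \<Theta> (\<sigma> n)) (conc \<Theta> g)"
    unfolding A.conv_def
  proof (rule Lim_null_comparison)
    have "norm (fnrm (conc \<Theta> (\<sigma> n) - conc \<Theta> g)) \<le> fnrm (\<sigma> n - g)" for n
      using inner_conc_le[OF \<Theta> U.diff_mem[OF \<sigma>m g], of n]
        A.nrm_nonneg[OF inner_conc_mem[OF \<Theta> U.diff_mem[OF \<sigma>m g]], of n]
      by (simp add: conc_linear)
    then show "\<forall>\<^sub>F n in sequentially. norm (fnrm (conc \<Theta> (\<sigma> n) - conc \<Theta> g)) \<le> fnrm (\<sigma> n - g)"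
      by simp
    show "(\<lambda>n. fnrm (\<sigma> n - g)) \<longlonglongrightarrow> 0" using \<sigma>(2) unfolding U.conv_def .
  qed
  from A.conv_nrm[OF inner_conc_mem[OF \<Theta> \<sigma>m] inner_conc_mem[OF \<Theta> g] this]
  have "(\<lambda>n. fnrm (conc \<Theta> (\<sigma> n))) \<longlonglongrightarrow> fnrm (conc \<Theta> g)" .
  moreover have "fnrm (conc \<Theta> (\<sigma> n)) = fnrm (\<sigma> n)" for n
    using \<sigma>(1)[of n] inner_poly(2)[OF \<Theta>] by auto
  ultimately have "(\<lambda>n. fnrm (\<sigma> n)) \<longlonglongrightarrow> fnrm (conc \<Theta> g)" by simp
  then show ?thesis using U.conv_nrm[OF \<sigma>m g \<sigma>(2)] LIMSEQ_unique by blast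
qed

text \<open>The range of an isometry on a complete space is closed: the preimages of a convergent
  sequence form a Cauchy sequence.\<close>

lemma inner_factor:
  fixes \<Theta> :: "'i \<times> 'x list \<Rightarrow> complex"
  assumes \<Theta>: "inner \<Theta>" and f: "f \<in> function_pre_hilbert.clo fock fip (range (\<lambda>l. conc \<Theta> (lc (word_vec F) l)))"
  shows "\<exists>g\<in>fock. f = conc \<Theta> g"
proof -
  interpret A: reproducing "fock :: ('i \<times> 'x list \<Rightarrow> complex) set" fip "word_vec F" by (rule reproducing_fock)
  interpret U: reproducing "fock :: (unit \<times> 'x list \<Rightarrow> complex) set" fip "word_vec F" by (rule reproducing_fock)
  have sub: "range (\<lambda>l. conc \<Theta> (lc (word_vec F) l)) \<subseteq> fock" using inner_poly(1)[OF \<Theta>] by auto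
  obtain \<tau> where \<tau>: "\<And>n. \<tau> n \<in> range (\<lambda>l. conc \<Theta> (lc (word_vec F) l))" "A.conv \<tau> f"
    using A.clo_sequence[OF f sub] by blast
  have "\<forall>n. \<exists>l. \<tau> n = conc \<Theta> (lc (word_vec F) l)" using \<tau>(1) by blast
  then obtain l where l: "\<And>n. \<tau> n = conc \<Theta> (lc (word_vec F) (l n))" by metis
  have \<tau>m: "\<tau> n \<in> fock" for n using \<tau>(1)[of n] sub by auto
  have fm: "f \<in> fock" using A.clo_mem[OF f] .
  let ?\<sigma> = "\<lambda>n. lc (word_vec F) (l n)"
  have "fnrm (?\<sigma> m - ?\<sigma> n) = fnrm (\<tau> m - \<tau> n)" for m n
    using inner_conc_nrm[OF \<Theta> U.diff_mem[OF U.lc_kv_mem U.lc_kv_mem]] by (simp add: l conc_linear)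
  then have "U.cauchy ?\<sigma>"
    using A.conv_cauchy[OF \<tau>m fm \<tau>(2)] by (simp add: A.cauchy_def U.cauchy_def)
  then obtain g where g: "g \<in> fock" "U.conv ?\<sigma> g" using U.cauchy_conv[of ?\<sigma>, OF U.lc_kv_mem] by blast
  have "f p = conc \<Theta> g p" for p
  proof (rule LIMSEQ_unique)
    show "(\<lambda>n. \<tau> n p) \<longlonglongrightarrow> f p" by (rule A.conv_pointwise[OF \<tau>m fm \<tau>(2)])
    show "(\<lambda>n. \<tau> n p) \<longlonglongrightarrow> conc \<Theta> g p"
      unfolding l by (rule tendsto_conc_right) (rule U.conv_pointwise[OF U.lc_kv_mem g])
  qed
  then show ?thesis using g by blast
qed

section \<open>The passage from words to functions with the Pick kernel\<close>

lemma F_norm_less: "cmod (F x y) < 1"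
proof -
  have "(cmod (F x y))\<^sup>2 \<le> Re (F x x) * Re (F y y)"
    using psd_Cauchy_Schwarz[OF psd_F, of "[(1, y)]" x] by (simp add: lform_simps)
  also have "\<dots> \<le> Re (F x x) * 1"
    using F_less[of y] psd_diag(2)[OF psd_F, of x] by (intro mult_left_mono) auto
  also have "\<dots> < 1" using F_less[of x] by simp
  finally show ?thesis by (simp add: power_less_one_iff)
qed

lemma F_geometric: "(\<lambda>m. F x y ^ m) sums pick_kernel F x y"
  using geometric_sums[OF F_norm_less] by (simp add: pick_kernel_def)

lemma psd_power: "psd (\<lambda>x y. F x y ^ m)"
proof (induction m)
  case 0
  have "psd (\<lambda>x y :: 'x. cnj 1 * of_bool (() = ()) * 1)" by (rule psd_pullback[OF psd_of_bool_eq])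
  then show ?case by simp
next
  case (Suc m)
  then show ?case using psd_mult[OF psd_F Suc] by simp
qed

text \<open>The case \<open>M = 0\<close> is positivity of the Pick kernel; the other tails control
  the error when the geometric series is truncated.\<close>

lemma psd_tail: "psd (\<lambda>x y. F x y ^ M * pick_kernel F x y)"
proof (rule psd_limit)
  show "psd (\<lambda>x y. \<Sum>m<n. F x y ^ (M + m))" for n by (intro psd_sum psd_power)
  show "(\<lambda>n. \<Sum>m<n. F x y ^ (M + m)) \<longlonglongrightarrow> F x y ^ M * pick_kernel F x y" for x y
    using sums_mult[OF F_geometric[of x y], of "F x y ^ M"] by (simp add: sums_def power_add)
qed

lemma psd_pick_kernel: "psd (pick_kernel F)"
  using psd_tail[of 0] by simp

abbreviation HK :: "('x \<Rightarrow> complex) set" where "HK \<equiv> rk_set (pick_kernel F)"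
abbreviation hip :: "('x \<Rightarrow> complex) \<Rightarrow> ('x \<Rightarrow> complex) \<Rightarrow> complex" where "hip \<equiv> rk_ip (pick_kernel F)"
abbreviation hnrm :: "('x \<Rightarrow> complex) \<Rightarrow> real" where "hnrm \<equiv> nrm hip"

sublocale HR: reproducing HK hip "\<lambda>x y. pick_kernel F y x"
  by (rule reproducing_rk[OF psd_pick_kernel])

text \<open>The norm of the word \<open>z ... z\<close> decays geometrically because
  \<open>F z z\<close> is below 1. Absolute convergence is what the Cauchy product in
  \<open>hat_conc\<close> requires.\<close>

lemma fock_summable:
  fixes f :: "'i \<times> 'x list \<Rightarrow> complex"
  assumes f: "f \<in> fock" shows "summable (\<lambda>m. norm (f (i, replicate m z)))"
proof -
  interpret A: reproducing "fock :: ('i \<times> 'x list \<Rightarrow> complex) set" fip "word_vec F" by (rule reproducing_fock)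
  define r where "r = sqrt (Re (F z z))"
  have r: "0 \<le> r" "r < 1" using psd_diag(2)[OF psd_F, of z] F_less[of z] by (auto simp: r_def)
  have "fip (word_vec F (i, replicate m z)) (word_vec F (i, replicate m z)) = of_real (r ^ (2 * m))" for m
  proof -
    have "F z z = of_real (r\<^sup>2)"
      using psd_diag[OF psd_F, of z] by (simp add: r_def)
    then show ?thesis
      by (simp add: A.reproduce A.kv_mem word_vec_apply word_kernel_replicate power_mult)
  qed
  then have n: "fnrm (word_vec F (i, replicate m z)) = r ^ m" for m
    using r by (simp add: nrm_def power_mult[of r 2 m] power2_eq_square real_sqrt_mult flip: power_mult_distrib)
      (simp add: power_mult_distrib)
  have le: "norm (f (i, replicate m z)) \<le> fnrm f * r ^ m" for m
    using A.eval_bound[OF f, of "(i, replicate m z)"] by (simp add: n)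
  have "summable (\<lambda>m. r ^ m)" by (rule summable_geometric) (use r in simp)
  then have "summable (\<lambda>m. fnrm f * r ^ m)" by (rule summable_mult)
  then show ?thesis
  proof (rule summable_comparison_test')
    show "norm (norm (f (i, replicate m z))) \<le> fnrm f * r ^ m" for m using le by simp
  qed
qed

lemma hat_sums: "f \<in> fock \<Longrightarrow> (\<lambda>m. f (i, replicate m z)) sums hat f i z"
  unfolding hat_def by (rule summable_sums[OF summable_norm_cancel[OF fock_summable]])

lemma hat_diff:
  fixes f g :: "'i \<times> 'x list \<Rightarrow> complex"
  assumes "f \<in> fock" "g \<in> fock" shows "hat (f - g) i = hat f i - hat g i"
proof
  fix z
  have "(\<lambda>m. (f - g) (i, replicate m z)) sums (hat f i z - hat g i z)"
    using sums_diff[OF hat_sums hat_sums, OF assms] by simp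
  then show "hat (f - g) i z = (hat f i - hat g i) z" unfolding hat_def[of "f - g"] by (simp add: sums_iff)
qed

lemma hat_lc:
  fixes G :: "'s \<Rightarrow> 'i \<times> 'x list \<Rightarrow> complex"
  assumes "\<And>s. G s \<in> fock" shows "hat (lc G l) i = lc (\<lambda>s. hat (G s) i) l"
proof
  fix z
  have "(\<lambda>m. lin l (\<lambda>s. G s (i, replicate m z))) sums lin l (\<lambda>s. hat (G s) i z)"
    by (induction l) (auto intro!: sums_add sums_mult hat_sums assms)
  then show "hat (lc G l) i z = lc (\<lambda>s. hat (G s) i) l z" by (simp add: lc_def hat_def[of "\<lambda>x. lin l (\<lambda>s. G s x)"] sums_iff)
qed

text \<open>All prefixes and suffixes of \<open>z ... z\<close> are again powers of the letter
  \<open>z\<close>, so deconcatenation becomes the Cauchy product of two series.\<close>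

lemma hat_conc:
  fixes f :: "'i \<times> 'x list \<Rightarrow> complex"
  assumes f: "f \<in> fock" and g: "g \<in> fock"
  shows "hat (conc f g) i = hat f i * hat g ()"
proof
  fix z
  have "hat f i z * hat g () z = (\<Sum>k. \<Sum>j\<le>k. f (i, replicate j z) * g ((), replicate (k - j) z))"
    unfolding hat_def by (rule Cauchy_product[OF fock_summable[OF f] fock_summable[OF g]])
  also have "\<dots> = hat (conc f g) i z"
    unfolding hat_def by (intro suminf_cong) (auto simp: conc_def min_def intro!: sum.cong)
  finally show "hat (conc f g) i z = (hat f i * hat g ()) z" by simp
qed

text \<open>Replacing each point \<open>z\<close> of a list by the words \<open>z ... z\<close> of
  length below \<open>M\<close> gives a list of words. The defect of \<open>f\<close> there is at
  most its squared norm and tends to the defect of \<open>hat f i\<close> at the original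
  list.\<close>

lemma hat_mem_nrm:
  fixes f :: "'i \<times> 'x list \<Rightarrow> complex"
  assumes f: "f \<in> fock"
  shows "hat f i \<in> HK \<and> hnrm (hat f i) \<le> fnrm f"
proof -
  interpret A: reproducing "fock :: ('i \<times> 'x list \<Rightarrow> complex) set" fip "word_vec F" by (rule reproducing_fock)
  have "rk_defect (pick_kernel F) (hat f i) l \<le> rk_sq (column_kernel F) f" for l
  proof -
    define L where "L M = concat (map (\<lambda>m. map (\<lambda>(a, z). (a, (i, replicate m z))) l) [0..<M])" for M
    have L: "L (Suc M) = L M @ map (\<lambda>(a, z). (a, (i, replicate M z))) l" "L 0 = []" for M
      by (simp_all add: L_def)
    have lin1: "lin (map (\<lambda>(a, z). (a, (i, replicate M z))) l) g = lin l (\<lambda>z. g (i, replicate M z))"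
      "clin (map (\<lambda>(a, z). (a, (i, replicate M z))) l) g = clin l (\<lambda>z. g (i, replicate M z))" for g M
      by (induction l) auto
    have lin: "lin (L M) g = (\<Sum>m<M. lin l (\<lambda>z. g (i, replicate m z)))"
      "clin (L M) g = (\<Sum>m<M. clin l (\<lambda>z. g (i, replicate m z)))" for g M
      by (induction M) (simp_all add: L lin1)
    have "lform (column_kernel F) (L M) (L M) = lform (\<lambda>x y. \<Sum>m<M. F x y ^ m) l l" for M
    proof -
      have "(\<Sum>m'<M. lin l (\<lambda>y. column_kernel F (i, replicate m x) (i, replicate m' y)))
          = lin l (\<lambda>y. F x y ^ m)" if "m < M" for m x
      proof -
        have "(\<Sum>m'<M. lin l (\<lambda>y. column_kernel F (i, replicate m x) (i, replicate m' y)))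
            = (\<Sum>m'<M. if m = m' then lin l (\<lambda>y. F x y ^ m) else 0)"
          by (intro sum.cong) (auto simp: column_kernel_def word_kernel_replicate)
        then show ?thesis using that by simp
      qed
      then have "lform (column_kernel F) (L M) (L M) = (\<Sum>m<M. lform (\<lambda>x y. F x y ^ m) l l)"
        unfolding lform_def lin by simp
      then show ?thesis by (simp add: lform_sum)
    qed
    then have "rk_defect (column_kernel F) f (L M)
        = 2 * Re (clin l (\<lambda>z. \<Sum>m<M. f (i, replicate m z))) - Re (lform (\<lambda>x y. \<Sum>m<M. F x y ^ m) l l)" for M
      by (simp add: rk_defect_def lin(2) clin_sum)
    moreover have "(\<lambda>M. 2 * Re (clin l (\<lambda>z. \<Sum>m<M. f (i, replicate m z))) - Re (lform (\<lambda>x y. \<Sum>m<M. F x y ^ m) l l))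
        \<longlonglongrightarrow> rk_defect (pick_kernel F) (hat f i) l"
      unfolding rk_defect_def lform_def
      using hat_sums[OF f] F_geometric unfolding sums_def by (intro tendsto_intros) auto
    ultimately have "(\<lambda>M. rk_defect (column_kernel F) f (L M)) \<longlonglongrightarrow> rk_defect (pick_kernel F) (hat f i) l"
      by simp
    then show ?thesis by (rule LIMSEQ_le_const2) (use rk_sq_upper[OF f] in blast)
  qed
  from rk_sq_least[OF this] have *: "hat f i \<in> HK" "rk_sq (pick_kernel F) (hat f i) \<le> rk_sq (column_kernel F) f" by simp_all
  have "hnrm (hat f i) \<le> fnrm f"
  proof (rule power2_le_imp_le)
    show "(hnrm (hat f i))\<^sup>2 \<le> (fnrm f)\<^sup>2"
      using * nrm_rk[OF psd_pick_kernel *(1)] nrm_rk[OF psd_column_kernel[OF psd_F] f] by simp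
  qed (rule A.nrm_nonneg[OF f])
  then show ?thesis using * by blast
qed

definition word_fun :: "'x list \<Rightarrow> 'x \<Rightarrow> complex" where
  "word_fun u = hat (word_vec F ((), u)) ()"

lemma word_vec_mem: "word_vec F p \<in> fock"
  by (rule reproducing.kv_mem[OF reproducing_fock])

lemma word_fun_mem: "word_fun u \<in> HK"
  unfolding word_fun_def by (rule hat_mem_nrm[OF word_vec_mem, THEN conjunct1])

lemma word_fun_replicate: "word_fun (replicate m z) y = F y z ^ m"
proof -
  have "(\<lambda>n. if n = m then F y z ^ m else 0) sums F y z ^ m" by (rule sums_single)
  then have "(\<lambda>n. word_vec F ((), replicate m z) ((), replicate n y)) sums F y z ^ m"
    by (simp add: word_vec_apply word_kernel_replicate if_distrib cong: if_cong)
  then show ?thesis by (simp add: word_fun_def hat_def sums_iff)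
qed

lemma word_fun_Nil: "word_fun [] = 1"
  using word_fun_replicate[of 0] by auto

text \<open>The remainder kernel \<open>F^M K\<close>, with \<open>K\<close> the Pick kernel, is
  positive and dominated by \<open>K\<close>. Its column at \<open>z\<close> therefore has squared
  norm at most its own value at \<open>z\<close>, which tends to 0. This will place the kernel
  functions in the closure of the multipliers.\<close>

lemma kernel_word_fun:
  "HR.conv (\<lambda>M y. \<Sum>m<M. word_fun (replicate m z) y) (\<lambda>y. pick_kernel F y z)"
proof -
  define k where "k M y = F y z ^ M * pick_kernel F y z" for M y
  have diff: "(\<lambda>y. \<Sum>m<M. word_fun (replicate m z) y) - (\<lambda>y. pick_kernel F y z) = - k M" for M
  proof
    fix y
    have "F y z \<noteq> 1" using F_norm_less[of y z] by auto
    then show "((\<lambda>y. \<Sum>m<M. word_fun (replicate m z) y) - (\<lambda>y. pick_kernel F y z)) y = (- k M) y"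
      by (simp add: word_fun_replicate k_def pick_kernel_def sum_gp_strict diff_divide_distrib)
  qed
  have k: "k M \<in> HK \<and> rk_sq (pick_kernel F) (k M) \<le> Re (k M z)" for M
  proof (rule rk_sq_least)
    fix l
    let ?K = "\<lambda>x y. F x y ^ M * pick_kernel F x y"
    have c: "clin l (k M) = cnj (lin l (?K z))"
      unfolding cnj_lin k_def using psd_herm[OF psd_tail] by (intro clin_cong) metis
    have "0 \<le> Re (lform ?K ((-1, z) # l) ((-1, z) # l))" by (rule psd_nonneg[OF psd_tail])
    then have 1: "2 * Re (clin l (k M)) \<le> Re (k M z) + Re (lform ?K l l)"
      using c by (simp add: lform_simps k_def[abs_def])
    have "psd (\<lambda>x y. \<Sum>m<M. F x y ^ m)" by (intro psd_sum psd_power)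
    \<comment> \<open>The truncated series is the difference of the Pick kernel and the tail, so its
      positivity is the domination just mentioned.\<close>
    from psd_nonneg[OF this, of l] have "0 \<le> Re (lform (\<lambda>x y. pick_kernel F x y - ?K x y) l l)"
    proof -
      have "(\<Sum>m<M. F x y ^ m) = pick_kernel F x y - ?K x y" for x y
      proof -
        have "F x y \<noteq> 1" using F_norm_less[of x y] by auto
        then show ?thesis by (simp add: pick_kernel_def sum_gp_strict field_simps)
      qed
      then show ?thesis using \<open>0 \<le> Re (lform (\<lambda>x y. \<Sum>m<M. F x y ^ m) l l)\<close> by simp
    qed
    then show "rk_defect (pick_kernel F) (k M) l \<le> Re (k M z)"
      using 1 by (simp add: lform_diff rk_defect_def)
  qed
  have "HR.conv (\<lambda>M y. \<Sum>m<M. word_fun (replicate m z) y) (\<lambda>y. pick_kernel F y z)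
      \<longleftrightarrow> (\<lambda>M. hnrm (k M)) \<longlonglongrightarrow> 0"
    unfolding HR.conv_def diff using HR.nrm_uminus k by simp
  also have "\<dots>"
  proof (rule Lim_null_comparison)
    have "norm (hnrm (k M)) \<le> sqrt (Re (k M z))" for M
      using k[of M] nrm_rk[OF psd_pick_kernel, of "k M"] HR.nrm_nonneg[of "k M"] by (simp add: real_le_rsqrt)
    then show "\<forall>\<^sub>F M in sequentially. norm (hnrm (k M)) \<le> sqrt (Re (k M z))" by simp
    have "(\<lambda>M. k M z) \<longlonglongrightarrow> 0 * pick_kernel F z z"
      unfolding k_def by (intro tendsto_mult tendsto_const LIMSEQ_power_zero F_norm_less)
    then have "(\<lambda>M. sqrt (Re (k M z))) \<longlonglongrightarrow> sqrt (Re 0)" by (intro tendsto_intros) simp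
    then show "(\<lambda>M. sqrt (Re (k M z))) \<longlonglongrightarrow> 0" by simp
  qed
  finally show ?thesis .
qed

text \<open>The lift \<open>g\<close> is the adjoint of \<open>hat\<close> applied to each entry:
  its inner product with a word is that of \<open>f i\<close> with the image of the word. Since
  \<open>hat\<close> is contractive, so is the lift, and \<open>kernel_word_fun\<close> identifies
  \<open>hat g i z\<close> with the inner product of \<open>f i\<close> and the kernel vector at
  \<open>z\<close>.\<close>

lemma fock_lift:
  fixes f :: "'i \<Rightarrow> 'x \<Rightarrow> complex"
  assumes f: "\<And>i. f i \<in> HK" and bound: "\<And>S. finite S \<Longrightarrow> (\<Sum>i\<in>S. (hnrm (f i))\<^sup>2) \<le> B"
  obtains g :: "'i \<times> 'x list \<Rightarrow> complex" where "g \<in> fock" "(fnrm g)\<^sup>2 \<le> B" "\<And>i. hat g i = f i"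
proof -
  interpret U: reproducing "fock :: (unit \<times> 'x list \<Rightarrow> complex) set" fip "word_vec F" by (rule reproducing_fock)
  define g where "g p = hip (f (fst p)) (word_fun (snd p))" for p
  have "rk_defect (column_kernel F) g l \<le> B" for l
  proof -
    define S where "S = (\<lambda>p. fst (snd p)) ` set l"
    \<comment> \<open>Words in different entries are orthogonal, so both terms of the defect split
      over the finitely many indices that occur in \<open>l\<close>.\<close>
    define fl where "fl i = filter (\<lambda>p. fst (snd p) = i) l" for i
    have split: "clin l h = (\<Sum>i\<in>S. clin (fl i) h)" for h
    proof -
      have "clin k h = (\<Sum>i\<in>T. clin (filter (\<lambda>p. fst (snd p) = i) k) h)"
        if "finite T" "(\<lambda>p. fst (snd p)) ` set k \<subseteq> T" for k T
        using that(2)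
      proof (induction k)
        case (Cons p k)
        have "(\<Sum>i\<in>T. clin (filter (\<lambda>p. fst (snd p) = i) (p # k)) h)
            = (\<Sum>i\<in>T. (if fst (snd p) = i then cnj (fst p) * h (snd p) else 0) + clin (filter (\<lambda>p. fst (snd p) = i) k) h)"
          by (intro sum.cong) auto
        then show ?case using Cons that(1) by (simp add: sum.distrib)
      qed simp
      then show ?thesis unfolding fl_def by (auto simp: S_def)
    qed
    have fli: "fst p = i" if "p \<in> snd ` set (fl i)" for p i using that by (auto simp: fl_def)
    have form: "lform (column_kernel F) l l = (\<Sum>i\<in>S. lform (column_kernel F) (fl i) (fl i))"
    proof -
      have "clin (fl i) (\<lambda>x. lin l (column_kernel F x)) = clin (fl i) (\<lambda>x. lin (fl i) (column_kernel F x))" for i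
      proof (intro clin_cong)
        fix x assume "x \<in> snd ` set (fl i)"
        then have "fst x = i" by (rule fli)
        then show "lin l (column_kernel F x) = lin (fl i) (column_kernel F x)"
          unfolding fl_def by (subst lin_filter[where P = "\<lambda>p. fst p = i"]) (auto simp: column_kernel_def)
      qed
      then show ?thesis unfolding lform_def split by simp
    qed
    define pl where "pl i = lc (\<lambda>p. word_fun (snd p)) (fl i)" for i
    have plm: "pl i \<in> HK" for i unfolding pl_def by (intro HR.lc_mem word_fun_mem)
    have c: "clin (fl i) g = hip (f i) (pl i)" for i
    proof -
      have "clin (fl i) g = clin (fl i) (\<lambda>p. hip (f i) (word_fun (snd p)))"
        by (intro clin_cong) (simp add: g_def fli)
      also have "\<dots> = hip (f i) (pl i)"
        unfolding pl_def by (intro HR.ip_lc_right[symmetric] word_fun_mem f)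
      finally show ?thesis .
    qed
    have q: "(hnrm (pl i))\<^sup>2 \<le> Re (lform (column_kernel F) (fl i) (fl i))" for i
    proof -
      define e where "e = lc (\<lambda>p. word_vec F ((), snd p)) (fl i)"
      have em: "e \<in> fock" unfolding e_def by (intro U.lc_mem word_vec_mem)
      have "pl i = hat e ()" unfolding pl_def e_def word_fun_def by (simp add: hat_lc word_vec_mem)
      then have "hnrm (pl i) \<le> fnrm e" using hat_mem_nrm[OF em] by simp
      then have "(hnrm (pl i))\<^sup>2 \<le> (fnrm e)\<^sup>2" by (intro power_mono HR.nrm_nonneg plm)
      also have "fip e e = lform (column_kernel F) (fl i) (fl i)"
        unfolding e_def
        by (subst U.ip_lc_lc)
          (auto simp: word_vec_mem U.reproduce word_vec_def column_kernel_def dest!: fli intro!: lform_cong)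
      then have "(fnrm e)\<^sup>2 = Re (lform (column_kernel F) (fl i) (fl i))" by (simp add: U.nrm_power2 em)
      finally show ?thesis .
    qed
    have "rk_defect (column_kernel F) g l = (\<Sum>i\<in>S. 2 * Re (hip (f i) (pl i)) - Re (lform (column_kernel F) (fl i) (fl i)))"
      by (simp add: rk_defect_def form split c sum_subtractf sum_distrib_left)
    also have "\<dots> \<le> (\<Sum>i\<in>S. (hnrm (f i))\<^sup>2)"
    proof (intro sum_mono)
      fix i
      have "Re (hip (f i) (pl i)) \<le> hnrm (f i) * hnrm (pl i)"
        using HR.Cauchy_Schwarz[OF f plm, of i i] complex_Re_le_cmod order_trans by blast
      moreover have "2 * (hnrm (f i) * hnrm (pl i)) \<le> (hnrm (f i))\<^sup>2 + (hnrm (pl i))\<^sup>2"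
        using sum_squares_bound[of "hnrm (f i)" "hnrm (pl i)"] by simp
      ultimately show "2 * Re (hip (f i) (pl i)) - Re (lform (column_kernel F) (fl i) (fl i)) \<le> (hnrm (f i))\<^sup>2"
        using q[of i] by linarith
    qed
    also have "\<dots> \<le> B" by (intro bound) (simp add: S_def)
    finally show ?thesis .
  qed
  from rk_sq_least[OF this] have g: "g \<in> fock" "rk_sq (column_kernel F) g \<le> B" by simp_all
  have "hat g i = f i" for i
  proof
    fix z
    let ?\<sigma> = "\<lambda>M y. \<Sum>m<M. word_fun (replicate m z) y"
    have \<sigma>: "?\<sigma> M \<in> HK \<and> hip (f i) (?\<sigma> M) = (\<Sum>m<M. g (i, replicate m z))" for M
    proof (induction M)
      case 0
      have z: "(\<lambda>y. 0::complex) = 0" by auto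
      show ?case using HR.zero_mem HR.ip_zero_right[OF f] by (simp add: z)
    next
      case (Suc M)
      have "?\<sigma> (Suc M) = ?\<sigma> M + word_fun (replicate M z)" by auto
      then show ?case
        using Suc by (simp only:) (simp add: HR.add_mem HR.ip_add_right word_fun_mem f g_def)
    qed
    have "(\<lambda>M. hip (?\<sigma> M) (f i)) \<longlonglongrightarrow> hip (\<lambda>y. pick_kernel F y z) (f i)"
      using \<sigma> by (intro HR.conv_ip HR.kv_mem f kernel_word_fun) auto
    then have "(\<lambda>M. cnj (hip (?\<sigma> M) (f i))) \<longlonglongrightarrow> cnj (hip (\<lambda>y. pick_kernel F y z) (f i))"
      by (rule tendsto_cnj)
    moreover have "cnj (hip (?\<sigma> M) (f i)) = (\<Sum>m<M. g (i, replicate m z))" for M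
      using \<sigma>[of M] HR.ip_commute[OF f, of "?\<sigma> M" i] by simp
    moreover have "cnj (hip (\<lambda>y. pick_kernel F y z) (f i)) = f i z"
      using HR.ip_commute[OF f HR.kv_mem, of i z] HR.reproduce[OF f, of i z] by simp
    ultimately have "(\<lambda>M. \<Sum>m<M. g (i, replicate m z)) \<longlonglongrightarrow> f i z" by (simp only:)
    then show "hat g i z = f i z" using hat_sums[OF g(1), of i z] by (simp add: sums_def LIMSEQ_unique)
  qed
  moreover have "(fnrm g)\<^sup>2 \<le> B" using g nrm_rk[OF psd_column_kernel[OF psd_F] g(1)] by simp
  ultimately show thesis using that g by blast
qed

end

section \<open>Inner-outer factorization\<close>

definition lspan :: "('s \<Rightarrow> 'x \<Rightarrow> complex) \<Rightarrow> 's set \<Rightarrow> ('x \<Rightarrow> complex) set" where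
  "lspan g S = {lc g l | l. snd ` set l \<subseteq> S}"

lemma is_subspace_lspan: "is_subspace (lspan g S)"
  unfolding lspan_def by (rule is_subspace_span)

lemma lspan_base: "s \<in> S \<Longrightarrow> g s \<in> lspan g S"
  unfolding lspan_def by (intro CollectI exI[of _ "[(1, s)]"]) (auto simp: lc_simps fscale_simps)

lemma lspan_mono: "S \<subseteq> T \<Longrightarrow> lspan g S \<subseteq> lspan g T"
  unfolding lspan_def by (intro Collect_mono ex_mono) auto

lemma lspan_least: "is_subspace V \<Longrightarrow> (\<And>s. s \<in> S \<Longrightarrow> g s \<in> V) \<Longrightarrow> lspan g S \<subseteq> V"
  unfolding lspan_def by (auto intro!: is_subspace_lc)

lemma is_subspace_sums:
  assumes V: "is_subspace V" and W: "is_subspace W" shows "is_subspace {v + w | v w. v \<in> V \<and> w \<in> W}"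
  unfolding is_subspace_def
proof (intro conjI ballI allI)
  show "0 \<in> {v + w | v w. v \<in> V \<and> w \<in> W}"
    using is_subspaceD(1)[OF V] is_subspaceD(1)[OF W] by (intro CollectI exI[of _ 0]) simp
next
  fix f g assume "f \<in> {v + w | v w. v \<in> V \<and> w \<in> W}" "g \<in> {v + w | v w. v \<in> V \<and> w \<in> W}"
  then obtain v w v' w' where "f = v + w" "g = v' + w'" "v \<in> V" "w \<in> W" "v' \<in> V" "w' \<in> W" by blast
  then show "f + g \<in> {v + w | v w. v \<in> V \<and> w \<in> W}"
    using is_subspaceD(2)[OF V] is_subspaceD(2)[OF W]
    by (intro CollectI exI[of _ "v + v'"] exI[of _ "w + w'"]) simp
next
  fix f c assume "f \<in> {v + w | v w. v \<in> V \<and> w \<in> W}"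
  then obtain v w where "f = v + w" "v \<in> V" "w \<in> W" by blast
  then show "fscale c f \<in> {v + w | v w. v \<in> V \<and> w \<in> W}"
    using is_subspaceD(3)[OF V] is_subspaceD(3)[OF W]
    by (intro CollectI exI[of _ "fscale c v"] exI[of _ "fscale c w"]) (simp add: fscale_simps)
qed

context function_pre_hilbert
begin

lemma orthogonal_lspan:
  assumes "f \<in> H" "\<And>s. s \<in> S \<Longrightarrow> g s \<in> H" "\<And>s. s \<in> S \<Longrightarrow> ip f (g s) = 0" "v \<in> lspan g S"
  shows "ip f v = 0"
proof -
  obtain l where l: "v = lc g l" "snd ` set l \<subseteq> S" using assms(4) unfolding lspan_def by blast
  have "ip f v = clin l (\<lambda>s. ip f (g s))"
    unfolding l(1) using l(2) assms by (intro ip_lc_right) auto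
  also have "\<dots> = clin l (\<lambda>s. 0)" using l(2) assms by (intro clin_cong) auto
  finally show ?thesis by simp
qed

lemma subset_clo: "V \<subseteq> H \<Longrightarrow> V \<subseteq> W \<Longrightarrow> V \<subseteq> clo W"
  by (rule subsetI, rule clo_superset) blast+

text \<open>\<open>f - p\<close> is orthogonal to all of \<open>clo V\<close>, in particular to
  \<open>p - v\<close>, and Pythagoras applies.\<close>

lemma best_approximation:
  assumes V: "is_subspace V" "V \<subseteq> H" and f: "f \<in> H" and p: "p \<in> clo V" "\<And>v. v \<in> V \<Longrightarrow> ip (f - p) v = 0"
    and v: "v \<in> clo V"
  shows "norm_H (f - p) \<le> norm_H (f - v)"
proof (rule power2_le_imp_le)
  have m: "p \<in> H" "v \<in> H" using p(1) v clo_mem by auto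
  have "p - v \<in> clo V" using is_subspaceD(4)[OF is_subspace_clo[OF V]] p(1) v by blast
  then have "ip (f - p) (p - v) = 0"
    using f m V(2) p(2) by (intro clo_orthogonal[of "f - p" V "p - v"] diff_mem)
  then have "(norm_H ((f - p) + (p - v)))\<^sup>2 = (norm_H (f - p))\<^sup>2 + (norm_H (p - v))\<^sup>2"
    using nrm_add_power2[OF diff_mem[OF f m(1)] diff_mem[OF m]] by simp
  then show "(norm_H (f - p))\<^sup>2 \<le> (norm_H (f - v))\<^sup>2" by simp
  show "0 \<le> norm_H (f - v)" by (intro nrm_nonneg diff_mem f m)
qed

end

context pick
begin

abbreviation len :: "unit \<times> 'x list \<Rightarrow> nat" where "len s \<equiv> length (snd s)"

lemma conc_wv_wv: "conc (conc f (word_vec F s)) (word_vec F t) = conc f (word_vec F ((), snd s @ snd t))"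
  using conc_assoc_word[of f "word_vec F s" F "snd t"] conc_word_vec[of F "()" "snd s" "snd t"]
  by (cases s; cases t) simp

text \<open>Right multiplication by \<open>t\<close> is bounded and lengthens every word by
  \<open>len t\<close>.\<close>

lemma clo_shift:
  fixes \<Phi> :: "'i \<times> 'x list \<Rightarrow> complex"
  assumes \<Phi>: "\<Phi> \<in> fock"
    and f: "f \<in> function_pre_hilbert.clo fock fip (lspan (\<lambda>s. conc \<Phi> (word_vec F s)) {s. n \<le> len s})"
    and k: "k \<le> n + len t"
  shows "conc f (word_vec F t) \<in> function_pre_hilbert.clo fock fip (lspan (\<lambda>s. conc \<Phi> (word_vec F s)) {s. k \<le> len s})"
proof -
  interpret A: reproducing "fock :: ('i \<times> 'x list \<Rightarrow> complex) set" fip "word_vec F" by (rule reproducing_fock)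
  let ?V = "\<lambda>n. lspan (\<lambda>s. conc \<Phi> (word_vec F s)) {s. n \<le> len s}"
  have m: "conc g (word_vec F t) \<in> fock" if "g \<in> fock" for g :: "'i \<times> 'x list \<Rightarrow> complex" and t
    using conc_word_mem[OF that, of "snd t"] by (cases t) simp
  have Vm: "?V n \<subseteq> fock" for n by (intro lspan_least A.is_subspace_H m \<Phi>)
  define C where "C = sqrt (Re (word_kernel F (snd t) (snd t)))"
  have C: "C \<ge> 0" using psd_diag(2)[OF psd_word_kernel[OF psd_F]] by (simp add: C_def)
  show ?thesis
    unfolding A.clo_def
  proof (intro CollectI conjI allI impI)
    show "conc f (word_vec F t) \<in> fock" by (intro m A.clo_mem[OF f])
    fix e :: real assume e: "e > 0"
    then have "e / (C + 1) > 0" using C by simp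
    then obtain v where v: "v \<in> ?V n" "fnrm (f - v) < e / (C + 1)" using A.clo_D[OF f] by blast
    have vm: "v \<in> fock" using v Vm by blast
    have fv: "f - v \<in> fock" by (intro A.diff_mem A.clo_mem[OF f] vm)
    have "fnrm (conc f (word_vec F t) - conc v (word_vec F t)) \<le> C * fnrm (f - v)"
      using word_vec_conc_mem_nrm[OF fv, of "snd t"] by (cases t) (simp add: C_def conc_linear)
    also have "\<dots> \<le> (C + 1) * fnrm (f - v)"
      using A.nrm_nonneg[OF fv] by (intro mult_right_mono) auto
    also have "\<dots> < e" using v(2) C by (simp add: field_simps)
    finally have "fnrm (conc f (word_vec F t) - conc v (word_vec F t)) < e" .
    moreover have "conc v (word_vec F t) \<in> ?V k"
    proof -
      obtain l where l: "v = lc (\<lambda>s. conc \<Phi> (word_vec F s)) l" "snd ` set l \<subseteq> {s. n \<le> len s}"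
        using v(1) unfolding lspan_def by blast
      have "conc v (word_vec F t) = lc (\<lambda>s. conc \<Phi> (word_vec F ((), snd s @ snd t))) l"
        unfolding l(1) conc_lc_left conc_wv_wv ..
      also have "\<dots> \<in> ?V k"
        using l(2) k by (intro is_subspace_lc is_subspace_lspan lspan_base) auto
      finally show ?thesis .
    qed
    ultimately show "\<exists>v\<in>?V k. fnrm (conc f (word_vec F t) - v) < e" by blast
  qed
qed

text \<open>Inner-outer factorization. Subtracting from \<open>\<Phi>\<close> its projection to the closed span of the right
  multiples of \<open>\<Phi>\<close> by nonempty words leaves a wandering vector \<open>\<Theta>0\<close>, and the Wold decomposition shows
  that the right multiples of \<open>\<Theta>0\<close> span the same closed space as those of \<open>\<Phi>\<close>.\<close>

lemma inner_outer:
  fixes \<Phi> :: "'i \<times> 'x list \<Rightarrow> complex"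
  assumes \<Phi>: "\<Phi> \<in> fock" and nz: "\<Phi> \<noteq> 0"
  obtains \<Theta> G where "inner \<Theta>" "G \<in> fock" "\<Phi> = conc \<Theta> G"
    "\<And>e. e > 0 \<Longrightarrow> \<exists>l. fnrm (word_vec F ((), []) - conc G (lc (word_vec F) l)) < e"
proof -
  interpret A: reproducing "fock :: ('i \<times> 'x list \<Rightarrow> complex) set" fip "word_vec F" by (rule reproducing_fock)
  interpret U: reproducing "fock :: (unit \<times> 'x list \<Rightarrow> complex) set" fip "word_vec F" by (rule reproducing_fock)
  have m: "conc g (word_vec F t) \<in> fock" if "g \<in> fock" for g :: "'i \<times> 'x list \<Rightarrow> complex" and t
    using conc_word_mem[OF that, of "snd t"] by (cases t) simp
  define R where "R s = conc \<Phi> (word_vec F s)" for s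
  have Rm: "R s \<in> fock" for s unfolding R_def by (intro m \<Phi>)
  define V where "V n = lspan R {s. n \<le> len s}" for n
  have V: "is_subspace (V n)" "V n \<subseteq> fock" for n
    unfolding V_def by (rule is_subspace_lspan) (intro lspan_least A.is_subspace_H Rm)
  have V_anti: "V n \<subseteq> V k" if "k \<le> n" for n k unfolding V_def using that by (intro lspan_mono) auto
  have shift: "conc f (word_vec F t) \<in> A.clo (V k)" if "f \<in> A.clo (V n)" "k \<le> n + len t" for f n k t
    using clo_shift[OF \<Phi>, of f n k t] that by (simp add: V_def R_def[abs_def])
  have RNil: "R ((), []) = \<Phi>" unfolding R_def by (rule conc_Nil)
  have \<Phi>V: "\<Phi> \<in> V 0" using lspan_base[of "((), [])" "{s. 0 \<le> len s}" R] by (simp add: V_def RNil)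
  obtain p where p: "p \<in> A.clo (V 1)" "\<And>v. v \<in> V 1 \<Longrightarrow> fip (\<Phi> - p) v = 0"
    using A.projection_exists[OF V \<Phi>] by blast
  have pm: "p \<in> fock" using A.clo_mem[OF p(1)] .
  define \<Theta>0 where "\<Theta>0 = \<Phi> - p"
  have \<Theta>m: "\<Theta>0 \<in> fock" unfolding \<Theta>0_def by (intro A.diff_mem \<Phi> pm)
  have \<Theta>V: "\<Theta>0 \<in> A.clo (V 0)"
    unfolding \<Theta>0_def using is_subspaceD(4)[OF A.is_subspace_clo[OF V]] A.clo_superset[OF \<Phi>V \<Phi>]
      A.clo_mono[OF V_anti[of 0 1]] p(1) by blast
  have orth1: "fip \<Theta>0 f = 0" if "f \<in> A.clo (V 1)" for f
    using A.clo_orthogonal[OF \<Theta>m V(2) _ that] p(2) by (simp add: \<Theta>0_def)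
  define Q where "Q s = conc \<Theta>0 (word_vec F s)" for s
  have Qm: "Q s \<in> fock" for s unfolding Q_def by (intro m \<Theta>m)
  have split: "\<exists>v1 v2. snd t = v1 @ v2 \<and> length v2 = len s \<and> v1 \<noteq> []" if "len s < len t" for s t
    using that by (intro exI[of _ "take (len t - len s) (snd t)"] exI[of _ "drop (len t - len s) (snd t)"]) auto
  have ip_word: "fip (conc g (word_vec F s)) (conc f (word_vec F t)) = word_kernel F (snd t) (snd s) * fip g f"
    if "f \<in> fock" "g \<in> fock" "len s = len t" for f g s t
    using ip_conc_word[OF that(1,2), of "snd t" "snd s"] that(3) by (cases s; cases t) simp
  \<comment> \<open>A word longer than \<open>s\<close> ends in a suffix of the length of
    \<open>s\<close>. By \<open>ip_word\<close> this suffix can be stripped together with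
    \<open>s\<close>, and what remains is an inner product of \<open>\<Theta>0\<close> with a right
    multiple of \<open>\<Phi>\<close> by a nonempty word.\<close>
  have QR: "fip (Q s) (R t) = 0" if st: "len s < len t" for s t
  proof -
    obtain v1 v2 where v: "snd t = v1 @ v2" "length v2 = len s" "v1 \<noteq> []" using split[OF st] by blast
    have "R t = conc (R ((), v1)) (word_vec F ((), v2))"
      unfolding R_def conc_wv_wv using v by (cases t) simp
    then have "fip (Q s) (R t) = word_kernel F v2 (snd s) * fip \<Theta>0 (R ((), v1))"
      unfolding Q_def using ip_word[OF Rm[of "((), v1)"] \<Theta>m, of s "((), v2)"] v by simp
    moreover have "R ((), v1) \<in> V 1" unfolding V_def using v by (intro lspan_base) (cases v1; simp)
    then have "fip \<Theta>0 (R ((), v1)) = 0" by (intro orth1 A.clo_superset Rm)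
    ultimately show ?thesis by simp
  qed
  have QQ0: "fip (Q s) (Q t) = 0" if st: "len s < len t" for s t
  proof -
    obtain v1 v2 where v: "snd t = v1 @ v2" "length v2 = len s" "v1 \<noteq> []" using split[OF st] by blast
    have "Q t = conc (Q ((), v1)) (word_vec F ((), v2))"
      unfolding Q_def conc_wv_wv using v by (cases t) simp
    then have "fip (Q s) (Q t) = word_kernel F v2 (snd s) * fip \<Theta>0 (Q ((), v1))"
      unfolding Q_def[of s] using ip_word[OF Qm[of "((), v1)"] \<Theta>m, of s "((), v2)"] v by simp
    moreover have "Q ((), v1) \<in> A.clo (V 1)"
      unfolding Q_def by (rule shift[OF \<Theta>V]) (use v in \<open>cases v1; simp\<close>)
    ultimately show ?thesis using orth1 by simp
  qed
  have QQ: "fip (Q s) (Q t) = word_kernel F (snd t) (snd s) * fip \<Theta>0 \<Theta>0" for s t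
  proof (cases "len s" "len t" rule: linorder_cases)
    case less
    then show ?thesis using QQ0[OF less] by (simp add: word_kernel_length)
  next
    case equal
    then show ?thesis unfolding Q_def using ip_word[OF \<Theta>m \<Theta>m] by simp
  next
    case greater
    then show ?thesis using QQ0[OF greater] A.ip_commute[OF Qm Qm, of s t] by (simp add: word_kernel_length)
  qed
  define N where "N n = lspan Q {s. len s < n}" for n
  have N: "is_subspace (N n)" "N n \<subseteq> fock" for n
    unfolding N_def by (rule is_subspace_lspan) (intro lspan_least A.is_subspace_H Qm)
  have N_mono: "N n \<subseteq> N k" if "n \<le> k" for n k unfolding N_def using that by (intro lspan_mono) auto
  have NV: "fip b a = 0" if "b \<in> V n" "a \<in> N n" for a b n
  proof -
    have am: "a \<in> fock" and bm: "b \<in> fock" using that N(2) V(2) by blast+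
    have "fip (R t) a = 0" if t: "n \<le> len t" for t
    proof (rule A.orthogonal_lspan[OF Rm Qm _ \<open>a \<in> N n\<close>[unfolded N_def]])
      fix s assume "s \<in> {s. len s < n}"
      then show "fip (R t) (Q s) = 0" using QR[of s t] t A.ip_commute[OF Rm Qm, of t s] by simp
    qed
    then have "fip a (R t) = 0" if "n \<le> len t" for t using that A.ip_commute[OF am Rm, of t] by simp
    then have "fip a b = 0"
      by (intro A.orthogonal_lspan[OF am Rm _ \<open>b \<in> V n\<close>[unfolded V_def]]) simp
    then show ?thesis using A.ip_commute[OF bm am] by simp
  qed
  define S where "S n = {a + b | a b. a \<in> N n \<and> b \<in> V n}" for n
  have S: "is_subspace (S n)" "S n \<subseteq> fock" for n
    unfolding S_def using is_subspace_sums[OF N(1) V(1)] N(2)[of n] V(2)[of n] A.add_mem by blast+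
  have NS: "N n \<subseteq> S n" "V n \<subseteq> S n" for n
    unfolding S_def using is_subspaceD(1)[OF N(1)] is_subspaceD(1)[OF V(1)]
    by (force intro: exI[of _ 0])+
  \<comment> \<open>One more layer is split off in each step: a multiple \<open>R s\<close> by a
    word of length \<open>n\<close> is \<open>Q s\<close> plus a multiple of \<open>p\<close>, and
    the latter is a limit of multiples of \<open>\<Phi>\<close> by longer words.\<close>
  have \<Phi>S: "\<Phi> \<in> A.clo (S n)" for n
  proof (induction n)
    case 0
    show ?case by (intro A.clo_superset \<Phi> subsetD[OF NS(2)] \<Phi>V)
  next
    case (Suc n)
    note sub = A.is_subspace_clo[OF S, of "Suc n"]
    have "N n \<subseteq> A.clo (S (Suc n))"
      by (intro A.subset_clo N(2) subset_trans[OF N_mono NS(1)]) simp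
    moreover have "V n \<subseteq> A.clo (S (Suc n))"
      unfolding V_def
    proof (intro lspan_least sub)
      fix s assume "s \<in> {s. n \<le> len s}"
      then consider "Suc n \<le> len s" | "len s = n" by fastforce
      then show "R s \<in> A.clo (S (Suc n))"
      proof cases
        case 1
        then have "R s \<in> V (Suc n)" unfolding V_def by (intro lspan_base) simp
        then show ?thesis by (intro A.clo_superset Rm subsetD[OF NS(2)])
      next
        case 2
        have "Q s \<in> N (Suc n)" unfolding N_def using 2 by (intro lspan_base) simp
        then have "Q s \<in> A.clo (S (Suc n))" by (intro A.clo_superset Qm subsetD[OF NS(1)])
        moreover have "conc p (word_vec F s) \<in> A.clo (V (Suc n))" using 2 by (intro shift[OF p(1)]) simp
        then have "conc p (word_vec F s) \<in> A.clo (S (Suc n))" by (rule subsetD[OF A.clo_mono[OF NS(2)]])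
        moreover have "R s = Q s + conc p (word_vec F s)"
          unfolding R_def Q_def \<Theta>0_def by (simp add: conc_linear)
        ultimately show ?thesis using is_subspaceD(2)[OF sub] by simp
      qed
    qed
    ultimately have "S n \<subseteq> A.clo (S (Suc n))"
      unfolding S_def[of n] using is_subspaceD(2)[OF sub] by blast
    then show ?case
      using A.clo_clo[OF S(2) \<Phi>, of "Suc n"] A.clo_D[OF Suc] by (meson subsetD)
  qed
  \<comment> \<open>The spaces \<open>clo (V n)\<close> hence have zero intersection, so the
    residual part of the Wold decomposition is trivial.\<close>
  have vanish: "f (i, w) = 0" if f: "f \<in> A.clo (V n)" and w: "length w < n" for f i w n
  proof -
    have wR: "fip (word_vec F (i, w)) (R s) = 0" if "n \<le> len s" for s
      using A.ip_commute[OF A.kv_mem Rm] A.reproduce[OF Rm] conc_word[of \<Phi> F "snd s" i w] that w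
      by (cases s) (simp add: R_def)
    have "fip (word_vec F (i, w)) v = 0" if "v \<in> V n" for v
      by (rule A.orthogonal_lspan[OF A.kv_mem Rm _ that[unfolded V_def]]) (simp add: wR)
    then have "fip (word_vec F (i, w)) f = 0" by (intro A.clo_orthogonal[OF A.kv_mem V(2) _ f])
    then show ?thesis
      using A.ip_commute[OF A.clo_mem[OF f] A.kv_mem, of "(i, w)"] A.reproduce[OF A.clo_mem[OF f], of "(i, w)"]
      by simp
  qed
  let ?N = "lspan Q UNIV"
  have N': "is_subspace ?N" "?N \<subseteq> fock"
    by (rule is_subspace_lspan) (intro lspan_least A.is_subspace_H Qm)
  obtain a where a: "a \<in> A.clo ?N" "\<And>v. v \<in> ?N \<Longrightarrow> fip (\<Phi> - a) v = 0"
    using A.projection_exists[OF N' \<Phi>] by blast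
  have am: "a \<in> fock" using A.clo_mem[OF a(1)] .
  have "\<Phi> (i, w) = a (i, w)" for i w
  proof -
    have est: "cmod (\<Phi> (i, w) - a (i, w)) \<le> e * fnrm (word_vec F (i, w))" if e: "e > 0" for e
    proof -
      obtain v where v: "v \<in> ?N" "fnrm (a - v) < e" using A.clo_D[OF a(1) e] by blast
      obtain l where l: "v = lc Q l" using v(1) unfolding lspan_def by blast
      obtain k where k: "\<And>s. s \<in> snd ` set l \<Longrightarrow> len s < k"
      proof -
        have "finite (len ` snd ` set l)" by simp
        then obtain k where "\<forall>j\<in>len ` snd ` set l. j < k" using finite_nat_set_iff_bounded by blast
        then show thesis using that by blast
      qed
      \<comment> \<open>Large enough that \<open>v\<close> lies in \<open>N n\<close> and that
        elements of \<open>clo (V n)\<close> vanish at \<open>w\<close>.\<close>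
      define n where "n = max k (Suc (length w))"
      have vN: "v \<in> N n" unfolding l N_def n_def using k by (intro is_subspace_lc is_subspace_lspan lspan_base) force
      obtain b where b: "b \<in> A.clo (N n)" "\<And>v. v \<in> N n \<Longrightarrow> fip (\<Phi> - b) v = 0"
        using A.projection_exists[OF N \<Phi>] by blast
      have bm: "b \<in> fock" using A.clo_mem[OF b(1)] .
      have "\<Phi> - b \<in> A.clo (V n)"
        unfolding A.clo_def
      proof (intro CollectI conjI allI impI)
        fix \<epsilon> :: real assume "\<epsilon> > 0"
        then obtain s where s: "s \<in> S n" "fnrm (\<Phi> - s) < \<epsilon>" using A.clo_D[OF \<Phi>S] by blast
        then obtain x y where xy: "s = x + y" "x \<in> N n" "y \<in> V n" unfolding S_def by blast
        have ym: "y \<in> fock" using xy V(2) by blast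
        \<comment> \<open>As \<open>y\<close> is orthogonal to \<open>N n\<close>, the projection
          \<open>b\<close> of \<open>\<Phi>\<close> is also that of \<open>\<Phi> - y\<close>, and
          so beats \<open>x\<close>.\<close>
        have le: "fnrm (\<Phi> - y - b) \<le> fnrm (\<Phi> - y - x)"
        proof (rule A.best_approximation[OF N A.diff_mem[OF \<Phi> ym] b(1)])
          fix v assume v: "v \<in> N n"
          have eq: "\<Phi> - y - b = (\<Phi> - b) - y" by simp
          show "fip (\<Phi> - y - b) v = 0"
            unfolding eq A.ip_diff(1)[OF A.diff_mem[OF \<Phi> bm] ym subsetD[OF N(2) v]] b(2)[OF v] NV[OF xy(3) v]
            by simp
        qed (use xy(2) N(2)[of n] in \<open>auto intro: A.clo_superset\<close>)
        have eqs: "\<Phi> - y - x = \<Phi> - s" "\<Phi> - y - b = \<Phi> - b - y" by (simp_all add: xy(1) fun_eq_iff)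
        have "fnrm (\<Phi> - b - y) < \<epsilon>"
          using le s(2) unfolding eqs by (rule le_less_trans)
        then show "\<exists>v\<in>V n. fnrm (\<Phi> - b - v) < \<epsilon>" using xy(3) by blast
      qed (intro A.diff_mem \<Phi> bm)
      then have "(\<Phi> - b) (i, w) = 0" by (rule vanish) (simp add: n_def)
      then have "\<Phi> (i, w) = b (i, w)" by simp
      then have "cmod (\<Phi> (i, w) - a (i, w)) = cmod ((a - b) (i, w))" by (simp add: norm_minus_commute)
      also have "\<dots> \<le> fnrm (a - b) * fnrm (word_vec F (i, w))"
        by (intro A.eval_bound A.diff_mem am bm)
      \<comment> \<open>Both \<open>\<Phi> - a\<close> and \<open>\<Phi> - b\<close> are orthogonal
        to \<open>N n\<close>, so \<open>b\<close> is the projection of \<open>a\<close> to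
        \<open>N n\<close> and is at least as close to \<open>a\<close> as \<open>v\<close>.\<close>
      also have "fnrm (a - b) \<le> fnrm (a - v)"
      proof (rule A.best_approximation[OF N am b(1)])
        fix v assume v: "v \<in> N n"
        have vN': "v \<in> ?N" using v lspan_mono[of "{s. len s < n}" UNIV Q] unfolding N_def by auto
        have eq: "a - b = (\<Phi> - b) - (\<Phi> - a)" by simp
        show "fip (a - b) v = 0"
          unfolding eq A.ip_diff(1)[OF A.diff_mem[OF \<Phi> bm] A.diff_mem[OF \<Phi> am] subsetD[OF N(2) v]]
            b(2)[OF v] a(2)[OF vN'] by simp
      qed (use vN N(2)[of n] in \<open>auto intro: A.clo_superset\<close>)
      then have "fnrm (a - b) * fnrm (word_vec F (i, w)) \<le> e * fnrm (word_vec F (i, w))"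
        using v(2) A.nrm_nonneg[OF A.kv_mem] by (intro mult_right_mono) auto
      finally show ?thesis .
    qed
    show ?thesis
    proof (rule ccontr)
      assume ne: "\<Phi> (i, w) \<noteq> a (i, w)"
      let ?c = "fnrm (word_vec F (i, w))" and ?d = "cmod (\<Phi> (i, w) - a (i, w))"
      have c: "?c \<ge> 0" by (intro A.nrm_nonneg A.kv_mem)
      have d: "?d > 0" using ne by simp
      have "?d \<le> ?d / (?c + 1) * ?c" using c d by (intro est) simp
      then have "?d * (?c + 1) \<le> ?d * ?c" using c by (simp add: field_simps)
      then show False using d by (simp add: distrib_left)
    qed
  qed
  then have "\<Phi> = a" by (auto simp: fun_eq_iff)
  then have \<Phi>N: "\<Phi> \<in> A.clo ?N" using a(1) by simp
  have "\<Theta>0 \<noteq> 0"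
  proof
    assume "\<Theta>0 = 0"
    then have "Q s = 0" for s by (simp only: Q_def conc_linear)
    then have "fip \<Phi> (Q s) = 0" for s by (simp only: A.ip_zero_right[OF \<Phi>])
    then have "fip \<Phi> v = 0" if "v \<in> ?N" for v
      by (rule A.orthogonal_lspan[OF \<Phi> Qm _ that])
    then have "fip \<Phi> \<Phi> = 0" by (intro A.clo_orthogonal[OF \<Phi> N'(2) _ \<Phi>N])
    then show False using A.ip_definite[OF \<Phi>] nz by simp
  qed
  then have pos: "fnrm \<Theta>0 > 0" using A.nrm_eq_0[OF \<Theta>m] A.nrm_nonneg[OF \<Theta>m] by linarith
  define \<Theta> where "\<Theta> = fscale (of_real (1 / fnrm \<Theta>0)) \<Theta>0"
  have \<Theta>Q: "conc \<Theta> (word_vec F s) = fscale (of_real (1 / fnrm \<Theta>0)) (Q s)" for s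
    unfolding \<Theta>_def Q_def by (rule conc_linear)
  have inner: "inner \<Theta>"
    unfolding inner_def
  proof (intro conjI allI)
    show "\<Theta> \<in> fock" unfolding \<Theta>_def by (intro A.fscale_mem \<Theta>m)
    fix u v
    show "fip (conc \<Theta> (word_vec F ((), v))) (conc \<Theta> (word_vec F ((), u))) = word_kernel F u v"
      using pos by (simp add: \<Theta>Q A.ip_fscale A.fscale_mem Qm QQ A.ip_self_nrm[OF \<Theta>m] power2_eq_square)
  qed
  have "?N \<subseteq> range (\<lambda>l. conc \<Theta> (lc (word_vec F) l))"
  proof
    fix f assume "f \<in> ?N"
    then obtain l where l: "f = lc Q l" unfolding lspan_def by blast
    have "conc \<Theta> (lc (word_vec F) (lscale (of_real (fnrm \<Theta>0)) l)) = fscale (of_real (fnrm \<Theta>0)) (lc (\<lambda>s. conc \<Theta> (word_vec F s)) l)"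
      by (simp only: conc_lc_right lc_simps conc_linear)
    also have "\<dots> = f"
      unfolding l \<Theta>Q using pos by (induction l) (auto simp: lc_simps fun_eq_iff algebra_simps)
    finally show "f \<in> range (\<lambda>l. conc \<Theta> (lc (word_vec F) l))" by (metis rangeI)
  qed
  then obtain G where G: "G \<in> fock" "\<Phi> = conc \<Theta> G"
    using inner_factor[OF inner] A.clo_mono \<Phi>N by blast
  \<comment> \<open>\<open>\<Theta>\<close> is a limit of right multiples of
    \<open>\<Phi> = conc \<Theta> G\<close>. Cancelling the isometric left factor
    \<open>\<Theta>\<close> leaves the empty word as a limit of right multiples of
    \<open>G\<close>.\<close>
  have "\<exists>l. fnrm (word_vec F ((), []) - conc G (lc (word_vec F) l)) < e" if e: "e > 0" for e
  proof -
    have "\<Theta> \<in> A.clo (V 0)"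
      unfolding \<Theta>_def using is_subspaceD(3)[OF A.is_subspace_clo[OF V]] \<Theta>V by blast
    then obtain v where v: "v \<in> V 0" "fnrm (\<Theta> - v) < e" using A.clo_D[OF _ e] by blast
    then obtain l where l: "v = lc R l" unfolding V_def lspan_def by blast
    have Gl: "conc G (lc (word_vec F) l) \<in> fock"
      unfolding conc_lc_right
    proof (intro U.lc_mem)
      show "conc G (word_vec F s) \<in> fock" for s
        using conc_word_mem[OF G(1), of "snd s"] by (cases s) simp
    qed
    have "v = conc \<Theta> (conc G (lc (word_vec F) l))"
      unfolding l R_def G(2) by (simp only: conc_lc_right[symmetric] conc_assoc_lc)
    then have "\<Theta> - v = conc \<Theta> (word_vec F ((), []) - conc G (lc (word_vec F) l))"
      by (simp only: conc_linear conc_Nil)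
    then have "fnrm (\<Theta> - v) = fnrm (word_vec F ((), []) - conc G (lc (word_vec F) l))"
      using inner_conc_nrm[OF inner U.diff_mem[OF U.kv_mem Gl]] by simp
    then show ?thesis using v by auto
  qed
  then show thesis using that[OF inner G] by blast
qed

end

text \<open>The norm bound is part of the definition and is not derived from the closed graph
  theorem.\<close>

definition bounded_multipliers :: "('x \<Rightarrow> complex) set \<Rightarrow> (('x \<Rightarrow> complex) \<Rightarrow> ('x \<Rightarrow> complex) \<Rightarrow> complex)
    \<Rightarrow> ('x \<Rightarrow> complex) set" where
  "bounded_multipliers H ip = {h. \<exists>C. \<forall>f\<in>H. h * f \<in> H \<and> nrm ip (h * f) \<le> C * nrm ip f}"

context function_pre_hilbert
begin

lemma bounded_multipliersD:
  assumes "h \<in> bounded_multipliers H ip"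
  shows "\<exists>C>0. \<forall>f\<in>H. h * f \<in> H \<and> norm_H (h * f) \<le> C * norm_H f"
proof -
  obtain C where C: "\<And>f. f \<in> H \<Longrightarrow> h * f \<in> H \<and> norm_H (h * f) \<le> C * norm_H f"
    using assms unfolding bounded_multipliers_def by blast
  have *: "norm_H (h * f) \<le> (\<bar>C\<bar> + 1) * norm_H f" if "f \<in> H" for f
  proof -
    have "C * norm_H f \<le> (\<bar>C\<bar> + 1) * norm_H f" using nrm_nonneg[OF that] by (intro mult_right_mono) auto
    then show ?thesis using C[OF that] by linarith
  qed
  then show ?thesis using C by (intro exI[of _ "\<bar>C\<bar> + 1"] conjI ballI) auto
qed

lemma bounded_multipliers_add:
  assumes "g \<in> bounded_multipliers H ip" "h \<in> bounded_multipliers H ip"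
  shows "g + h \<in> bounded_multipliers H ip"
proof -
  obtain C where "\<forall>f\<in>H. g * f \<in> H \<and> norm_H (g * f) \<le> C * norm_H f"
    using bounded_multipliersD[OF assms(1)] by blast
  then have C: "\<And>f. f \<in> H \<Longrightarrow> g * f \<in> H" "\<And>f. f \<in> H \<Longrightarrow> norm_H (g * f) \<le> C * norm_H f"
    by simp_all
  obtain D where "\<forall>f\<in>H. h * f \<in> H \<and> norm_H (h * f) \<le> D * norm_H f"
    using bounded_multipliersD[OF assms(2)] by blast
  then have D: "\<And>f. f \<in> H \<Longrightarrow> h * f \<in> H" "\<And>f. f \<in> H \<Longrightarrow> norm_H (h * f) \<le> D * norm_H f"
    by simp_all
  have "(g + h) * f \<in> H \<and> norm_H ((g + h) * f) \<le> (C + D) * norm_H f" if f: "f \<in> H" for f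
  proof -
    have eq: "(g + h) * f = g * f + h * f" by (auto simp: algebra_simps)
    show ?thesis
      unfolding eq using nrm_triangle[OF C(1)[OF f] D(1)[OF f]] C[OF f] D[OF f]
      by (simp add: add_mem distrib_right)
  qed
  then show ?thesis unfolding bounded_multipliers_def by blast
qed

lemma bounded_multipliers_mult:
  assumes "g \<in> bounded_multipliers H ip" "h \<in> bounded_multipliers H ip"
  shows "g * h \<in> bounded_multipliers H ip"
proof -
  obtain C where "C > 0" "\<forall>f\<in>H. g * f \<in> H \<and> norm_H (g * f) \<le> C * norm_H f"
    using bounded_multipliersD[OF assms(1)] by blast
  then have C: "C > 0" "\<And>f. f \<in> H \<Longrightarrow> g * f \<in> H" "\<And>f. f \<in> H \<Longrightarrow> norm_H (g * f) \<le> C * norm_H f"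
    by simp_all
  obtain D where "\<forall>f\<in>H. h * f \<in> H \<and> norm_H (h * f) \<le> D * norm_H f"
    using bounded_multipliersD[OF assms(2)] by blast
  then have D: "\<And>f. f \<in> H \<Longrightarrow> h * f \<in> H" "\<And>f. f \<in> H \<Longrightarrow> norm_H (h * f) \<le> D * norm_H f"
    by simp_all
  have "g * h * f \<in> H \<and> norm_H (g * h * f) \<le> (C * D) * norm_H f" if f: "f \<in> H" for f
  proof -
    have "norm_H (g * (h * f)) \<le> C * norm_H (h * f)" by (rule C(3)[OF D(1)[OF f]])
    also have "\<dots> \<le> C * (D * norm_H f)" using C(1) D(2)[OF f] by (intro mult_left_mono) auto
    finally show ?thesis using C(2)[OF D(1)[OF f]] by (simp add: mult.assoc)
  qed
  then show ?thesis unfolding bounded_multipliers_def by blast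
qed

lemma bounded_multipliers_const: "(\<lambda>x. c) \<in> bounded_multipliers H ip"
proof -
  have "(\<lambda>x. c) * f = fscale c f" for f :: "'x \<Rightarrow> complex" by auto
  then show ?thesis unfolding bounded_multipliers_def
    using fscale_mem nrm_fscale by (intro CollectI exI[of _ "cmod c"]) simp
qed

lemma is_subspace_bounded_multipliers: "is_subspace (bounded_multipliers H ip)"
  unfolding is_subspace_def
proof (intro conjI ballI allI)
  show "0 \<in> bounded_multipliers H ip"
    using bounded_multipliers_const[of 0] by (simp add: zero_fun_def)
  show "g + h \<in> bounded_multipliers H ip"
    if "g \<in> bounded_multipliers H ip" "h \<in> bounded_multipliers H ip" for g h
    by (rule bounded_multipliers_add[OF that])
  fix h c assume h: "h \<in> bounded_multipliers H ip"
  have "fscale c h = (\<lambda>x. c) * h" by auto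
  then show "fscale c h \<in> bounded_multipliers H ip"
    using bounded_multipliers_mult[OF bounded_multipliers_const h, of c] by simp
qed

lemma is_subspace_mult: "is_subspace V \<Longrightarrow> is_subspace ((\<lambda>m. m * g) ` V)" for g :: "'x \<Rightarrow> complex"
  unfolding is_subspace_def
proof (intro conjI ballI allI; elim conjE)
  assume V: "0 \<in> V" "\<forall>f\<in>V. \<forall>g\<in>V. f + g \<in> V" "\<forall>f\<in>V. \<forall>c. fscale c f \<in> V"
  show "0 \<in> (\<lambda>m. m * g) ` V" using V by (intro image_eqI[of _ _ 0]) auto
  show "f + h \<in> (\<lambda>m. m * g) ` V" if "f \<in> (\<lambda>m. m * g) ` V" "h \<in> (\<lambda>m. m * g) ` V" for f h
  proof -
    obtain a b where "f = a * g" "h = b * g" "a \<in> V" "b \<in> V" using \<open>f \<in> _\<close> \<open>h \<in> _\<close> by blast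
    then show ?thesis using V by (intro image_eqI[of _ _ "a + b"]) (auto simp: algebra_simps)
  qed
  show "fscale c f \<in> (\<lambda>m. m * g) ` V" if "f \<in> (\<lambda>m. m * g) ` V" for f c
  proof -
    obtain a where "f = a * g" "a \<in> V" using \<open>f \<in> _\<close> by blast
    then show ?thesis using V by (intro image_eqI[of _ _ "fscale c a"]) (auto simp: algebra_simps)
  qed
qed

end

section \<open>Simultaneous factorization of columns of functions\<close>

context pick
begin

abbreviation BM :: "('x \<Rightarrow> complex) set" where "BM \<equiv> bounded_multipliers HK hip"

lemma scalar_lift:
  assumes "f \<in> HK"
  obtains g :: "unit \<times> 'x list \<Rightarrow> complex" where "g \<in> fock" "fnrm g \<le> hnrm f" "hat g () = f"
proof -
  interpret U: reproducing "fock :: (unit \<times> 'x list \<Rightarrow> complex) set" fip "word_vec F" by (rule reproducing_fock)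
  have "(\<Sum>i\<in>S. (hnrm f)\<^sup>2) \<le> (hnrm f)\<^sup>2" if "finite S" for S :: "unit set"
  proof -
    have "S = {} \<or> S = {()}" by auto
    then show ?thesis by auto
  qed
  note bound = this
  show thesis
  proof (rule fock_lift[of "\<lambda>_ :: unit. f" "(hnrm f)\<^sup>2"])
    fix g :: "unit \<times> 'x list \<Rightarrow> complex"
    assume g: "g \<in> fock" "(fnrm g)\<^sup>2 \<le> (hnrm f)\<^sup>2" "\<And>i. hat g i = f"
    have "fnrm g \<le> hnrm f" by (rule power2_le_imp_le[OF g(2) HR.nrm_nonneg[OF assms]])
    then show thesis using g(1,3) by (intro that)
  qed (use assms bound in auto)
qed

text \<open>A lift of \<open>f\<close> is multiplied by the word on the right and mapped back by
  \<open>hat\<close>, which is multiplicative and contractive. \<open>inner_multiplier\<close> does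
  the same with left multiplication by \<open>\<Theta>\<close>.\<close>

lemma word_fun_multiplier: "word_fun u \<in> BM"
proof -
  have "word_fun u * f \<in> HK \<and> hnrm (word_fun u * f) \<le> sqrt (Re (word_kernel F u u)) * hnrm f" if f: "f \<in> HK" for f
  proof -
    obtain g where g: "g \<in> fock" "fnrm g \<le> hnrm f" "hat g () = f" using scalar_lift[OF f] by blast
    have eq: "hat (conc g (word_vec F ((), u))) () = word_fun u * f"
      by (simp add: hat_conc g word_vec_mem word_fun_def mult.commute)
    note W = word_vec_conc_mem_nrm[OF g(1), of u]
    have "fnrm (conc g (word_vec F ((), u))) \<le> sqrt (Re (word_kernel F u u)) * hnrm f"
    proof -
      have "sqrt (Re (word_kernel F u u)) * fnrm g \<le> sqrt (Re (word_kernel F u u)) * hnrm f"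
        using g psd_diag(2)[OF psd_word_kernel[OF psd_F]] by (intro mult_left_mono) auto
      then show ?thesis using W by linarith
    qed
    then show ?thesis using hat_mem_nrm[OF conjunct1[OF W], of "()"] unfolding eq by auto
  qed
  then show ?thesis unfolding bounded_multipliers_def by blast
qed

lemma inner_multiplier:
  fixes \<Theta> :: "'i \<times> 'x list \<Rightarrow> complex"
  assumes \<Theta>: "inner \<Theta>" and f: "f \<in> HK"
  shows "hat \<Theta> i * f \<in> HK \<and> hnrm (hat \<Theta> i * f) \<le> hnrm f"
proof -
  obtain g where g: "g \<in> fock" "fnrm g \<le> hnrm f" "hat g () = f" using scalar_lift[OF f] by blast
  have "\<Theta> \<in> fock" using \<Theta> by (simp add: inner_def)
  then have eq: "hat (conc \<Theta> g) i = hat \<Theta> i * f" by (simp add: hat_conc g)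
  show ?thesis
    using hat_mem_nrm[OF inner_conc_mem[OF \<Theta> g(1)], of i] inner_conc_nrm[OF \<Theta> g(1)] g(2) unfolding eq by simp
qed

lemma one_mem: "1 \<in> HK"
  using word_fun_mem[of "[]"] by (simp add: word_fun_Nil)

text \<open>\<open>hat\<close> carries the inner-outer factorization of a lifted column to
  functions. Density of the orbit of \<open>G\<close> spreads from \<open>1\<close> to the bounded
  multipliers by multiplication, to the kernel functions by \<open>kernel_word_fun\<close>, and to
  everything since these span a dense space.\<close>

theorem simultaneous_factorization:
  fixes f :: "nat \<Rightarrow> 'x \<Rightarrow> complex"
  assumes f: "\<And>n. f n \<in> HK" and sm: "summable (\<lambda>n. (hnrm (f n))\<^sup>2)" and nz: "f n0 \<noteq> 0"
  obtains G h where "G \<in> HK" "\<And>n. f n = h n * G"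
    "\<And>n g. g \<in> HK \<Longrightarrow> h n * g \<in> HK \<and> hnrm (h n * g) \<le> hnrm g"
    "\<And>g e. g \<in> HK \<Longrightarrow> e > 0 \<Longrightarrow> \<exists>m\<in>BM. hnrm (g - m * G) < e"
proof -
  interpret U: reproducing "fock :: (unit \<times> 'x list \<Rightarrow> complex) set" fip "word_vec F" by (rule reproducing_fock)
  have "\<exists>\<Phi> :: nat \<times> 'x list \<Rightarrow> complex. \<Phi> \<in> fock \<and> (\<forall>n. hat \<Phi> n = f n)"
  proof (rule fock_lift[of f "\<Sum>n. (hnrm (f n))\<^sup>2"])
    show "f n \<in> HK" for n by (rule f)
    show "(\<Sum>i\<in>S. (hnrm (f i))\<^sup>2) \<le> (\<Sum>n. (hnrm (f n))\<^sup>2)" if "finite S" for S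
      using that by (intro sum_le_suminf[OF sm]) auto
  qed blast
  then obtain \<Phi> :: "nat \<times> 'x list \<Rightarrow> complex" where \<Phi>: "\<Phi> \<in> fock" "\<And>n. hat \<Phi> n = f n" by blast
  have "\<Phi> \<noteq> 0"
  proof
    assume "\<Phi> = 0"
    then have "hat \<Phi> n0 = 0" by (auto simp: hat_def)
    then show False using \<Phi>(2)[of n0] nz by simp
  qed
  then obtain \<Theta> G0 where \<Theta>: "inner \<Theta>" and G0: "G0 \<in> fock" "\<Phi> = conc \<Theta> G0"
    and outer: "\<And>e. e > 0 \<Longrightarrow> \<exists>l. fnrm (word_vec F ((), []) - conc G0 (lc (word_vec F) l)) < e"
    using inner_outer[OF \<Phi>(1)] by blast
  define G where "G = hat G0 ()"
  have G: "G \<in> HK" unfolding G_def using hat_mem_nrm[OF G0(1)] by blast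
  have "\<Theta> \<in> fock" using \<Theta> by (simp add: inner_def)
  then have fac: "f n = hat \<Theta> n * G" for n
    unfolding \<Phi>(2)[symmetric] G0(2) G_def by (rule hat_conc[OF _ G0(1)])
  let ?V = "(\<lambda>m. m * G) ` BM"
  have BMm: "m * g \<in> HK" if "m \<in> BM" "g \<in> HK" for m g
    using HR.bounded_multipliersD[OF that(1)] that(2) by blast
  have V: "is_subspace ?V" "?V \<subseteq> HK"
    using HR.is_subspace_mult[OF HR.is_subspace_bounded_multipliers] BMm G by auto
  note V' = HR.is_subspace_clo[OF V]
  have one: "1 \<in> HR.clo ?V"
    unfolding HR.clo_def
  proof (intro CollectI conjI allI impI one_mem)
    fix e :: real assume "e > 0"
    then obtain l where l: "fnrm (word_vec F ((), []) - conc G0 (lc (word_vec F) l)) < e" using outer by blast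
    define P where "P = lc (word_vec F) l"
    have P: "P \<in> fock" unfolding P_def by (rule U.lc_kv_mem)
    have cP: "conc G0 P \<in> fock"
      unfolding P_def conc_lc_right
    proof (intro U.lc_mem)
      show "conc G0 (word_vec F s) \<in> fock" for s
        using conc_word_mem[OF G0(1), of "snd s"] by (cases s) simp
    qed
    \<comment> \<open>Polynomials in words become bounded multipliers, so approximation of the empty
      word in the Fock space turns into approximation of \<open>1\<close> by
      \<open>m * G\<close>.\<close>
    have "hat (word_vec F s) () \<in> BM" for s
      using word_fun_multiplier[of "snd s"] by (cases s) (simp add: word_fun_def)
    then have BP: "hat P () \<in> BM"
      unfolding P_def hat_lc[OF word_vec_mem] by (intro is_subspace_lc HR.is_subspace_bounded_multipliers)
    have "hat (word_vec F ((), []) - conc G0 P) () = 1 - hat P () * G"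
      using word_fun_Nil by (simp add: hat_diff word_vec_mem cP hat_conc G0(1) P G_def mult.commute word_fun_def)
    then have "hnrm (1 - hat P () * G) < e"
      using hat_mem_nrm[OF U.diff_mem[OF U.kv_mem cP], of "((), [])" "()"] l by (simp add: P_def)
    then show "\<exists>v\<in>?V. hnrm (1 - v) < e" using BP by blast
  qed
  have BMV: "m \<in> HR.clo ?V" if m: "m \<in> BM" for m
    unfolding HR.clo_def
  proof (intro CollectI conjI allI impI)
    show "m \<in> HK" using BMm[OF m one_mem] by simp
    fix e :: real assume e: "e > 0"
    obtain C where "C > 0" "\<forall>f\<in>HK. m * f \<in> HK \<and> hnrm (m * f) \<le> C * hnrm f"
      using HR.bounded_multipliersD[OF m] by blast
    then have C: "C > 0" "\<And>f. f \<in> HK \<Longrightarrow> hnrm (m * f) \<le> C * hnrm f" by simp_all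
    have "e / C > 0" using e C by simp
    then obtain q where q: "q \<in> BM" "hnrm (1 - q * G) < e / C" using HR.clo_D[OF one] by blast
    have eq: "m * (1 - q * G) = m - m * q * G" by (auto simp: fun_eq_iff algebra_simps)
    have "hnrm (m * (1 - q * G)) \<le> C * hnrm (1 - q * G)"
      by (intro C HR.diff_mem one_mem BMm q G)
    also have "\<dots> < e" using q C by (simp add: field_simps)
    finally have "hnrm (m - m * q * G) < e" unfolding eq .
    then show "\<exists>v\<in>?V. hnrm (m - v) < e"
      using HR.bounded_multipliers_mult[OF m q(1)] by blast
  qed
  have kV: "(\<lambda>y. pick_kernel F y z) \<in> HR.clo ?V" for z
  proof (rule HR.clo_clo[OF V(2) HR.kv_mem])
    fix e :: real assume "e > 0"
    then have "\<forall>\<^sub>F M in sequentially.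
        hnrm ((\<lambda>y. \<Sum>m<M. word_fun (replicate m z) y) - (\<lambda>y. pick_kernel F y z)) < e"
      using kernel_word_fun[of z] unfolding HR.conv_def by (intro order_tendstoD) auto
    then obtain M where M: "hnrm ((\<lambda>y. \<Sum>m<M. word_fun (replicate m z) y) - (\<lambda>y. pick_kernel F y z)) < e"
      by (auto simp: eventually_sequentially)
    have B: "(\<lambda>y. \<Sum>m<M. word_fun (replicate m z) y) \<in> BM" for M
    proof (induction M)
      case 0
      show ?case using HR.bounded_multipliers_const by simp
    next
      case (Suc M)
      have "(\<lambda>y. \<Sum>m<Suc M. word_fun (replicate m z) y)
          = (\<lambda>y. \<Sum>m<M. word_fun (replicate m z) y) + word_fun (replicate M z)" by auto
      then show ?case using HR.bounded_multipliers_add[OF Suc word_fun_multiplier] by simp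
    qed
    have "(\<lambda>y. \<Sum>m<M. word_fun (replicate m z) y) \<in> HK" using BMm[OF B one_mem] by simp
    then show "\<exists>g\<in>HR.clo ?V. hnrm ((\<lambda>y. pick_kernel F y z) - g) < e"
      using M HR.nrm_minus_commute HR.kv_mem BMV[OF B[of M]] by metis
  qed
  have "g \<in> HR.clo ?V" if g: "g \<in> HK" for g
  proof (rule HR.clo_clo[OF V(2) g])
    fix e :: real assume "e > 0"
    then obtain v where "v \<in> range (lc (\<lambda>x y. pick_kernel F y x))" and "hnrm (g - v) < e"
      using HR.clo_D[OF HR.lc_kv_dense[OF g]] by blast
    moreover from \<open>v \<in> range _\<close> have "v \<in> HR.clo ?V"
      by (auto intro: is_subspace_lc[OF V' kV])
    ultimately show "\<exists>v\<in>HR.clo ?V. hnrm (g - v) < e" by blast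
  qed
  then have "\<exists>m\<in>BM. hnrm (g - m * G) < e" if "g \<in> HK" "e > 0" for g e
    using HR.clo_D that by blast
  then show thesis using that[OF G fac inner_multiplier[OF \<Theta>]] by blast
qed

end

section \<open>The theorem of Gleason, Kahane and Zelazko\<close>

text \<open>Newton's identity \<open>p_2 = e_1^2 - 2 e_2\<close> for the reciprocals of the roots,
  whose elementary symmetric functions are up to sign the coefficients of a polynomial with constant
  term 1.\<close>

lemma poly_coeffs_roots:
  fixes A :: "complex multiset"
  defines "s \<equiv> \<Prod>x\<in>#A. [:1, - inverse x:]"
  shows "coeff s 0 = 1 \<and> (coeff s 1)\<^sup>2 - 2 * coeff s 2 = (\<Sum>x\<in>#A. (inverse x)\<^sup>2)"
  unfolding s_def
proof (induction A)
  case empty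
  then show ?case by (simp add: numeral_2_eq_2)
next
  case (add x A)
  define q where "q = (\<Prod>x\<in>#A. [:1, - inverse x:])"
  have q: "coeff q 0 = 1" "(coeff q 1)\<^sup>2 - 2 * coeff q 2 = (\<Sum>x\<in>#A. (inverse x)\<^sup>2)"
    using add unfolding q_def[symmetric] by blast+
  have c: "coeff ([:1, - inverse x:] * q) 0 = coeff q 0"
    "coeff ([:1, - inverse x:] * q) 1 = coeff q 1 - inverse x * coeff q 0"
    "coeff ([:1, - inverse x:] * q) 2 = coeff q 2 - inverse x * coeff q 1"
    by (simp_all add: coeff_pCons numeral_2_eq_2)
  have prod: "(\<Prod>x\<in>#add_mset x A. [:1, - inverse x:]) = [:1, - inverse x:] * q"
    by (simp add: q_def)
  have "(coeff q 1 - inverse x * coeff q 0)\<^sup>2 - 2 * (coeff q 2 - inverse x * coeff q 1)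
      = (inverse x)\<^sup>2 + ((coeff q 1)\<^sup>2 - 2 * coeff q 2)"
    unfolding q(1) by (simp add: power2_eq_square algebra_simps)
  moreover have "(\<Sum>y\<in>#add_mset x A. (inverse y)\<^sup>2) = (inverse x)\<^sup>2 + (\<Sum>y\<in>#A. (inverse y)\<^sup>2)"
    by simp
  ultimately show ?case unfolding prod c using q by (simp only: simp_thms)
qed

text \<open>By Newton's identity the left side is the modulus of a sum of \<open>degree p\<close>
  squared reciprocals of roots, each reciprocal being at most \<open>R\<close> in modulus.\<close>

lemma poly_root_bound:
  fixes p :: "complex poly" and R :: real
  assumes p0: "poly p 0 = 1" and roots: "\<And>t. poly p t = 0 \<Longrightarrow> 1 \<le> cmod t * R" and R: "R > 0"
  shows "cmod ((coeff p 1)\<^sup>2 - 2 * coeff p 2) \<le> degree p * R\<^sup>2"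
proof -
  have "p \<noteq> 0" using p0 by auto
  from alg_closed_imp_factorization[OF this]
  obtain A where "size A = degree p \<and> p = smult (lead_coeff p) (\<Prod>x\<in>#A. [:- x, 1:])" ..
  note A = conjunct1[OF this] conjunct2[OF this]
  have root: "1 \<le> cmod x * R" if "x \<in># A" for x
  proof (rule roots)
    have "poly (\<Prod>x\<in>#A. [:- x, 1:]) x = 0" using that by (induction A) auto
    then show "poly p x = 0" by (subst A(2)) simp
  qed
  then have nz: "x \<noteq> 0" if "x \<in># A" for x using that by force
  define s where "s = (\<Prod>x\<in>#A. [:1, - inverse x:])"
  have "\<exists>d. (\<Prod>x\<in>#A. [:- x, 1:]) = smult d (\<Prod>x\<in>#A. [:1, - inverse x:])"
    using nz
  proof (induction A)
    case empty
    show ?case by (intro exI[of _ 1]) simp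
  next
    case (add x A)
    then obtain d where d: "(\<Prod>x\<in>#A. [:- x, 1:]) = smult d (\<Prod>x\<in>#A. [:1, - inverse x:])" by auto
    have "[:- x, 1:] = smult (- x) [:1, - inverse x:]" using add.prems by simp
    then show ?case
      by (intro exI[of _ "d * - x"])
        (simp only: image_mset_add_mset prod_mset.add_mset d mult_smult_left mult_smult_right smult_smult)
  qed
  then obtain d where d: "p = smult d s" by (metis A(2) s_def smult_smult)
  have s: "coeff s 0 = 1" "(coeff s 1)\<^sup>2 - 2 * coeff s 2 = (\<Sum>x\<in>#A. (inverse x)\<^sup>2)"
    using poly_coeffs_roots[of A] by (simp_all add: s_def)
  have "d = 1" using p0 s(1) d by (simp add: poly_0_coeff_0)
  then have "cmod ((coeff p 1)\<^sup>2 - 2 * coeff p 2) = cmod (\<Sum>x\<in>#A. (inverse x)\<^sup>2)" using d s by simp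
  also have "\<dots> \<le> size A * R\<^sup>2"
    using root
  proof (induction A)
    case (add x A)
    have x: "1 \<le> cmod x * R" using add.prems by simp
    then have "cmod x > 0" by (cases "x = 0") auto
    then have "inverse (cmod x) \<le> R" using x by (simp add: field_simps)
    then have "(inverse (cmod x))\<^sup>2 \<le> R\<^sup>2" by (intro power_mono) auto
    then have "cmod ((inverse x)\<^sup>2) \<le> R\<^sup>2" by (simp add: norm_power norm_inverse)
    moreover have "cmod (\<Sum>x\<in>#A. (inverse x)\<^sup>2) \<le> size A * R\<^sup>2" using add by simp
    ultimately have "cmod ((inverse x)\<^sup>2 + (\<Sum>x\<in>#A. (inverse x)\<^sup>2)) \<le> R\<^sup>2 + size A * R\<^sup>2"
      by (rule norm_triangle_le[OF add_mono])
    then show ?case by (simp add: algebra_simps)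
  qed simp
  finally show ?thesis by (simp add: A(1))
qed

text \<open>Gleason, Kahane and Zelazko, in the elementary form of Roitman and Sternfeld: the roots of
  \<open>t \<mapsto> \<phi> ((1 - t a) ^ n)\<close> are bounded away from zero, and their power sums compare
  \<open>\<phi> (a\<^sup>2)\<close> with \<open>(\<phi> a)\<^sup>2\<close> up to an error that vanishes as \<open>n\<close> grows.\<close>

lemma Gleason_Kahane_Zelazko_square:
  fixes \<phi> :: "('x \<Rightarrow> complex) \<Rightarrow> complex"
  assumes A: "is_subspace A" "1 \<in> A" "\<And>a b. a \<in> A \<Longrightarrow> b \<in> A \<Longrightarrow> a * b \<in> A"
    and \<phi>: "\<And>a b. a \<in> A \<Longrightarrow> b \<in> A \<Longrightarrow> \<phi> (a + b) = \<phi> a + \<phi> b"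
      "\<And>a c. a \<in> A \<Longrightarrow> \<phi> (fscale c a) = c * \<phi> a" "\<phi> 1 = 1"
    and a: "a \<in> A" and R: "R > 0" "\<And>t n. cmod t * R < 1 \<Longrightarrow> \<phi> ((1 - fscale t a) ^ n) \<noteq> 0"
  shows "\<phi> (a * a) = \<phi> a * \<phi> a"
proof -
  have pow: "a ^ k \<in> A" for k by (induction k) (simp_all only: power_0 power_Suc A a)
  have sums: "lc (\<lambda>k. a ^ k) l \<in> A \<and> \<phi> (lc (\<lambda>k. a ^ k) l) = lin l (\<lambda>k. \<phi> (a ^ k))" for l
  proof (induction l)
    case Nil
    have "\<phi> 0 = 0" using \<phi>(2)[OF A(2), of 0] by (simp add: fscale_simps)
    then show ?case using is_subspaceD(1)[OF A(1)] by (simp only: lc_simps lin_simps)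
  next
    case (Cons p l)
    have "fscale (fst p) (a ^ snd p) \<in> A" using is_subspaceD(3)[OF A(1) pow] .
    then show ?case using Cons is_subspaceD(2)[OF A(1)] \<phi>(1) \<phi>(2)[OF pow]
      by (simp only: lc_simps lin_simps)
  qed
  define p where "p n = (\<Sum>k\<le>n. monom (of_nat (n choose k) * (-1) ^ k * \<phi> (a ^ k)) k)" for n
  have expand: "\<phi> ((1 - fscale t a) ^ n) = poly (p n) t" for t n
  proof -
    define l where "l = map (\<lambda>k. (of_nat (n choose k) * (- t) ^ k, k)) [0..<Suc n]"
    have lin: "lin l f = (\<Sum>k\<le>n. of_nat (n choose k) * (- t) ^ k * f k)" for f
      unfolding l_def lin_def
      by (simp add: comp_def interv_sum_list_conv_sum_set_nat atLeast0AtMost atLeastLessThanSuc_atLeastAtMost del: upt_Suc)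
    have "((1 - fscale t a) ^ n) x = lc (\<lambda>k. a ^ k) l x" for x
    proof -
      have pw: "(f ^ k) x = f x ^ k" for f :: "'x \<Rightarrow> complex" and k by (induction k) simp_all
      have "((1 - fscale t a) ^ n) x = (- t * a x + 1) ^ n" by (simp add: pw)
      also have "\<dots> = (\<Sum>k\<le>n. of_nat (n choose k) * (- t * a x) ^ k)"
        by (simp only: binomial_ring power_one mult_1_right)
      also have "\<dots> = lc (\<lambda>k. a ^ k) l x"
        unfolding lc_def lin pw power_mult_distrib by (simp add: mult.assoc)
      finally show ?thesis .
    qed
    then have "(1 - fscale t a) ^ n = lc (\<lambda>k. a ^ k) l" by auto
    then have "\<phi> ((1 - fscale t a) ^ n) = (\<Sum>k\<le>n. of_nat (n choose k) * (- t) ^ k * \<phi> (a ^ k))"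
      using sums[of l] by (simp only: lin)
    also have "\<dots> = poly (p n) t"
      by (simp add: p_def poly_sum poly_monom power_minus[of t] mult_ac)
    finally show ?thesis .
  qed
  define D where "D = (\<phi> a)\<^sup>2 - \<phi> (a ^ 2)"
  \<comment> \<open>For \<open>p n\<close> the sum of the squared reciprocal roots is
    \<open>n (n D + \<phi> (a ^ 2))\<close>, which is quadratic in \<open>n\<close> unless
    \<open>D = 0\<close>, while the bound on the roots allows only \<open>n R^2\<close>.\<close>
  have est: "real n * cmod D \<le> R\<^sup>2 + cmod (\<phi> (a ^ 2))" if n: "n \<ge> 2" for n
  proof -
    have co: "coeff (p n) k = of_nat (n choose k) * (-1) ^ k * \<phi> (a ^ k)" if "k \<le> n" for k
      using that by (simp add: p_def coeff_sum if_distrib cong: if_cong)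
    have "degree (p n) \<le> n"
      unfolding p_def by (intro degree_sum_le) (auto intro: order_trans[OF degree_monom_le])
    then have deg: "real (degree (p n)) * R\<^sup>2 \<le> real n * R\<^sup>2" by (intro mult_right_mono) auto
    have "poly (p n) 0 = 1" using expand[of 0 n] by (simp add: fscale_simps \<phi>)
    moreover have "1 \<le> cmod t * R" if "poly (p n) t = 0" for t
      using R(2)[of t n] expand that by force
    ultimately have "cmod ((coeff (p n) 1)\<^sup>2 - 2 * coeff (p n) 2) \<le> degree (p n) * R\<^sup>2"
      using R(1) by (rule poly_root_bound)
    moreover have "(coeff (p n) 1)\<^sup>2 - 2 * coeff (p n) 2 = of_nat n * (of_nat n * D + \<phi> (a ^ 2))"
    proof -
      have "even (n * (n - 1))" by (cases n) auto
      then have "2 * (n choose 2) = n * (n - 1)" by (simp only: choose_two dvd_mult_div_cancel)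
      then have "complex_of_nat (2 * (n choose 2)) = of_nat (n * (n - 1))" by (rule arg_cong)
      then have c2: "2 * of_nat (n choose 2) = (of_nat n * (of_nat n - 1) :: complex)"
        using n by (simp add: of_nat_diff)
      define y where "y = \<phi> (a ^ 2)"
      have 1: "coeff (p n) 1 = - (of_nat n * \<phi> a)" using co[of 1] n by simp
      have "coeff (p n) 2 = of_nat (n choose 2) * y" using co[of 2] n by (simp add: y_def)
      then have 2: "2 * coeff (p n) 2 = of_nat n * (of_nat n - 1) * y"
        using c2 by (simp only: mult.assoc[symmetric])
      show ?thesis unfolding 1 2 D_def y_def[symmetric] by (simp add: power2_eq_square algebra_simps)
    qed
    ultimately have "real n * cmod (of_nat n * D + \<phi> (a ^ 2)) \<le> real n * R\<^sup>2"
      using deg by (simp add: norm_mult)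
    then have "cmod (of_nat n * D + \<phi> (a ^ 2)) \<le> R\<^sup>2" using n by simp
    moreover have "cmod (of_nat n * D) \<le> cmod (of_nat n * D + \<phi> (a ^ 2)) + cmod (\<phi> (a ^ 2))"
      using norm_triangle_ineq4[of "of_nat n * D + \<phi> (a ^ 2)" "\<phi> (a ^ 2)"] by simp
    ultimately show ?thesis by (simp add: norm_mult)
  qed
  have "D = 0"
  proof (rule ccontr)
    assume "D \<noteq> 0"
    then obtain n where "R\<^sup>2 + cmod (\<phi> (a ^ 2)) < real n * cmod D"
      using reals_Archimedean3[of "cmod D"] by auto
    moreover have "real n * cmod D \<le> real (max n 2) * cmod D" by (intro mult_right_mono) auto
    ultimately show False using est[of "max n 2"] by simp
  qed
  then show ?thesis by (simp add: D_def power2_eq_square)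
qed

text \<open>Expanding \<open>(a + b)^2\<close> in a commutative algebra reduces products to
  squares.\<close>

lemma Gleason_Kahane_Zelazko:
  fixes \<phi> :: "('x \<Rightarrow> complex) \<Rightarrow> complex"
  assumes A: "is_subspace A" "1 \<in> A" "\<And>a b. a \<in> A \<Longrightarrow> b \<in> A \<Longrightarrow> a * b \<in> A"
    and \<phi>: "\<And>a b. a \<in> A \<Longrightarrow> b \<in> A \<Longrightarrow> \<phi> (a + b) = \<phi> a + \<phi> b"
      "\<And>a c. a \<in> A \<Longrightarrow> \<phi> (fscale c a) = c * \<phi> a" "\<phi> 1 = 1"
    and nz: "\<And>a. a \<in> A \<Longrightarrow> \<exists>R>0. \<forall>t n. cmod t * R < 1 \<longrightarrow> \<phi> ((1 - fscale t a) ^ n) \<noteq> 0"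
    and ab: "a \<in> A" "b \<in> A"
  shows "\<phi> (a * b) = \<phi> a * \<phi> b"
proof -
  have sq: "\<phi> (c * c) = \<phi> c * \<phi> c" if c: "c \<in> A" for c
  proof -
    obtain R where "R > 0" "\<forall>t n. cmod t * R < 1 \<longrightarrow> \<phi> ((1 - fscale t c) ^ n) \<noteq> 0" using nz[OF c] by blast
    then show ?thesis using Gleason_Kahane_Zelazko_square[OF A \<phi> c, of R] by blast
  qed
  have abA: "a * b \<in> A" "a * a \<in> A" "b * b \<in> A" "a + b \<in> A"
    using A(3) ab is_subspaceD(2)[OF A(1)] by auto
  have two: "fscale 2 (a * b) \<in> A" using is_subspaceD(3)[OF A(1) abA(1)] .
  have eq: "(a + b) * (a + b) = (a * a + b * b) + fscale 2 (a * b)" by (auto simp: fun_eq_iff algebra_simps)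
  have "\<phi> ((a + b) * (a + b)) = \<phi> (a * a) + \<phi> (b * b) + 2 * \<phi> (a * b)"
    unfolding eq using abA two is_subspaceD(2)[OF A(1)] by (simp only: \<phi>)
  also have "\<phi> ((a + b) * (a + b)) = (\<phi> a + \<phi> b) * (\<phi> a + \<phi> b)"
    using sq[OF abA(4)] ab by (simp only: \<phi>)
  finally have "(\<phi> a + \<phi> b) * (\<phi> a + \<phi> b) = \<phi> a * \<phi> a + \<phi> b * \<phi> b + 2 * \<phi> (a * b)"
    by (simp only: sq[OF ab(1)] sq[OF ab(2)])
  moreover have "z = x * y" if "(x + y) * (x + y) = x * x + y * y + 2 * z" for x y z :: complex
    using that by (simp add: algebra_simps)
  ultimately show ?thesis by blast
qed

section \<open>Inverses of multipliers close to \<open>1\<close>\<close>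

context reproducing
begin

text \<open>Evaluate \<open>h\<close> times the kernel vector at \<open>x\<close> at the point
  \<open>x\<close> itself.\<close>

lemma multiplier_pointwise_bound:
  assumes "\<And>f. f \<in> H \<Longrightarrow> h * f \<in> H" "\<And>f. f \<in> H \<Longrightarrow> norm_H (h * f) \<le> C * norm_H f" and nz: "kv x x \<noteq> 0"
  shows "cmod (h x) \<le> C"
proof -
  have kk: "kv x x = of_real ((norm_H (kv x))\<^sup>2)"
    using reproduce[OF kv_mem, of x x] ip_self_nrm[OF kv_mem] by simp
  have pos: "(norm_H (kv x))\<^sup>2 > 0" using nz kk by (metis of_real_0 zero_less_power2 power2_eq_square mult_zero_left)
  have "cmod (h x) * (norm_H (kv x))\<^sup>2 = cmod ((h * kv x) x)"
    by (simp add: norm_mult kk norm_power)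
  also have "\<dots> \<le> norm_H (h * kv x) * norm_H (kv x)" by (intro eval_bound assms kv_mem)
  also have "\<dots> \<le> C * norm_H (kv x) * norm_H (kv x)"
    by (intro mult_right_mono assms kv_mem nrm_nonneg)
  finally have "cmod (h x) * (norm_H (kv x))\<^sup>2 \<le> C * (norm_H (kv x))\<^sup>2" by (simp add: power2_eq_square)
  then show ?thesis using pos by (simp only: mult_le_cancel_right_pos)
qed

text \<open>For each \<open>f\<close> the quotient \<open>f / (1 - h)\<close> is found in
  \<open>H\<close> as the limit of the iteration \<open>g \<mapsto> f + h g\<close>. The fixed point
  equation determines it at every point, because the pointwise bound keeps \<open>h\<close> away
  from 1.\<close>

lemma Neumann_series:
  assumes h: "\<And>f. f \<in> H \<Longrightarrow> h * f \<in> H" "\<And>f. f \<in> H \<Longrightarrow> norm_H (h * f) \<le> r * norm_H f" and r: "0 \<le> r" "r < 1"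
    and nz: "\<And>x. kv x x \<noteq> 0"
  shows "(\<lambda>x. 1 / (1 - h x)) \<in> bounded_multipliers H ip" "h x \<noteq> 1"
proof -
  have ne: "h x \<noteq> 1" for x using multiplier_pointwise_bound[OF h nz, of x] r by auto
  then show "h x \<noteq> 1" .
  have "(\<lambda>x. 1 / (1 - h x)) * f \<in> H \<and> norm_H ((\<lambda>x. 1 / (1 - h x)) * f) \<le> 1 / (1 - r) * norm_H f" if f: "f \<in> H" for f
  proof -
    define T where "T n = ((\<lambda>g. f + h * g) ^^ n) 0" for n
    have T: "T 0 = 0" "T (Suc n) = f + h * T n" for n by (simp_all add: T_def)
    define B where "B = 1 / (1 - r) * norm_H f"
    \<comment> \<open>\<open>B\<close> is the fixed point of
      \<open>b \<mapsto> norm_H f + r b\<close>, so the bound reproduces itself along the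
      iteration.\<close>
    have B: "norm_H f + r * B = B" "B \<ge> 0"
      using r nrm_nonneg[OF f] by (auto simp: B_def field_simps)
    have Tm: "T n \<in> H" for n by (induction n) (simp_all only: T zero_mem add_mem f h)
    have TB: "norm_H (T n) \<le> B" for n
    proof (induction n)
      case (Suc n)
      have "norm_H (T (Suc n)) \<le> norm_H f + norm_H (h * T n)"
        unfolding T by (intro nrm_triangle f h Tm)
      also have "\<dots> \<le> norm_H f + r * norm_H (T n)" using h(2)[OF Tm] by simp
      also have "\<dots> \<le> norm_H f + r * B" using Suc r by (intro add_left_mono mult_left_mono)
      finally show ?case using B by simp
    next
      case 0
      show ?case using B(2) by (simp only: T nrm_zero)
    qed
    have diff: "norm_H (T (n + k) - T n) \<le> r ^ n * B" for n k
    proof (induction n)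
      case 0
      then show ?case using TB by (simp add: T)
    next
      case (Suc n)
      have "T (Suc n + k) - T (Suc n) = h * (T (n + k) - T n)" by (auto simp: T fun_eq_iff algebra_simps)
      then have "norm_H (T (Suc n + k) - T (Suc n)) \<le> r * norm_H (T (n + k) - T n)"
        using h(2)[OF diff_mem[OF Tm Tm]] by metis
      also have "\<dots> \<le> r * (r ^ n * B)" using Suc r by (intro mult_left_mono)
      finally show ?case by (simp only: power_Suc mult.assoc)
    qed
    have "cauchy T"
      unfolding cauchy_def
    proof (intro allI impI)
      fix e :: real assume e: "e > 0"
      have "(\<lambda>n. r ^ n * B) \<longlonglongrightarrow> 0" using r by (intro tendsto_mult_left_zero LIMSEQ_power_zero) simp
      then have "\<forall>\<^sub>F n in sequentially. r ^ n * B < e / 2" using e by (intro order_tendstoD) auto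
      then obtain N where N: "r ^ N * B < e / 2" by (auto simp: eventually_sequentially)
      have near: "norm_H (T m - T N) < e / 2" if "m \<ge> N" for m
        using diff[of N "m - N"] N that by simp
      have "norm_H (T m - T n) < e" if "m \<ge> N" "n \<ge> N" for m n
        using nrm_triangle_diff[OF Tm[of m] Tm[of N] Tm[of n]] near[OF that(1)] near[OF that(2)]
          nrm_minus_commute[OF Tm[of N] Tm[of n]] by simp
      then show "\<exists>N. \<forall>m\<ge>N. \<forall>n\<ge>N. norm_H (T m - T n) < e" by blast
    qed
    then obtain g where g: "g \<in> H" "conv T g" using cauchy_conv[of T, OF Tm] by blast
    have "g x = f x + h x * g x" for x
    proof (rule LIMSEQ_unique)
      show "(\<lambda>n. T (Suc n) x) \<longlonglongrightarrow> g x" using conv_pointwise[OF Tm g] by (rule LIMSEQ_Suc)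
      show "(\<lambda>n. T (Suc n) x) \<longlonglongrightarrow> f x + h x * g x"
        unfolding T plus_fun_apply times_fun_apply by (intro tendsto_intros conv_pointwise[OF Tm g])
    qed
    then have "g x = 1 / (1 - h x) * f x" for x
    proof -
      assume eq: "\<And>x. g x = f x + h x * g x"
      have "(1 - h x) * g x = f x" using eq[of x] by (simp add: algebra_simps)
      then show ?thesis using ne[of x] by (simp add: field_simps)
    qed
    then have "(\<lambda>x. 1 / (1 - h x)) * f = g" by auto
    moreover have "norm_H g \<le> B"
      by (rule LIMSEQ_le_const2[OF conv_nrm[OF Tm g]]) (use TB in blast)
    ultimately show ?thesis using g(1) by (simp add: B_def)
  qed
  then show "(\<lambda>x. 1 / (1 - h x)) \<in> bounded_multipliers H ip" unfolding bounded_multipliers_def by blast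
qed

end

section \<open>Multiplicative functionals\<close>

text \<open>The normalization point may differ from the base point of the complete Pick property. Both
  conditions say that \<open>1 / K\<close> has one positive square, and this does not depend on the base point.\<close>

lemma psd_normalized_pick:
  assumes herm: "\<And>x y. K y x = cnj (K x y)" and nz: "\<And>x y. K x y \<noteq> 0"
    and pick: "pos_semidef_fun (\<lambda>x y. 1 - (K x x1 * K x1 y) / (K x y * K x1 x1))"
    and x1: "0 < K x1 x1" and x0: "\<And>x. K x x0 = 1"
  shows "psd (\<lambda>x y. 1 - 1 / K x y)"
proof (rule psdI)
  show "1 - 1 / K y x = cnj (1 - 1 / K x y)" for x y by (simp add: herm[of y x])
  fix l
  define L where "L x y = 1 / K x y" for x y
  define r where "r x = 1 / K x1 x" for x
  define G where "G x y = 1 - (K x x1 * K x1 y) / (K x y * K x1 x1)" for x y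
  define k where "k = Re (K x1 x1)"
  have k: "K x1 x1 = of_real k" "k > 0" using x1 by (simp_all add: k_def less_complex_def complex_eq_iff)
  \<comment> \<open>\<open>1 / K\<close> is a rank one positive kernel minus a positive one, so its
    form is nonpositive on the hyperplane where \<open>lin m r\<close> vanishes.\<close>
  have L: "L x y = K x1 x1 * (cnj (r x) * r y - cnj (r x) * G x y * r y)" for x y
    using nz[of x x1] nz[of x1 y] nz[of x y] nz[of x1 x1] herm[of x x1]
    by (simp add: L_def r_def G_def field_simps)
  have neg: "Re (lform L m m) \<le> 0" if m: "lin m r = 0" for m
  proof -
    have "lform (\<lambda>x y. cnj (r x) * r y) m m = 0"
      unfolding lform_def lin_mult m by simp
    moreover have "0 \<le> Re (lform (\<lambda>x y. cnj (r x) * G x y * r y) m m)"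
      using pos_semidef_fun_lform[OF pick[folded G_def], of "map (\<lambda>(a, x). (a * r x, x)) m"]
      unfolding lform_map by (simp add: less_eq_complex_def)
    ultimately show ?thesis
      unfolding L[abs_def] lform_scale lform_diff k(1) Re_of_real_mult
      using k(2) by (simp add: mult_nonneg_nonneg)
  qed
  \<comment> \<open>With this coefficient at \<open>x0\<close> the enlarged list lies in that
    hyperplane. The row of \<open>1 / K\<close> at \<open>x0\<close> is constantly 1, so the added
    terms depend only on \<open>s\<close> and \<open>t\<close>, and they complete the form of the
    constant kernel to the square of \<open>cmod (s + t)\<close>.\<close>
  define t where "t = - lin l r"
  define s where "s = lin l (\<lambda>_. 1)"
  have Lx0: "L x x0 = 1" "L x0 x = 1" for x using x0 herm[of x0 x] by (simp_all add: L_def)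
  have rx0: "r x0 = 1" by (simp add: r_def x0)
  have "lin ((t, x0) # l) r = 0" by (simp add: t_def rx0)
  then have 1: "Re (lform L ((t, x0) # l) ((t, x0) # l)) \<le> 0" by (rule neg)
  have cs: "clin l (\<lambda>_. 1) = cnj s" unfolding s_def cnj_lin by simp
  have "lform L ((t, x0) # l) ((t, x0) # l) = cnj t * (t + s) + t * cnj s + lform L l l"
  proof -
    have "lin l (L x0) = s" unfolding s_def by (intro lin_cong) (simp add: Lx0)
    moreover have "clin l (\<lambda>x. L x x0) = cnj s" unfolding cs[symmetric] by (intro clin_cong) (simp add: Lx0)
    ultimately show ?thesis by (simp add: lform_simps Lx0 algebra_simps)
  qed
  then have 2: "Re (lform L ((t, x0) # l) ((t, x0) # l)) = Re (cnj t * (t + s) + t * cnj s) + Re (lform L l l)"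
    by (simp only: plus_complex.simps)
  have "lform (\<lambda>x y. 1 - L x y) l l = cnj s * s - lform L l l"
  proof -
    have "lform (\<lambda>x y. 1) l l = cnj s * s"
      unfolding lform_def s_def[symmetric] using clin_mult[of l s "\<lambda>_. 1"] cs by (simp add: mult.commute)
    then show ?thesis by (simp only: lform_diff)
  qed
  then have "Re (lform (\<lambda>x y. 1 - L x y) l l) = Re (cnj s * s) - Re (lform L l l)" by simp
  also have "\<dots> \<ge> Re (cnj s * s) + Re (cnj t * (t + s) + t * cnj s)" using 1 2 by linarith
  moreover have "Re (cnj s * s) + Re (cnj t * (t + s) + t * cnj s) = (cmod (s + t))\<^sup>2"
    unfolding cmod_power2 by (simp add: power2_eq_square algebra_simps)
  ultimately show "0 \<le> Re (lform (\<lambda>x y. 1 - 1 / K x y) l l)"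
    unfolding L_def[abs_def] by (metis order_trans zero_le_power2)
qed

section \<open>The metric topology in terms of the norm\<close>

context function_pre_hilbert
begin

interpretation M: Metric_space H "ip_dist H ip"
  by (rule Metric_space_ip_dist)

lemma ip_dist_nrm: "f \<in> H \<Longrightarrow> g \<in> H \<Longrightarrow> ip_dist H ip f g = norm_H (f - g)"
  by (simp add: ip_dist_def nrm_def)

lemma ip_topology_closure:
  assumes "S \<subseteq> H" shows "ip_topology H ip closure_of S = clo S"
proof -
  have "ip_topology H ip closure_of S = {x \<in> H. \<forall>r>0. \<exists>y\<in>S. y \<in> M.mball x r}"
    unfolding ip_topology_def by (rule M.metric_closure_of)
  also have "\<dots> = clo S"
    unfolding clo_def
  proof (intro Collect_cong conj_cong refl all_cong bex_cong)
    fix x y assume "x \<in> H" "y \<in> S"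
    then show "(y \<in> M.mball x r) = (norm_H (x - y) < r)" for r
      using assms by (auto simp: M.in_mball ip_dist_nrm)
  qed
  finally show ?thesis .
qed

lemma ip_topology_openin:
  "openin (ip_topology H ip) U \<longleftrightarrow> U \<subseteq> H \<and> (\<forall>x\<in>U. \<exists>r>0. \<forall>y\<in>H. norm_H (x - y) < r \<longrightarrow> y \<in> U)"
proof -
  have "M.mball x r \<subseteq> U \<longleftrightarrow> (\<forall>y\<in>H. norm_H (x - y) < r \<longrightarrow> y \<in> U)" if "x \<in> H" for x r
    using that by (auto simp: M.in_mball subset_iff ip_dist_nrm)
  then show ?thesis
    unfolding ip_topology_def M.openin_mtopology by (meson subsetD)
qed

lemma topspace_ip_topology: "topspace (ip_topology H ip) = H"
  unfolding ip_topology_def by (rule M.topspace_mtopology)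

lemma bounded_imp_continuous_map:
  assumes diff: "\<And>f g. f \<in> H \<Longrightarrow> g \<in> H \<Longrightarrow> \<phi> (f - g) = \<phi> f - \<phi> g"
    and bound: "\<And>f. f \<in> H \<Longrightarrow> cmod (\<phi> f) \<le> C * norm_H f"
  shows "continuous_map (ip_topology H ip) euclidean \<phi>"
  unfolding continuous_map_def topspace_ip_topology
proof (intro conjI allI impI)
  fix U :: "complex set" assume "openin euclidean U"
  then have U: "open U" by simp
  show "openin (ip_topology H ip) {x \<in> H. \<phi> x \<in> U}"
    unfolding ip_topology_openin
  proof (intro conjI ballI)
    fix f assume "f \<in> {x \<in> H. \<phi> x \<in> U}"
    then have f: "f \<in> H" "\<phi> f \<in> U" by auto
    obtain e where e: "e > 0" "ball (\<phi> f) e \<subseteq> U" using U f(2) openE by blast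
    have C: "\<bar>C\<bar> + 1 > 0" by simp
    have "g \<in> {x \<in> H. \<phi> x \<in> U}" if g: "g \<in> H" "norm_H (f - g) < e / (\<bar>C\<bar> + 1)" for g
    proof -
      have "cmod (\<phi> f - \<phi> g) \<le> C * norm_H (f - g)" using bound[OF diff_mem[OF f(1) g(1)]] diff f g by simp
      also have "\<dots> \<le> (\<bar>C\<bar> + 1) * norm_H (f - g)"
        using nrm_nonneg[OF diff_mem[OF f(1) g(1)]] by (intro mult_right_mono) auto
      also have "\<dots> < e" using g(2) C by (simp add: field_simps)
      finally show ?thesis using e(2) g(1) by (auto simp: dist_norm subset_iff)
    qed
    moreover have "e / (\<bar>C\<bar> + 1) > 0" using e(1) C by simp
    ultimately show "\<exists>r>0. \<forall>y\<in>H. norm_H (f - y) < r \<longrightarrow> y \<in> {x \<in> H. \<phi> x \<in> U}" by blast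
  qed auto
qed simp

lemma continuous_map_imp_bounded:
  assumes cont: "continuous_map (ip_topology H ip) euclidean \<phi>"
    and zero: "\<phi> 0 = 0" and scale: "\<And>f c. f \<in> H \<Longrightarrow> \<phi> (fscale c f) = c * \<phi> f"
  obtains C where "\<And>f. f \<in> H \<Longrightarrow> cmod (\<phi> f) \<le> C * norm_H f"
proof -
  have "openin (ip_topology H ip) {f \<in> topspace (ip_topology H ip). \<phi> f \<in> ball 0 1}"
    using cont by (intro openin_continuous_map_preimage) auto
  then have "openin (ip_topology H ip) {f \<in> H. \<phi> f \<in> ball 0 1}" by (simp only: topspace_ip_topology)
  moreover have "0 \<in> {f \<in> H. \<phi> f \<in> ball 0 1}" using zero zero_mem by simp
  ultimately obtain r where r: "r > 0" "\<forall>y\<in>H. norm_H (0 - y) < r \<longrightarrow> y \<in> {f \<in> H. \<phi> f \<in> ball 0 1}"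
    unfolding ip_topology_openin by blast
  have small: "cmod (\<phi> f) < 1" if "f \<in> H" "norm_H f < r" for f
  proof -
    have "norm_H (0 - f) = norm_H f" using nrm_uminus[OF that(1)] by (simp only: diff_0)
    then show ?thesis using r(2) that by auto
  qed
  have "cmod (\<phi> f) \<le> 2 / r * norm_H f" if f: "f \<in> H" for f
  proof (cases "norm_H f = 0")
    case True
    then show ?thesis using nrm_eq_0[OF f] zero by simp
  next
    case False
    then have pos: "norm_H f > 0" using nrm_nonneg[OF f] by simp
    define c where "c = r / (2 * norm_H f)"
    have c: "c > 0" using pos r(1) by (simp add: c_def)
    have "norm_H (fscale (of_real c) f) = c * norm_H f" using c by (simp add: nrm_fscale[OF f])
    then have "norm_H (fscale (of_real c) f) = r / 2" using pos by (simp add: c_def)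
    then have "cmod (\<phi> (fscale (of_real c) f)) < 1" using r(1) f by (intro small fscale_mem) auto
    then have "c * cmod (\<phi> f) < 1" using c f by (simp add: scale norm_mult)
    then have "cmod (\<phi> f) < 1 / c" using c by (simp add: field_simps)
    then show ?thesis by (simp add: c_def)
  qed
  then show thesis using that by blast
qed

end

lemma (in rkhs) function_hilbert: "function_hilbert H ip"
proof
  interpret M: Metric_space H "ip_dist H ip" by (rule Metric_space_ip_dist)
  fix \<sigma> assume \<sigma>: "\<And>n. \<sigma> n \<in> H" and c: "cauchy \<sigma>"
  have "M.MCauchy \<sigma>"
    unfolding M.MCauchy_def using \<sigma> c unfolding cauchy_def by (auto simp: ip_dist_nrm)
  then obtain f where "limitin M.mtopology \<sigma> f sequentially"
    using complete unfolding M.mcomplete_def by blast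
  then have f: "f \<in> H" "\<And>e. e > 0 \<Longrightarrow> \<exists>N. \<forall>n\<ge>N. \<sigma> n \<in> H \<and> ip_dist H ip (\<sigma> n) f < e"
    unfolding M.limit_metric_sequentially by auto
  have "conv \<sigma> f"
    unfolding conv_def
  proof (rule LIMSEQ_I)
    fix e :: real assume "e > 0"
    then obtain N where "\<forall>n\<ge>N. \<sigma> n \<in> H \<and> ip_dist H ip (\<sigma> n) f < e" using f(2) by blast
    then show "\<exists>N. \<forall>n\<ge>N. norm (norm_H (\<sigma> n - f) - 0) < e"
      using nrm_nonneg[OF diff_mem[OF \<sigma> f(1)]]
      by (intro exI[of _ N]) (simp add: ip_dist_nrm[OF \<sigma> f(1)])
  qed
  then show "\<exists>f\<in>H. conv \<sigma> f" using f(1) by blast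
qed

text \<open>Continuity of evaluation gives a bound, and Riesz gives a representing vector. Two such
  vectors differ by an element orthogonal to itself, so the definite description in
  \<open>kernel_vec\<close> denotes.\<close>

lemma (in rkhs) reproducing_kernel_vec: "reproducing H ip (kernel_vec H ip)"
proof -
  interpret function_hilbert H ip by (rule function_hilbert)
  have "kernel_vec H ip x \<in> H \<and> (\<forall>f\<in>H. f x = ip f (kernel_vec H ip x))" for x
    unfolding kernel_vec_def
  proof (rule theI'[where P = "\<lambda>k. k \<in> H \<and> (\<forall>f\<in>H. f x = ip f k)"])
    obtain C where C: "\<And>f. f \<in> H \<Longrightarrow> cmod (f x) \<le> C * norm_H f"
      using continuous_map_imp_bounded[OF eval_continuous[of x]] by auto
    obtain k where k: "k \<in> H" "\<And>f. f \<in> H \<Longrightarrow> f x = ip f k"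
      using Riesz[of "\<lambda>f. f x", OF _ _ C] by auto
    have "k' = k" if k': "k' \<in> H" "\<forall>f\<in>H. f x = ip f k'" for k'
    proof -
      have "ip (k' - k) (k' - k) = ip (k' - k) k' - ip (k' - k) k"
        using k k' by (intro ip_diff diff_mem)
      also have "\<dots> = 0"
        using k'(2)[rule_format, OF diff_mem[OF k'(1) k(1)]] k(2)[OF diff_mem[OF k'(1) k(1)]]
        by (simp only: diff_self)
      finally show ?thesis using ip_definite[OF diff_mem[OF k'(1) k(1)]] by simp
    qed
    then show "\<exists>!k. k \<in> H \<and> (\<forall>f\<in>H. f x = ip f k)" using k by blast
  qed
  then show ?thesis by unfold_locales auto
qed

text \<open>The interface between kernels and functionals: from here on the Pick property enters
  only through this existence statement, and \<open>F\<close> and the Fock space are no longer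
  visible.\<close>

locale factorization_space = reproducing H ip kv
  for H :: "('x \<Rightarrow> complex) set" and ip and kv +
  assumes one_mem: "1 \<in> H"
    and kv_nonzero: "kv x x \<noteq> 0"
    and factorization: "(\<And>n::nat. f n \<in> H) \<Longrightarrow> summable (\<lambda>n. (nrm ip (f n))\<^sup>2) \<Longrightarrow> f n0 \<noteq> 0 \<Longrightarrow>
      \<exists>G h. G \<in> H \<and> (\<forall>n. f n = h n * G) \<and> (\<forall>n. \<forall>g\<in>H. h n * g \<in> H \<and> nrm ip (h n * g) \<le> nrm ip g)
        \<and> (\<forall>g\<in>H. \<forall>e>0. \<exists>m\<in>bounded_multipliers H ip. nrm ip (g - m * G) < e)"

text \<open>The space built from \<open>F = 1 - 1 / K\<close> has the reproducing kernel
  \<open>K\<close>, so it is the given space with the same norm, and the factorization is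
  transported along this equality.\<close>

lemma (in rkhs) factorization_space:
  assumes P: "complete_pick_kernel (rep_kernel H ip)" and N: "normalized_kernel (rep_kernel H ip)"
  shows "factorization_space H ip (kernel_vec H ip)"
proof -
  interpret A: reproducing H ip "kernel_vec H ip" by (rule reproducing_kernel_vec)
  let ?K = "rep_kernel H ip"
  define F where "F x y = 1 - 1 / ?K x y" for x y
  have herm: "?K y x = cnj (?K x y)" for x y unfolding rep_kernel_def by (rule A.kv_herm)
  have nz: "?K x y \<noteq> 0" for x y using P by (simp add: complete_pick_kernel_def)
  obtain x1 where x1: "pos_semidef_fun (\<lambda>x y. 1 - (?K x x1 * ?K x1 y) / (?K x y * ?K x1 x1))"
    using P unfolding complete_pick_kernel_def by blast
  obtain x0 where x0: "\<And>x. ?K x x0 = 1" using N unfolding normalized_kernel_def by blast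
  have psd: "psd F" unfolding F_def
    by (rule psd_normalized_pick[OF herm nz x1 kernel_diag_pos x0])
  have F_less: "Re (F x x) < 1" for x
  proof -
    have "Re (?K x x) > 0" "Im (?K x x) = 0" using kernel_diag_pos[of x] by (simp_all add: less_complex_def)
    then show ?thesis by (simp add: F_def Re_divide)
  qed
  interpret P: pick F by unfold_locales (rule psd, rule F_less)
  have pk: "pick_kernel F y x = kernel_vec H ip x y" for x y
    by (simp add: pick_kernel_def F_def rep_kernel_def)
  have R: "reproducing P.HK P.hip (kernel_vec H ip)" using P.HR.reproducing_axioms by (simp add: pk)
  have HK: "f \<in> H \<longleftrightarrow> f \<in> P.HK" for f
    using reproducing_unique[OF A.reproducing_axioms R] reproducing_unique[OF R A.reproducing_axioms] by blast
  have nrm: "nrm P.hip f = nrm ip f" if "f \<in> H" for f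
    using reproducing_unique[OF A.reproducing_axioms R that] by blast
  have BM: "P.BM = bounded_multipliers H ip"
    unfolding bounded_multipliers_def using HK nrm by (intro Collect_cong) (metis (no_types, lifting))
  show ?thesis
  proof
    show "1 \<in> H" using P.one_mem HK by blast
    show "kernel_vec H ip x x \<noteq> 0" for x using nz[of x x] by (simp add: rep_kernel_def)
    fix f :: "nat \<Rightarrow> 'x \<Rightarrow> complex" and n0
    assume f: "\<And>n. f n \<in> H" "summable (\<lambda>n. (nrm ip (f n))\<^sup>2)" "f n0 \<noteq> 0"
    have fK: "f n \<in> P.HK" for n using f(1) HK by blast
    have sm: "summable (\<lambda>n. (nrm P.hip (f n))\<^sup>2)" using f(2) nrm[OF f(1)] by simp
    show "\<exists>G h. G \<in> H \<and> (\<forall>n. f n = h n * G) \<and> (\<forall>n. \<forall>g\<in>H. h n * g \<in> H \<and> nrm ip (h n * g) \<le> nrm ip g)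
        \<and> (\<forall>g\<in>H. \<forall>e>0. \<exists>m\<in>bounded_multipliers H ip. nrm ip (g - m * G) < e)"
    proof (rule P.simultaneous_factorization[OF fK sm f(3)])
      fix G h
      assume G: "G \<in> P.HK" "\<And>n. f n = h n * G"
        and h: "\<And>n g. g \<in> P.HK \<Longrightarrow> h n * g \<in> P.HK \<and> P.hnrm (h n * g) \<le> P.hnrm g"
        and dense: "\<And>g e. g \<in> P.HK \<Longrightarrow> e > 0 \<Longrightarrow> \<exists>m\<in>P.BM. P.hnrm (g - m * G) < e"
      have GH: "G \<in> H" using G HK by blast
      have h': "h n * g \<in> H \<and> nrm ip (h n * g) \<le> nrm ip g" if "g \<in> H" for n g
      proof -
        have "h n * g \<in> H" using h[of g n] that HK by blast
        then show ?thesis using h[of g n] that HK[of g] nrm by simp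
      qed
      have "\<exists>m\<in>bounded_multipliers H ip. nrm ip (g - m * G) < e" if ge: "g \<in> H" "e > 0" for g e
      proof -
        obtain m where m: "m \<in> P.BM" "P.hnrm (g - m * G) < e" using dense[of g e] ge HK by blast
        have "m * G \<in> H" using bounded_multipliersD[of m] m(1) GH unfolding BM by blast
        then have "nrm P.hip (g - m * G) = nrm ip (g - m * G)" by (intro nrm diff_mem ge)
        then show ?thesis using m unfolding BM by (intro bexI[of _ m]) simp_all
      qed
      then show ?thesis using GH G(2) h' by blast
    qed
  qed
qed

section \<open>Functionals on a space with factorization\<close>

context factorization_space
begin

abbreviation B :: "('x \<Rightarrow> complex) set" where "B \<equiv> bounded_multipliers H ip"

text \<open>Formally stronger than \<open>cyclic\<close>, as only bounded multipliers are used; the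
  factorization provides elements of this kind, and nonvanishing at cyclic elements covers
  them.\<close>

definition orbit_dense :: "('x \<Rightarrow> complex) \<Rightarrow> bool" where
  "orbit_dense G \<longleftrightarrow> G \<in> H \<and> (\<forall>g\<in>H. \<forall>e>0. \<exists>m\<in>B. norm_H (g - m * G) < e)"

lemma B_mult: "m \<in> B \<Longrightarrow> f \<in> H \<Longrightarrow> m * f \<in> H"
  using bounded_multipliersD by blast

lemma B_mem: "m \<in> B \<Longrightarrow> m \<in> H"
  using B_mult[OF _ one_mem, of m] by simp

lemma one_B: "1 \<in> B"
  using bounded_multipliers_const[of 1] by (simp add: one_fun_def)

lemma B_power: "m \<in> B \<Longrightarrow> m ^ n \<in> B"
  by (induction n) (simp_all only: power_0 power_Suc one_B bounded_multipliers_mult)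

lemma orbit_dense_cyclic:
  assumes "orbit_dense G" shows "cyclic H ip G"
proof -
  have G: "G \<in> H" using assms by (simp add: orbit_dense_def)
  have sub: "{h * G | h. h \<in> multipliers H} \<subseteq> H" using G by (auto simp: multipliers_def)
  have BM: "m \<in> multipliers H" if "m \<in> B" for m using B_mult[OF that] by (simp add: multipliers_def)
  have "clo {h * G | h. h \<in> multipliers H} = H"
  proof (intro subset_antisym subsetI)
    show "f \<in> H" if "f \<in> clo {h * G | h. h \<in> multipliers H}" for f using clo_mem[OF that] .
    fix f assume f: "f \<in> H"
    show "f \<in> clo {h * G | h. h \<in> multipliers H}"
      unfolding clo_def
    proof (intro CollectI conjI allI impI f)
      fix e :: real assume "e > 0"
      then obtain m where "m \<in> B" "norm_H (f - m * G) < e" using assms f unfolding orbit_dense_def by blast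
      then show "\<exists>v\<in>{h * G | h. h \<in> multipliers H}. norm_H (f - v) < e" using BM by blast
    qed
  qed
  then show ?thesis using G ip_topology_closure[OF sub] by (simp add: cyclic_def)
qed

lemma orbit_dense_mult:
  assumes G: "orbit_dense G" and u: "u \<in> B" and v: "v \<in> B" and uv: "v * u = 1"
  shows "orbit_dense (u * G)"
  unfolding orbit_dense_def
proof (intro conjI ballI allI impI)
  show "u * G \<in> H" using G B_mult[OF u] by (simp add: orbit_dense_def)
  fix g and e :: real assume "g \<in> H" "e > 0"
  then obtain m where m: "m \<in> B" "norm_H (g - m * G) < e" using G unfolding orbit_dense_def by blast
  have "(m * v) * (u * G) = m * (v * u) * G" by (simp only: mult.assoc)
  also have "\<dots> = m * G" by (simp only: uv mult_1_right)
  finally show "\<exists>m\<in>B. norm_H (g - m * (u * G)) < e"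
    using m bounded_multipliers_mult[OF m(1) v] by (intro bexI[of _ "m * v"]) simp_all
qed

lemma resolvent:
  assumes a: "\<And>f. f \<in> H \<Longrightarrow> a * f \<in> H" "\<And>f. f \<in> H \<Longrightarrow> norm_H (a * f) \<le> C * norm_H f" and C: "C \<ge> 0"
    and t: "cmod t * C < 1"
  obtains u where "u \<in> B" "u * (1 - fscale t a) = 1"
proof -
  have eq: "fscale t a * f = fscale t (a * f)" for f by (auto simp: fun_eq_iff)
  have b: "norm_H (fscale t a * f) \<le> cmod t * C * norm_H f" if "f \<in> H" for f
    using a(1)[OF that] a(2)[OF that] by (simp only: eq nrm_fscale mult.assoc) (simp add: mult_left_mono)
  have m: "fscale t a * f \<in> H" if "f \<in> H" for f
    unfolding eq using a(1)[OF that] by (rule fscale_mem)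
  have tC: "0 \<le> cmod t * C" using C by simp
  note N = Neumann_series[OF m b tC t kv_nonzero]
  have "(\<lambda>x. 1 / (1 - fscale t a x)) * (1 - fscale t a) = 1"
    using N(2) by (auto simp: fun_eq_iff)
  then show thesis using that N(1) by blast
qed

lemma invertible_powers:
  assumes a: "a \<in> B"
  shows "\<exists>R>0. \<forall>t n. cmod t * R < 1 \<longrightarrow> (\<exists>v\<in>B. v * (1 - fscale t a) ^ n = 1)"
proof -
  obtain C where "C > 0" "\<forall>f\<in>H. a * f \<in> H \<and> norm_H (a * f) \<le> C * norm_H f"
    using bounded_multipliersD[OF a] by blast
  then have C: "C > 0" "\<And>f. f \<in> H \<Longrightarrow> a * f \<in> H" "\<And>f. f \<in> H \<Longrightarrow> norm_H (a * f) \<le> C * norm_H f" by simp_all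
  have "\<exists>v\<in>B. v * (1 - fscale t a) ^ n = 1" if t: "cmod t * C < 1" for t n
  proof -
    obtain u where u: "u \<in> B" "u * (1 - fscale t a) = 1"
      using resolvent[OF C(2,3) less_imp_le[OF C(1)] t] by blast
    have "u ^ n * (1 - fscale t a) ^ n = 1"
      by (simp only: power_mult_distrib[symmetric] u(2) power_one)
    then show ?thesis using B_power[OF u(1)] by blast
  qed
  then show ?thesis using C(1) by blast
qed

lemma B_affine: "a \<in> B \<Longrightarrow> (1 - fscale t a) ^ n \<in> B"
  using is_subspaceD[OF is_subspace_bounded_multipliers] one_B by (intro B_power) blast

context
  fixes \<Lambda> :: "('x \<Rightarrow> complex) \<Rightarrow> complex"
  assumes lin: "linear_functional_on H \<Lambda>"
begin

lemma \<Lambda>_add: "f \<in> H \<Longrightarrow> g \<in> H \<Longrightarrow> \<Lambda> (f + g) = \<Lambda> f + \<Lambda> g"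
  and \<Lambda>_scale: "f \<in> H \<Longrightarrow> \<Lambda> (fscale c f) = c * \<Lambda> f"
  using lin by (auto simp: linear_functional_on_def fscale_def)

lemma \<Lambda>_zero: "\<Lambda> 0 = 0"
  using \<Lambda>_scale[OF zero_mem, of 0] by (simp only: fscale_simps mult_zero_left)

lemma \<Lambda>_diff: "f \<in> H \<Longrightarrow> g \<in> H \<Longrightarrow> \<Lambda> (f - g) = \<Lambda> f - \<Lambda> g"
  using \<Lambda>_add[OF diff_mem[of f g], of g] by (simp only: diff_add_cancel) simp

text \<open>For \<open>u\<close> invertible in \<open>B\<close> the element \<open>u * G\<close> is
  again orbit dense, which supplies the nonvanishing that Gleason-Kahane-Zelazko demands. The
  identity is stated with the denominators cleared.\<close>

lemma character_on_orbit:
  assumes nz: "\<And>G. orbit_dense G \<Longrightarrow> \<Lambda> G \<noteq> 0" and G: "orbit_dense G" and ab: "a \<in> B" "b \<in> B"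
  shows "\<Lambda> (a * b * G) * \<Lambda> G = \<Lambda> (a * G) * \<Lambda> (b * G)"
proof -
  have GH: "G \<in> H" using G by (simp add: orbit_dense_def)
  have \<Lambda>G: "\<Lambda> G \<noteq> 0" using nz[OF G] .
  define \<phi> where "\<phi> a = \<Lambda> (a * G) / \<Lambda> G" for a
  have "\<phi> (a * b) = \<phi> a * \<phi> b"
  proof (rule Gleason_Kahane_Zelazko[OF is_subspace_bounded_multipliers one_B bounded_multipliers_mult _ _ _ _ ab])
    show "\<phi> (a + b) = \<phi> a + \<phi> b" if "a \<in> B" "b \<in> B" for a b
      using that GH by (simp only: \<phi>_def distrib_right \<Lambda>_add B_mult add_divide_distrib)
    show "\<phi> (fscale c a) = c * \<phi> a" if "a \<in> B" for a c
    proof -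
      have "fscale c a * G = fscale c (a * G)" by (auto simp: fun_eq_iff)
      then show ?thesis using that GH by (simp only: \<phi>_def \<Lambda>_scale B_mult times_divide_eq_right)
    qed
    show "\<phi> 1 = 1" unfolding \<phi>_def mult_1_left using \<Lambda>G by simp
    fix a assume a: "a \<in> B"
    obtain R where R: "R > 0" "\<forall>t n. cmod t * R < 1 \<longrightarrow> (\<exists>v\<in>B. v * (1 - fscale t a) ^ n = 1)"
      using invertible_powers[OF a] by blast
    have "\<phi> ((1 - fscale t a) ^ n) \<noteq> 0" if t: "cmod t * R < 1" for t n
    proof -
      obtain v where "v \<in> B" "v * (1 - fscale t a) ^ n = 1" using R(2) t by blast
      then have "orbit_dense ((1 - fscale t a) ^ n * G)" using orbit_dense_mult[OF G B_affine[OF a]] by blast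
      then show ?thesis unfolding \<phi>_def using nz \<Lambda>G by (simp only: divide_eq_0_iff) blast
    qed
    then show "\<exists>R>0. \<forall>t n. cmod t * R < 1 \<longrightarrow> \<phi> ((1 - fscale t a) ^ n) \<noteq> 0" using R(1) by blast
  qed
  then show ?thesis using \<Lambda>G unfolding \<phi>_def by (simp add: field_simps)
qed

text \<open>Apply the factorization to the sequence \<open>1, f, 0, 0, ...\<close>; its first entry
  ensures that it is not the zero sequence. The last equation comes from multiplying
  \<open>f = h2 * G\<close> by \<open>h1\<close> and using \<open>h1 * G = 1\<close>.\<close>

lemma pair_factorization:
  assumes f: "f \<in> H"
  obtains G h1 h2 where "orbit_dense G" "h1 \<in> B" "h2 \<in> B" "1 = h1 * G" "f = h2 * G" "h1 * f = h2"
proof -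
  define s :: "nat \<Rightarrow> 'x \<Rightarrow> complex" where "s n = (if n = 0 then 1 else if n = 1 then f else 0)" for n
  have s: "s n \<in> H" for n by (simp add: s_def one_mem f zero_mem)
  have sm: "summable (\<lambda>n. (norm_H (s n))\<^sup>2)"
    by (rule summable_finite[of "{0, 1}"]) (auto simp: s_def nrm_zero)
  have s01: "s 0 = 1" by (simp add: s_def)
  then have s0: "s 0 \<noteq> 0" by (metis one_neq_zero)
  obtain G h where G: "G \<in> H" "\<forall>n. s n = h n * G" "\<forall>n. \<forall>g\<in>H. h n * g \<in> H \<and> norm_H (h n * g) \<le> norm_H g"
    "\<forall>g\<in>H. \<forall>e>0. \<exists>m\<in>B. norm_H (g - m * G) < e"
    using factorization[of s 0, OF s sm s0] by blast
  have hB: "h n \<in> B" for n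
    unfolding bounded_multipliers_def using G(3) by (intro CollectI exI[of _ 1]) simp
  have 1: "1 = h 0 * G" by (rule trans[OF s01[symmetric] G(2)[rule_format, of 0]])
  have 2: "f = h 1 * G" using G(2)[rule_format, of 1] by (simp add: s_def)
  have "h 0 * f = h 1 * (h 0 * G)" unfolding 2 by (simp only: mult.left_commute)
  also have "\<dots> = h 1" unfolding 1[symmetric] by (rule mult_1_right)
  finally have 3: "h 0 * f = h 1" .
  have "orbit_dense G" using G(1,4) by (simp add: orbit_dense_def)
  then show thesis using hB hB 1 2 3 by (rule that)
qed

lemma multiplicative_of_nonvanishing:
  assumes \<Lambda>1: "\<Lambda> 1 = 1" and nz: "\<And>G. orbit_dense G \<Longrightarrow> \<Lambda> G \<noteq> 0"
    and f: "f \<in> H" and g: "g \<in> H" and fg: "f * g \<in> H"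
  shows "\<Lambda> (f * g) = \<Lambda> f * \<Lambda> g"
proof -
  have M: "\<Lambda> (a * f) = \<Lambda> a * \<Lambda> f" if a: "a \<in> B" and f: "f \<in> H" for a f
  proof -
    obtain G h1 h2 where G: "orbit_dense G" and h: "h1 \<in> B" "h2 \<in> B" "1 = h1 * G" "f = h2 * G"
      using pair_factorization[OF f] by blast
    have \<Lambda>G: "\<Lambda> G \<noteq> 0" using nz[OF G] .
    \<comment> \<open>Because \<open>h1 * G = 1\<close>, the character at \<open>a\<close> and
      \<open>h1\<close> compares \<open>\<Lambda> (a * G)\<close> with \<open>\<Lambda> a\<close>;
      this removes the dependence on \<open>G\<close>.\<close>
    have aG: "\<Lambda> (a * G) = \<Lambda> a * \<Lambda> G"
    proof -
      have "\<Lambda> (a * h1 * G) * \<Lambda> G = \<Lambda> (a * G) * \<Lambda> (h1 * G)"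
        by (rule character_on_orbit[OF nz G a h(1)])
      moreover have "a * h1 * G = a" unfolding mult.assoc h(3)[symmetric] by (rule mult_1_right)
      ultimately show ?thesis using \<Lambda>1 by (simp only: h(3)[symmetric] mult_1_right)
    qed
    have "\<Lambda> (a * h2 * G) * \<Lambda> G = \<Lambda> (a * G) * \<Lambda> (h2 * G)"
      by (rule character_on_orbit[OF nz G a h(2)])
    then have "\<Lambda> (a * f) * \<Lambda> G = \<Lambda> a * \<Lambda> f * \<Lambda> G"
      unfolding aG h(4) by (simp only: mult_ac)
    then show ?thesis using \<Lambda>G by (simp only: mult_cancel_right) blast
  qed
  obtain G h1 h2 where G: "orbit_dense G" and h: "h1 \<in> B" "h2 \<in> B" "1 = h1 * G" "h1 * f = h2"
    using pair_factorization[OF f] by blast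
  obtain G' k1 k2 where G': "orbit_dense G'" and k: "k1 \<in> B" "k2 \<in> B" "1 = k1 * G'" "k1 * g = k2"
    using pair_factorization[OF g] by blast
  have "G \<in> H" "G' \<in> H" using G G' by (simp_all add: orbit_dense_def)
  then have "\<Lambda> h1 * \<Lambda> G = 1" "\<Lambda> k1 * \<Lambda> G' = 1"
    using M[OF h(1), of G] M[OF k(1), of G'] by (simp_all only: h(3)[symmetric] k(3)[symmetric] \<Lambda>1)
  then have nz': "\<Lambda> h1 \<noteq> 0" "\<Lambda> k1 \<noteq> 0" by auto
  \<comment> \<open>Both functions are quotients of bounded multipliers. After clearing the
    denominators only products with a factor in \<open>B\<close> occur, where \<open>M\<close>
    applies, and \<open>\<Lambda>\<close> is nonzero at the denominators since
    \<open>h1 * G = 1\<close> and \<open>k1 * G' = 1\<close>.\<close>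
  have "h1 * (k1 * (f * g)) = h2 * k2" unfolding h(4)[symmetric] k(4)[symmetric] by (simp only: mult_ac)
  then have "\<Lambda> h1 * (\<Lambda> k1 * \<Lambda> (f * g)) = \<Lambda> h2 * \<Lambda> k2"
    using M[OF h(1) B_mult[OF k(1) fg]] M[OF k(1) fg] M[OF h(2) B_mem[OF k(2)]] by simp
  also have "\<dots> = (\<Lambda> h1 * \<Lambda> f) * (\<Lambda> k1 * \<Lambda> g)"
    using M[OF h(1) f] M[OF k(1) g] by (simp only: h(4) k(4))
  finally show ?thesis using nz' by (simp add: mult_ac)
qed

lemma multiplicative_bounded:
  assumes mult: "\<And>f g. f \<in> H \<Longrightarrow> g \<in> H \<Longrightarrow> f * g \<in> H \<Longrightarrow> \<Lambda> (f * g) = \<Lambda> f * \<Lambda> g"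
    and \<Lambda>1: "\<Lambda> 1 = 1"
  obtains C where "\<And>f. f \<in> H \<Longrightarrow> cmod (\<Lambda> f) \<le> C * norm_H f"
proof (rule ccontr)
  assume "\<not> thesis"
  then have "\<exists>f\<in>H. \<not> cmod (\<Lambda> f) \<le> C * norm_H f" for C using that by blast
  \<comment> \<open>With this constant, scaling \<open>g n\<close> to norm \<open>(1/2) ^ n\<close>
    still leaves a value of modulus above \<open>n\<close>.\<close>
  then have "\<forall>n. \<exists>f\<in>H. \<not> cmod (\<Lambda> f) \<le> (real n * 2 ^ n) * norm_H f" by blast
  then obtain g where g: "\<And>n. g n \<in> H" "\<And>n. real n * 2 ^ n * norm_H (g n) < cmod (\<Lambda> (g n))"
    by (metis not_le)
  have pos: "norm_H (g n) > 0" for n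
  proof -
    have "norm_H (g n) \<noteq> 0" using g(2)[of n] nrm_eq_0[OF g(1), of n] \<Lambda>_zero by auto
    then show ?thesis using nrm_nonneg[OF g(1), of n] by simp
  qed
  define c where "c n = 1 / (2 ^ n * norm_H (g n))" for n
  have c: "c n > 0" for n using pos by (simp add: c_def)
  define f where "f n = fscale (of_real (c n)) (g n)" for n
  have fH: "f n \<in> H" for n unfolding f_def by (intro fscale_mem g)
  have fn: "norm_H (f n) = (1/2) ^ n" for n
  proof -
    have "norm_H (f n) = c n * norm_H (g n)" unfolding f_def nrm_fscale[OF g(1)] using c[of n] by simp
    then show ?thesis using pos[of n] by (simp add: c_def power_divide)
  qed
  have \<Lambda>f: "real n < cmod (\<Lambda> (f n))" for n
  proof -
    have "real n = c n * (real n * 2 ^ n * norm_H (g n))" using pos[of n] by (simp add: c_def)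
    also have "\<dots> < c n * cmod (\<Lambda> (g n))" using g(2) c by (intro mult_strict_left_mono)
    also have "\<dots> = cmod (\<Lambda> (f n))" unfolding f_def \<Lambda>_scale[OF g(1)] using c[of n] by (simp add: norm_mult)
    finally show ?thesis .
  qed
  have sm: "summable (\<lambda>n. (norm_H (f n))\<^sup>2)"
  proof -
    have "(norm_H (f n))\<^sup>2 = (1/4) ^ n" for n
      unfolding fn by (simp add: power2_eq_square flip: power_mult_distrib)
    then show ?thesis by (simp add: summable_geometric)
  qed
  have f0: "f 0 \<noteq> 0" using fn[of 0] nrm_zero by auto
  obtain G h where G: "G \<in> H" "\<forall>n. f n = h n * G" "\<forall>n. \<forall>g\<in>H. h n * g \<in> H \<and> norm_H (h n * g) \<le> norm_H g"
    using factorization[of f 0, OF fH sm f0] by blast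
  have hB: "h n \<in> B" for n
    unfolding bounded_multipliers_def using G(3) by (intro CollectI exI[of _ 1]) simp
  have h1: "cmod (\<Lambda> (h n)) \<le> 1" for n
  proof (rule ccontr)
    assume "\<not> cmod (\<Lambda> (h n)) \<le> 1"
    then have big: "cmod (\<Lambda> (h n)) > 1" by simp
    \<comment> \<open>If the modulus of \<open>\<Lambda> (h n)\<close> exceeded 1, then
      \<open>1 - t h n\<close> would have an inverse in \<open>B\<close> by the Neumann series,
      while \<open>\<Lambda>\<close> vanishes at it and is multiplicative with
      \<open>\<Lambda> 1 = 1\<close>.\<close>
    define t where "t = 1 / \<Lambda> (h n)"
    have nz: "\<Lambda> (h n) \<noteq> 0" using big by auto
    have "1 / cmod (\<Lambda> (h n)) < 1 / 1" by (rule divide_strict_left_mono[OF big]) (use nz in simp_all)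
    then have t: "cmod t * 1 < 1" by (simp only: t_def norm_divide norm_one mult_1_right div_by_1)
    have b1: "h n * g \<in> H" "norm_H (h n * g) \<le> 1 * norm_H g" if "g \<in> H" for g
      using G(3) that by simp_all
    obtain u where u: "u \<in> B" "u * (1 - fscale t (h n)) = 1" using resolvent[OF b1 _ t] by auto
    have m: "1 - fscale t (h n) \<in> H" by (intro diff_mem one_mem fscale_mem B_mem hB)
    have "\<Lambda> (1 - fscale t (h n)) = 1 - t * \<Lambda> (h n)"
      using \<Lambda>_diff[OF one_mem fscale_mem[OF B_mem[OF hB]]] \<Lambda>_scale[OF B_mem[OF hB]] \<Lambda>1 by (simp only:)
    also have "\<dots> = 0" using nz by (simp add: t_def)
    finally have "\<Lambda> (u * (1 - fscale t (h n))) = 0"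
      using mult[OF B_mem[OF u(1)] m] one_mem by (simp only: u(2) mult_zero_right)
    then show False using \<Lambda>1 by (simp only: u(2)) simp
  qed
  obtain n :: nat where n: "cmod (\<Lambda> G) < real n" using reals_Archimedean2 by blast
  have "\<Lambda> (f n) = \<Lambda> (h n) * \<Lambda> G"
    using mult[OF B_mem[OF hB] G(1)] G(2) fH[of n] by metis
  then have "cmod (\<Lambda> (f n)) \<le> 1 * cmod (\<Lambda> G)" by (simp only: norm_mult) (intro mult_right_mono h1 norm_ge_zero)
  then show False using \<Lambda>f[of n] n by simp
qed

lemma multiplicative_one:
  assumes mult: "\<And>f g. f \<in> H \<Longrightarrow> g \<in> H \<Longrightarrow> f * g \<in> H \<Longrightarrow> \<Lambda> (f * g) = \<Lambda> f * \<Lambda> g"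
    and f: "f \<in> H" "\<Lambda> f \<noteq> 0"
  shows "\<Lambda> 1 = 1"
proof -
  have "\<Lambda> f = \<Lambda> f * \<Lambda> 1" using mult[OF f(1) one_mem] f(1) by (simp only: mult_1_right)
  then show ?thesis using f(2) by simp
qed

text \<open>Every multiplier lies in \<open>H\<close> because \<open>1\<close> does, so
  \<open>\<Lambda>\<close> is multiplicative on the products \<open>h * f\<close>. If
  \<open>\<Lambda> f = 0\<close>, the bounded functional \<open>\<Lambda>\<close> vanishes on a set
  whose closure contains \<open>1\<close>.\<close>

lemma multiplicative_nonvanishing:
  assumes mult: "\<And>f g. f \<in> H \<Longrightarrow> g \<in> H \<Longrightarrow> f * g \<in> H \<Longrightarrow> \<Lambda> (f * g) = \<Lambda> f * \<Lambda> g"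
    and \<Lambda>1: "\<Lambda> 1 = 1" and f: "cyclic H ip f"
  shows "\<Lambda> f \<noteq> 0"
proof
  assume 0: "\<Lambda> f = 0"
  have fH: "f \<in> H" using f by (simp add: cyclic_def)
  have sub: "{h * f | h. h \<in> multipliers H} \<subseteq> H" using fH by (auto simp: multipliers_def)
  have one: "1 \<in> clo {h * f | h. h \<in> multipliers H}"
    using f one_mem ip_topology_closure[OF sub] by (simp add: cyclic_def)
  obtain C where C: "\<And>f. f \<in> H \<Longrightarrow> cmod (\<Lambda> f) \<le> C * norm_H f" using multiplicative_bounded[OF mult \<Lambda>1] by blast
  have "1 / (\<bar>C\<bar> + 1) > (0::real)" by (simp add: add_nonneg_pos)
  then obtain v where v: "v \<in> {h * f | h. h \<in> multipliers H}" "norm_H (1 - v) < 1 / (\<bar>C\<bar> + 1)"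
    using clo_D[OF one] by blast
  then obtain h where h: "v = h * f" "h \<in> multipliers H" by blast
  have hm: "h * g \<in> H" if "g \<in> H" for g using h(2) that by (simp add: multipliers_def)
  have "h \<in> H" using hm[OF one_mem] by (simp only: mult_1_right)
  then have \<Lambda>v: "\<Lambda> v = 0" using mult[OF _ fH hm[OF fH]] 0 by (simp only: h(1) mult_zero_right)
  have vH: "v \<in> H" unfolding h(1) by (rule hm[OF fH])
  have "1 = cmod (\<Lambda> (1 - v))" using \<Lambda>_diff[OF one_mem vH] \<Lambda>v \<Lambda>1 by simp
  also have "\<dots> \<le> C * norm_H (1 - v)" by (intro C diff_mem one_mem vH)
  also have "\<dots> \<le> (\<bar>C\<bar> + 1) * norm_H (1 - v)"
    using nrm_nonneg[OF diff_mem[OF one_mem vH]] by (intro mult_right_mono) auto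
  also have "\<dots> < 1" using v(2) by (simp add: field_simps add_nonneg_pos)
  finally show False by simp
qed

end

end

theorem theorem1p2:
  fixes H :: "('x \<Rightarrow> complex) set"
    and ip :: "('x \<Rightarrow> complex) \<Rightarrow> ('x \<Rightarrow> complex) \<Rightarrow> complex"
    and \<Lambda> :: "('x \<Rightarrow> complex) \<Rightarrow> complex"
  assumes "rkhs H ip"
    and "complete_pick_kernel (rep_kernel H ip)"
    and "normalized_kernel (rep_kernel H ip)"
    and "linear_functional_on H \<Lambda>"
    and "\<exists>f\<in>H. \<Lambda> f \<noteq> 0"
  shows "((\<Lambda> 1 = 1 \<and> (\<forall>f. cyclic H ip f \<longrightarrow> \<Lambda> f \<noteq> 0))
            \<longleftrightarrow> (\<forall>f\<in>H. \<forall>g\<in>H. f * g \<in> H \<longrightarrow> \<Lambda> (f * g) = \<Lambda> f * \<Lambda> g))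
       \<and> ((\<Lambda> 1 = 1 \<and> (\<forall>f. cyclic H ip f \<longrightarrow> \<Lambda> f \<noteq> 0))
            \<or> (\<forall>f\<in>H. \<forall>g\<in>H. f * g \<in> H \<longrightarrow> \<Lambda> (f * g) = \<Lambda> f * \<Lambda> g)
          \<longrightarrow> continuous_map (ip_topology H ip) euclidean \<Lambda>)"
    (is "(?i \<longleftrightarrow> ?ii) \<and> (?i \<or> ?ii \<longrightarrow> ?c)")
proof -
  interpret rkhs H ip by fact
  interpret factorization_space H ip "kernel_vec H ip" by (rule factorization_space[OF assms(2,3)])
  note lin = assms(4)
  have 1: ?ii if i: ?i
  proof (intro ballI impI)
    fix f g assume fg: "f \<in> H" "g \<in> H" "f * g \<in> H"
    show "\<Lambda> (f * g) = \<Lambda> f * \<Lambda> g"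
      by (rule multiplicative_of_nonvanishing[OF lin _ _ fg]) (use i orbit_dense_cyclic in blast)+
  qed
  have one: "\<Lambda> 1 = 1" if ii: ?ii
  proof -
    obtain f where "f \<in> H" "\<Lambda> f \<noteq> 0" using assms(5) by blast
    then show ?thesis using multiplicative_one[OF lin, of f] ii by blast
  qed
  have 2: ?i if ii: ?ii
    using one[OF ii] multiplicative_nonvanishing[OF lin _ one[OF ii]] ii by blast
  \<comment> \<open>Under (i) continuity is obtained through (ii).\<close>
  have 3: ?c if ii: ?ii
  proof -
    obtain C where C: "\<And>f. f \<in> H \<Longrightarrow> cmod (\<Lambda> f) \<le> C * nrm ip f"
      using multiplicative_bounded[OF lin _ one[OF ii]] ii by blast
    show ?thesis by (rule bounded_imp_continuous_map[OF \<Lambda>_diff[OF lin] C])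
  qed
  show ?thesis using 1 2 3 by blast
qed

end
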